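(* Let $n \geq 4$. Let $f$ be an automorphism of the graph $L_n$ preserving $O_n$ and $F_n$. Then $f$ is induced by the action of a unique element $\gamma$ of $\mathrm{Out}(W_n)$.
   Context: Let $F=\mathbb{Z}/2\mathbb{Z}$ and let $W_n$ be the free product of $n$ copies of $F$ ($n\geq 2$). Marked graphs of groups. A marked graph of groups is a pair $(X,\rho)$ where $X$ is a graph of groups with fundamental group isomorphic to $W_n$ such that: the underlying graph $\overline{X}$ of $X$ is a finite tree; every edge group is trivial; exactly $n$ vertices have vertex group isomorphic to $F$; all other vertices have trivial vertex group; every vertex with trivial vertex group has degree at least $3$; and $\rho\colon W_n\to\pi_1(X)$ is an isomorphism (the marking). Two marked graphs of groups $(X,\rho)$, $(X',\rho')$ are equivalent if there is an isomorphism of graphs of groups $f\colon X\to X'$ with $f_*\circ\rho=\rho'$ (up to inner automorphisms); equivalently, if their Bass-Serre trees, endowed with the $W_n$-actions given by the markings, are $W_n$-equivariantly isomorphic. Collapse. $Y$ is obtained from $X$ by collapsing a forest of $\overline{X}$ if it is obtained by contracting each component of the forest to a point, with induced marking; here $Y$ is required to satisfy again the conditions above. The spine $K_n$ is the flag simplicial complex whose vertices are the equivalence classes of marked graphs of groups, where two distinct classes are adjacent if they have representatives $X$ and $Y$ such that one is obtained from the other by collapsing a forest. $\mathrm{Aut}(W_n)$ acts on $K_n$ by precomposition of the marking, and this induces an action of $\mathrm{Out}(W_n)$. A $\{0\}$-star is a vertex of $K_n$ represented by a marked graph of groups whose underlying graph has $n+1$ vertices and $n$ leaves. An $F$-star is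 a vertex of $K_n$ represented by a marked graph of groups whose underlying graph has $n$ vertices and $n-1$ leaves. $O_n$ is the set of $\{0\}$-stars and $F_n$ is the set of $F$-stars. The graph $L_n$ is the full subgraph of (the $1$-skeleton of) $K_n$ with vertex set $O_n\cup F_n$; it is invariant under $\mathrm{Out}(W_n)$. *)

theory Defs
  imports
    "HOL-Algebra.Elementary_Groups"
    "HOL-Algebra.Bij"
    "Graph_Theory.Arc_Walk"
    "Graph_Theory.Digraph_Component"
    "Graph_Theory.Bidirected_Digraph"
begin

section \<open>Groups given by generators and relations\<close>

text \<open>The congruence on words over the alphabet \<open>S\<close> generated by the pairs in \<open>R\<close>.\<close>

inductive_set word_cong :: "'a set \<Rightarrow> ('a list \<times> 'a list) set \<Rightarrow> ('a list \<times> 'a list) set"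
  for S :: "'a set" and R :: "('a list \<times> 'a list) set"
where
  refl: "u \<in> lists S \<Longrightarrow> (u, u) \<in> word_cong S R"
| sym: "(u, v) \<in> word_cong S R \<Longrightarrow> (v, u) \<in> word_cong S R"
| trans: "(u, v) \<in> word_cong S R \<Longrightarrow> (v, w) \<in> word_cong S R \<Longrightarrow> (u, w) \<in> word_cong S R"
| rel: "(a, b) \<in> R \<Longrightarrow> a \<in> lists S \<Longrightarrow> b \<in> lists S \<Longrightarrow> x \<in> lists S \<Longrightarrow> y \<in> lists S
    \<Longrightarrow> (x @ a @ y, x @ b @ y) \<in> word_cong S R"

abbreviation word_class :: "'a set \<Rightarrow> ('a list \<times> 'a list) set \<Rightarrow> 'a list \<Rightarrow> 'a list set" where
  "word_class S R u \<equiv> word_cong S R `` {u}"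

text \<open>A presentation as a monoid. It is a group as soon as \<open>R\<close> makes every letter invertible,
  which is the case in both uses below.\<close>

definition presented :: "'a set \<Rightarrow> ('a list \<times> 'a list) set \<Rightarrow> 'a list set monoid" where
  "presented S R =
    \<lparr>carrier = lists S // word_cong S R,
     monoid.mult = (\<lambda>P Q. \<Union>u\<in>P. \<Union>v\<in>Q. word_class S R (u @ v)),
     one = word_class S R []\<rparr>"

definition free_product_letters :: "'i set \<Rightarrow> ('i \<Rightarrow> 'g monoid) \<Rightarrow> ('i \<times> 'g) set" where
  "free_product_letters I G = (SIGMA i:I. carrier (G i))"

definition free_product_rels :: "'i set \<Rightarrow> ('i \<Rightarrow> 'g monoid) \<Rightarrow> (('i \<times> 'g) list \<times> ('i \<times> 'g) list) set"
where
  "free_product_rels I G =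
    {([(i, \<one>\<^bsub>G i\<^esub>)], []) | i. i \<in> I} \<union>
    {([(i, g), (i, h)], [(i, g \<otimes>\<^bsub>G i\<^esub> h)]) | i g h.
       i \<in> I \<and> g \<in> carrier (G i) \<and> h \<in> carrier (G i)}"

definition free_product :: "'i set \<Rightarrow> ('i \<Rightarrow> 'g monoid) \<Rightarrow> ('i \<times> 'g) list set monoid" where
  "free_product I G = presented (free_product_letters I G) (free_product_rels I G)"

abbreviation free_product_class ::
  "'i set \<Rightarrow> ('i \<Rightarrow> 'g monoid) \<Rightarrow> ('i \<times> 'g) list \<Rightarrow> ('i \<times> 'g) list set" where
  "free_product_class I G \<equiv> word_class (free_product_letters I G) (free_product_rels I G)"

abbreviation F :: "int monoid" where
  "F \<equiv> integer_mod_group 2"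

type_synonym W_elt = "(nat \<times> int) list set"

definition W :: "nat \<Rightarrow> W_elt monoid" where
  "W n = free_product {..<n} (\<lambda>_. F)"

definition Inn :: "('a, 'b) monoid_scheme \<Rightarrow> ('a \<Rightarrow> 'a) set" where
  "Inn G = {(\<lambda>x\<in>carrier G. g \<otimes>\<^bsub>G\<^esub> x \<otimes>\<^bsub>G\<^esub> inv\<^bsub>G\<^esub> g) | g. g \<in> carrier G}"

definition Out :: "('a, 'b) monoid_scheme \<Rightarrow> ('a \<Rightarrow> 'a) set monoid" where
  "Out G = AutoGroup G Mod Inn G"


section \<open>Graphs of groups\<close>

text \<open>Graphs are in the sense of Serre: every geometric edge is a pair of opposite arcs
  \<open>e\<close>, \<open>rv e\<close>. The walk \<open>[e, rv e]\<close> is a \<open>cycle\<close> of the digraph but not a circuit of the graph.\<close>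

definition serre_forest :: "('v, 'e) pre_digraph \<Rightarrow> ('e \<Rightarrow> 'e) \<Rightarrow> bool" where
  "serre_forest G rv \<longleftrightarrow> (\<forall>p. pre_digraph.cycle G p \<longrightarrow> (\<exists>e. p = [e, rv e]))"

definition serre_tree :: "('v, 'e) pre_digraph \<Rightarrow> ('e \<Rightarrow> 'e) \<Rightarrow> bool" where
  "serre_tree G rv \<longleftrightarrow> bidirected_digraph G rv \<and> connected G \<and> serre_forest G rv"

text \<open>\<open>emb X e\<close> embeds the group of \<open>e\<close> into the group of the head of \<open>e\<close>.\<close>

record ('v, 'e, 'g, 'h) graph_of_groups =
  graph :: "('v, 'e) pre_digraph"
  rev_arc :: "'e \<Rightarrow> 'e"
  vgroup :: "'v \<Rightarrow> 'g monoid"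
  egroup :: "'e \<Rightarrow> 'h monoid"
  emb :: "'e \<Rightarrow> 'h \<Rightarrow> 'g"

definition is_graph_of_groups :: "('v, 'e, 'g, 'h) graph_of_groups \<Rightarrow> bool" where
  "is_graph_of_groups X \<longleftrightarrow>
     bidirected_digraph (graph X) (rev_arc X) \<and> connected (graph X) \<and>
     (\<forall>v\<in>verts (graph X). group (vgroup X v)) \<and>
     (\<forall>e\<in>arcs (graph X).
        group (egroup X e) \<and> egroup X (rev_arc X e) = egroup X e \<and>
        emb X e \<in> mon (egroup X e) (vgroup X (head (graph X) e)))"

datatype ('v, 'e, 'g) letter = Vert 'v 'g | Edge 'e

definition path_letters :: "('v, 'e, 'g, 'h) graph_of_groups \<Rightarrow> ('v, 'e, 'g) letter set" where
  "path_letters X =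
     {Vert v g | v g. v \<in> verts (graph X) \<and> g \<in> carrier (vgroup X v)} \<union>
     {Edge e | e. e \<in> arcs (graph X)}"

definition path_rels ::
  "('v, 'e, 'g, 'h) graph_of_groups \<Rightarrow> (('v, 'e, 'g) letter list \<times> ('v, 'e, 'g) letter list) set"
where
  "path_rels X =
     {([Vert v \<one>\<^bsub>vgroup X v\<^esub>], []) | v. v \<in> verts (graph X)} \<union>
     {([Vert v g, Vert v h], [Vert v (g \<otimes>\<^bsub>vgroup X v\<^esub> h)]) | v g h.
        v \<in> verts (graph X) \<and> g \<in> carrier (vgroup X v) \<and> h \<in> carrier (vgroup X v)} \<union>
     {([Edge e, Edge (rev_arc X e)], []) | e. e \<in> arcs (graph X)} \<union>
     {([Edge e, Vert (head (graph X) e) (emb X e g)],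
       [Vert (tail (graph X) e) (emb X (rev_arc X e) g), Edge e]) | e g.
        e \<in> arcs (graph X) \<and> g \<in> carrier (egroup X e)}"

definition path_group ::
  "('v, 'e, 'g, 'h) graph_of_groups \<Rightarrow> ('v, 'e, 'g) letter list set monoid" where
  "path_group X = presented (path_letters X) (path_rels X)"

abbreviation path_class ::
  "('v, 'e, 'g, 'h) graph_of_groups \<Rightarrow> ('v, 'e, 'g) letter list \<Rightarrow> ('v, 'e, 'g) letter list set" where
  "path_class X \<equiv> word_class (path_letters X) (path_rels X)"

fun is_path ::
  "('v, 'e, 'g, 'h) graph_of_groups \<Rightarrow> 'v \<Rightarrow> ('v, 'e, 'g) letter list \<Rightarrow> 'v \<Rightarrow> bool" where
  "is_path X u [] w \<longleftrightarrow> u \<in> verts (graph X) \<and> u = w"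
| "is_path X u (Vert v g # p) w \<longleftrightarrow>
     u \<in> verts (graph X) \<and> v = u \<and> g \<in> carrier (vgroup X u) \<and> is_path X u p w"
| "is_path X u (Edge e # p) w \<longleftrightarrow>
     e \<in> arcs (graph X) \<and> tail (graph X) e = u \<and> is_path X (head (graph X) e) p w"

definition fundamental_group ::
  "('v, 'e, 'g, 'h) graph_of_groups \<Rightarrow> 'v \<Rightarrow> ('v, 'e, 'g) letter list set monoid" where
  "fundamental_group X b = (path_group X)\<lparr>carrier := {path_class X p | p. is_path X b p b}\<rparr>"

text \<open>The map of path groups induced by a substitution of words for letters.\<close>

definition induced_map ::
  "('v, 'e, 'g, 'h) graph_of_groups \<Rightarrow> (('u, 'd, 'k) letter \<Rightarrow> ('v, 'e, 'g) letter list)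
     \<Rightarrow> ('u, 'd, 'k) letter list set \<Rightarrow> ('v, 'e, 'g) letter list set" where
  "induced_map Y s P = (\<Union>p\<in>P. path_class Y (concat (map s p)))"

text \<open>Isomorphisms of graphs of groups in the sense of Bass: the homomorphisms of edge and vertex
  groups commute with the embeddings only up to conjugation by prescribed elements \<open>\<delta> e\<close> of the
  vertex groups. The \<open>\<delta> e\<close> are part of the isomorphism and affect the induced map of path groups,
  even if all edge groups are trivial; it is with this notion that isomorphisms correspond to
  equivariant isomorphisms of Bass-Serre trees.\<close>

record ('v, 'e, 'g, 'h) gog_morphism =
  on_verts :: "'v \<Rightarrow> 'v"
  on_arcs :: "'e \<Rightarrow> 'e"
  on_vgroup :: "'v \<Rightarrow> 'g \<Rightarrow> 'g"
  on_egroup :: "'e \<Rightarrow> 'h \<Rightarrow> 'h"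
  twist :: "'e \<Rightarrow> 'g"

definition gog_iso ::
  "('v, 'e, 'g, 'h) graph_of_groups \<Rightarrow> ('v, 'e, 'g, 'h) graph_of_groups
     \<Rightarrow> ('v, 'e, 'g, 'h) gog_morphism \<Rightarrow> bool" where
  "gog_iso X Y f \<longleftrightarrow>
     bij_betw (on_verts f) (verts (graph X)) (verts (graph Y)) \<and>
     bij_betw (on_arcs f) (arcs (graph X)) (arcs (graph Y)) \<and>
     (\<forall>v\<in>verts (graph X). on_vgroup f v \<in> iso (vgroup X v) (vgroup Y (on_verts f v))) \<and>
     (\<forall>e\<in>arcs (graph X).
        tail (graph Y) (on_arcs f e) = on_verts f (tail (graph X) e) \<and>
        head (graph Y) (on_arcs f e) = on_verts f (head (graph X) e) \<and>
        rev_arc Y (on_arcs f e) = on_arcs f (rev_arc X e) \<and>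
        on_egroup f e \<in> iso (egroup X e) (egroup Y (on_arcs f e)) \<and>
        twist f e \<in> carrier (vgroup Y (on_verts f (head (graph X) e))) \<and>
        (\<forall>g\<in>carrier (egroup X e).
           on_egroup f (rev_arc X e) g = on_egroup f e g \<and>
           (let K = vgroup Y (on_verts f (head (graph X) e)) in
            on_vgroup f (head (graph X) e) (emb X e g) =
              twist f e \<otimes>\<^bsub>K\<^esub> emb Y (on_arcs f e) (on_egroup f e g) \<otimes>\<^bsub>K\<^esub> inv\<^bsub>K\<^esub> twist f e)))"

primrec iso_letter ::
  "('v, 'e, 'g, 'h) graph_of_groups \<Rightarrow> ('v, 'e, 'g, 'h) graph_of_groups
     \<Rightarrow> ('v, 'e, 'g, 'h) gog_morphism \<Rightarrow> ('v, 'e, 'g) letter \<Rightarrow> ('v, 'e, 'g) letter list" where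
  "iso_letter X Y f (Vert v g) = [Vert (on_verts f v) (on_vgroup f v g)]"
| "iso_letter X Y f (Edge e) =
     (let s = on_verts f (tail (graph X) e); t = on_verts f (head (graph X) e) in
      [Vert s (twist f (rev_arc X e)), Edge (on_arcs f e), Vert t (inv\<^bsub>vgroup Y t\<^esub> twist f e)])"


section \<open>Marked graphs of groups\<close>

text \<open>The underlying graphs are finite and the vertex groups have at most two elements, so taking
  vertices, arcs and group elements in \<^typ>\<open>nat\<close> loses no isomorphism type. A marking is a map into
  the fundamental group at some base vertex, which the equivalence below forgets; its values
  outside the carrier of \<open>W n\<close> are irrelevant.\<close>

type_synonym nat_gog = "(nat, nat, nat, nat) graph_of_groups"

record marked_gog =
  gog :: nat_gog
  base :: nat
  marking :: "W_elt \<Rightarrow> (nat, nat, nat) letter list set"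

abbreviation ugraph :: "marked_gog \<Rightarrow> (nat, nat) pre_digraph" where
  "ugraph M \<equiv> graph (gog M)"

definition is_marked_gog :: "nat \<Rightarrow> marked_gog \<Rightarrow> bool" where
  "is_marked_gog n M \<longleftrightarrow>
     is_graph_of_groups (gog M) \<and>
     fin_digraph (ugraph M) \<and> serre_tree (ugraph M) (rev_arc (gog M)) \<and>
     (\<forall>e\<in>arcs (ugraph M). trivial_group (egroup (gog M) e)) \<and>
     card {v \<in> verts (ugraph M). vgroup (gog M) v \<cong> F} = n \<and>
     (\<forall>v\<in>verts (ugraph M). \<not> vgroup (gog M) v \<cong> F \<longrightarrow>
        trivial_group (vgroup (gog M) v) \<and> out_degree (ugraph M) v \<ge> 3) \<and>
     base M \<in> verts (ugraph M) \<and>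
     marking M \<in> iso (W n) (fundamental_group (gog M) (base M))"

text \<open>The choice of the path \<open>p\<close> between the base vertices is exactly the ambiguity by inner
  automorphisms.\<close>

definition marked_equiv :: "nat \<Rightarrow> marked_gog \<Rightarrow> marked_gog \<Rightarrow> bool" where
  "marked_equiv n M N \<longleftrightarrow>
     (\<exists>f p. gog_iso (gog M) (gog N) f \<and>
        is_path (gog N) (base N) p (on_verts f (base M)) \<and>
        (let P = path_group (gog N); c = path_class (gog N) p in
         \<forall>w\<in>carrier (W n).
           marking N w =
             c \<otimes>\<^bsub>P\<^esub> induced_map (gog N) (iso_letter (gog M) (gog N) f) (marking M w) \<otimes>\<^bsub>P\<^esub> inv\<^bsub>P\<^esub> c))"

definition marked_rel :: "nat \<Rightarrow> (marked_gog \<times> marked_gog) set" where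
  "marked_rel n = {(M, N). is_marked_gog n M \<and> is_marked_gog n N \<and> marked_equiv n M N}"

text \<open>\<open>N\<close> is obtained from \<open>M\<close> by contracting the components of the forest with arc set \<open>A\<close>, with the
  induced marking. The map \<open>c\<close> contracts the components to vertices, and \<open>d\<close> identifies the
  remaining arcs with those of \<open>N\<close>. The group of a vertex \<open>w\<close> of \<open>N\<close> is the fundamental group of the
  component contracted to \<open>w\<close>, which is the free product of the vertex groups of the component since
  the component is a tree and the edge groups are trivial; \<open>h v\<close> are the canonical maps into it.\<close>

primrec collapse_letter ::
  "nat set \<Rightarrow> (nat \<Rightarrow> nat) \<Rightarrow> (nat \<Rightarrow> nat) \<Rightarrow> (nat \<Rightarrow> nat \<Rightarrow> nat)
     \<Rightarrow> (nat, nat, nat) letter \<Rightarrow> (nat, nat, nat) letter list" where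
  "collapse_letter A c d h (Vert v g) = [Vert (c v) (h v g)]"
| "collapse_letter A c d h (Edge e) = (if e \<in> A then [] else [Edge (d e)])"

definition collapses_to :: "nat \<Rightarrow> marked_gog \<Rightarrow> marked_gog \<Rightarrow> bool" where
  "collapses_to n M N \<longleftrightarrow>
     is_marked_gog n M \<and> is_marked_gog n N \<and>
     (\<exists>A c d h.
        A \<subseteq> arcs (ugraph M) \<and> rev_arc (gog M) ` A \<subseteq> A \<and>
        serre_forest ((ugraph M)\<lparr>arcs := A\<rparr>) (rev_arc (gog M)) \<and>
        c ` verts (ugraph M) = verts (ugraph N) \<and>
        (\<forall>u\<in>verts (ugraph M). \<forall>v\<in>verts (ugraph M).
           c u = c v \<longleftrightarrow> u \<rightarrow>\<^sup>*\<^bsub>(ugraph M)\<lparr>arcs := A\<rparr>\<^esub> v) \<and>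
        bij_betw d (arcs (ugraph M) - A) (arcs (ugraph N)) \<and>
        (\<forall>e\<in>arcs (ugraph M) - A.
           tail (ugraph N) (d e) = c (tail (ugraph M) e) \<and>
           head (ugraph N) (d e) = c (head (ugraph M) e) \<and>
           rev_arc (gog N) (d e) = d (rev_arc (gog M) e)) \<and>
        (\<forall>w\<in>verts (ugraph N).
           let C = {v \<in> verts (ugraph M). c v = w} in
           \<exists>\<theta> \<in> iso (free_product C (vgroup (gog M))) (vgroup (gog N) w).
             \<forall>v\<in>C. \<forall>g\<in>carrier (vgroup (gog M) v).
               h v g = \<theta> (free_product_class C (vgroup (gog M)) [(v, g)])) \<and>
        base N = c (base M) \<and>
        (\<forall>w\<in>carrier (W n).
           marking N w = induced_map (gog N) (collapse_letter A c d h) (marking M w)))"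


section \<open>The spine and the graph L\<close>

definition spine_verts :: "nat \<Rightarrow> marked_gog set set" where
  "spine_verts n = {M. is_marked_gog n M} // marked_rel n"

definition spine_adj :: "nat \<Rightarrow> marked_gog set \<Rightarrow> marked_gog set \<Rightarrow> bool" where
  "spine_adj n x y \<longleftrightarrow>
     x \<noteq> y \<and> (\<exists>M\<in>x. \<exists>N\<in>y. collapses_to n M N \<or> collapses_to n N M)"

text \<open>The simplices of the spine \<open>K_n\<close>.\<close>

definition spine :: "nat \<Rightarrow> marked_gog set set set" where
  "spine n = {S. finite S \<and> S \<noteq> {} \<and> S \<subseteq> spine_verts n \<and>
     (\<forall>x\<in>S. \<forall>y\<in>S. x \<noteq> y \<longrightarrow> spine_adj n x y)}"

definition leaves :: "('v, 'e) pre_digraph \<Rightarrow> 'v set" where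
  "leaves G = {v \<in> verts G. out_degree G v = 1}"

definition zero_stars :: "nat \<Rightarrow> marked_gog set set" where
  "zero_stars n = {x \<in> spine_verts n. \<exists>M\<in>x.
     card (verts (ugraph M)) = n + 1 \<and> card (leaves (ugraph M)) = n}"

definition F_stars :: "nat \<Rightarrow> marked_gog set set" where
  "F_stars n = {x \<in> spine_verts n. \<exists>M\<in>x.
     card (verts (ugraph M)) = n \<and> card (leaves (ugraph M)) = n - 1}"

definition L_verts :: "nat \<Rightarrow> marked_gog set set" where
  "L_verts n = zero_stars n \<union> F_stars n"

definition L_edges :: "nat \<Rightarrow> marked_gog set set set" where
  "L_edges n = {S \<in> spine n. card S = 2 \<and> S \<subseteq> L_verts n}"

definition graph_automorphism :: "'a set \<Rightarrow> 'a set set \<Rightarrow> ('a \<Rightarrow> 'a) \<Rightarrow> bool" where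
  "graph_automorphism V E f \<longleftrightarrow>
     bij_betw f V V \<and> (\<forall>x\<in>V. \<forall>y\<in>V. {f x, f y} \<in> E \<longleftrightarrow> {x, y} \<in> E)"

text \<open>The action of a class \<open>\<gamma>\<close> of automorphisms by precomposition of the marking.\<close>

definition Out_act :: "nat \<Rightarrow> (W_elt \<Rightarrow> W_elt) set \<Rightarrow> marked_gog set \<Rightarrow> marked_gog set" where
  "Out_act n \<gamma> x =
     (\<Union>\<phi>\<in>\<gamma>. \<Union>M\<in>x. marked_rel n `` {M\<lparr>marking := marking M \<circ> \<phi>\<rparr>})"

end

theory Submission
  imports Defs
begin

text \<open>Call the image of the standard generators of \<open>W n\<close> under an automorphism a basis. A \<open>{0}\<close>-star
  is a basis up to order and simultaneous conjugation; an \<open>F\<close>-star is a basis \<open>b\<close> with a distinguished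
  element \<open>b k\<close>, where moreover each \<open>b j\<close> may be conjugated by \<open>b k\<close> independently. A \<open>{0}\<close>-star is
  adjacent to the \<open>n\<close> \<open>F\<close>-stars obtained from it by distinguishing an element, so the stars that share
  the neighbour \<open>k\<close> of \<open>b\<close> arise by conjugating the members of a subset \<open>S\<close> by \<open>b k\<close>, where \<open>S\<close> and its
  complement give the same star.

  As automorphisms act transitively on bases, we may assume that \<open>f\<close> fixes a \<open>{0}\<close>-star \<open>X\<close> and its
  neighbours. The \<open>{0}\<close>-stars at distance two from \<open>X\<close> are labelled by pairs \<open>(i, S)\<close> as above. For
  nonempty \<open>S\<close> and \<open>T\<close>, normalized by \<open>j \<notin> S\<close> and \<open>i \<notin> T\<close>, those with labels \<open>(i, S)\<close> and \<open>(j, T)\<close> lie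
  together with \<open>X\<close> on an 8-cycle iff \<open>S\<close> and \<open>T\<close> are disjoint. So \<open>f\<close> respects disjointness,
  which forces it to fix all \<open>(i, S)\<close>, and then also their neighbours since these lie on the 8-cycles.
  Hence \<open>f\<close> is the identity on a connected component, and L is connected: by Nielsen reduction, every
  basis becomes the standard one under such partial conjugations, up to order.\<close>


section \<open>Presented groups\<close>

text \<open>Stars near that of a basis \<open>c\<close> are told apart mod 2. After partial
  conjugations each member is \<open>w \<otimes> c l \<otimes> inv w\<close> for some
  \<open>w\<close>, and the parities of \<open>w\<close> in the other members of \<open>c\<close>
  form a matrix of which a simultaneous conjugation can only flip whole columns. This matrix
  recovers \<open>S\<close> from \<open>(i, S)\<close> and forces the far part of an 8-cycle to
  consist of the expected conjugations. Parities cannot exclude a common member \<open>l\<close> of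
  \<open>S\<close> and \<open>T\<close>; this takes the comparison of the reduced words
  \<open>j i l i j\<close> and \<open>i j l j i\<close>. Disjointness determines the labels because
  the full set \<open>{..<n} - {i, j}\<close> is the only one that meets every nonempty set. Its
  star is also that of \<open>(i, {j})\<close>, so singletons are preserved, and they detect
  membership. The obstacle is a neighbour \<open>j\<close> of \<open>(i, S)\<close> for which the
  normalized set is full: no nonempty \<open>T\<close> is disjoint from it, so no 8-cycle reaches
  that neighbour. As \<open>n \<ge> 4\<close>, at most one \<open>j\<close> is of this kind, and a
  bijection that matches all other neighbours matches it too.\<close>

declare in_listsD [rule del] in_listsI [rule del]

lemma word_cong_lists: "(u, v) \<in> word_cong S R \<Longrightarrow> u \<in> lists S \<and> v \<in> lists S"
  by (induction rule: word_cong.induct) auto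

lemma equiv_word_cong: "equiv (lists S) (word_cong S R)"
  by (rule equivI)
    (auto simp: refl_on_def sym_def trans_def dest: word_cong_lists
      intro: word_cong.refl word_cong.sym word_cong.trans)

lemma word_cong_append_left:
  "(u, v) \<in> word_cong S R \<Longrightarrow> w \<in> lists S \<Longrightarrow> (w @ u, w @ v) \<in> word_cong S R"
proof (induction rule: word_cong.induct)
  case (rel a b x y)
  then show ?case using word_cong.rel[of a b R S "w @ x" y] by simp
next
  case (refl u)
  then show ?case by (intro word_cong.refl) auto
qed (auto intro: word_cong.sym word_cong.trans)

lemma word_cong_append_right:
  "(u, v) \<in> word_cong S R \<Longrightarrow> w \<in> lists S \<Longrightarrow> (u @ w, v @ w) \<in> word_cong S R"
proof (induction rule: word_cong.induct)
  case (rel a b x y)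
  then show ?case using word_cong.rel[of a b R S x "y @ w"] by simp
next
  case (refl u)
  then show ?case by (intro word_cong.refl) auto
qed (auto intro: word_cong.sym word_cong.trans)

lemma word_cong_append:
  "(u, u') \<in> word_cong S R \<Longrightarrow> (v, v') \<in> word_cong S R \<Longrightarrow> (u @ v, u' @ v') \<in> word_cong S R"
  by (meson word_cong.trans word_cong_append_left word_cong_append_right word_cong_lists)

lemma word_class_eq_iff:
  "u \<in> lists S \<Longrightarrow> v \<in> lists S \<Longrightarrow>
    word_class S R u = word_class S R v \<longleftrightarrow> (u, v) \<in> word_cong S R"
  using eq_equiv_class_iff[OF equiv_word_cong] by blast

lemma word_class_rel:
  "(a, b) \<in> R \<Longrightarrow> a \<in> lists S \<Longrightarrow> b \<in> lists S \<Longrightarrow> word_class S R a = word_class S R b"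
  using word_cong.rel[of a b R S "[]" "[]"] by (simp add: word_class_eq_iff)

lemma presented_carrier: "carrier (presented S R) = {word_class S R u | u. u \<in> lists S}"
  by (auto simp: presented_def quotient_def)

lemma word_class_in_presented [intro]:
  "u \<in> lists S \<Longrightarrow> word_class S R u \<in> carrier (presented S R)"
  by (auto simp: presented_carrier)

lemma presented_one: "\<one>\<^bsub>presented S R\<^esub> = word_class S R []"
  by (simp add: presented_def)

text \<open>Compatibility of the congruence with concatenation makes all classes in the double union
  equal, so the union is that one class.\<close>

lemma presented_mult:
  assumes "u \<in> lists S" "v \<in> lists S"
  shows "word_class S R u \<otimes>\<^bsub>presented S R\<^esub> word_class S R v = word_class S R (u @ v)"
proof -
  have "word_class S R (u' @ v') = word_class S R (u @ v)"
    if "u' \<in> word_class S R u" "v' \<in> word_class S R v" for u' v'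
    using that assms word_cong_append[of u u' S R v v'] word_cong_lists[of u u'] word_cong_lists[of v v']
    by (intro word_class_eq_iff[THEN iffD2]) (auto intro: word_cong.sym)
  moreover have "u \<in> word_class S R u" "v \<in> word_class S R v"
    using assms by (auto intro: word_cong.refl)
  ultimately have "(\<Union>u'\<in>word_class S R u. \<Union>v'\<in>word_class S R v. word_class S R (u' @ v'))
      = word_class S R (u @ v)"
    by blast
  then show ?thesis by (simp add: presented_def)
qed

lemma presented_monoid: "monoid (presented S R)"
  by (rule monoidI) (auto simp: presented_carrier presented_mult presented_one intro: word_class_in_presented)

text \<open>Inverting letters suffices: left inverses of words are concatenated in reverse
  order.\<close>

lemma presented_group:
  assumes "\<And>a. a \<in> S \<Longrightarrow> \<exists>b\<in>lists S. word_class S R (b @ [a]) = word_class S R []"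
  shows "group (presented S R)"
proof (rule groupI)
  interpret monoid "presented S R" by (rule presented_monoid)
  have left_inv: "\<exists>v\<in>lists S. word_class S R (v @ u) = word_class S R []" if "u \<in> lists S" for u
    using that
  proof (induction u)
    case Nil
    then show ?case by (intro bexI[of _ "[]"]) auto
  next
    case (Cons a u)
    then obtain v where v: "v \<in> lists S" "word_class S R (v @ u) = word_class S R []"
      by auto
    obtain b where b: "b \<in> lists S" "word_class S R (b @ [a]) = word_class S R []"
      using assms Cons.hyps by blast
    have "word_class S R ((v @ b) @ a # u)
        = word_class S R v \<otimes>\<^bsub>presented S R\<^esub> (word_class S R (b @ [a]) \<otimes>\<^bsub>presented S R\<^esub> word_class S R u)"
      using v(1) b(1) Cons.hyps by (simp add: presented_mult)
    also have "\<dots> = word_class S R []"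
      unfolding b(2) using v Cons.hyps by (simp add: presented_mult)
    finally show ?case using v b by (intro bexI[of _ "v @ b"]) auto
  qed
  show "\<exists>y\<in>carrier (presented S R). y \<otimes>\<^bsub>presented S R\<^esub> x = \<one>\<^bsub>presented S R\<^esub>"
    if "x \<in> carrier (presented S R)" for x
  proof -
    obtain u where "u \<in> lists S" "x = word_class S R u"
      using \<open>x \<in> _\<close> by (auto simp: presented_carrier)
    moreover obtain v where "v \<in> lists S" "word_class S R (v @ u) = word_class S R []"
      using left_inv[OF \<open>u \<in> lists S\<close>] by auto
    ultimately
    show ?thesis
      by (intro bexI[of _ "word_class S R v"]) (auto simp: presented_one presented_mult)
  qed
qed (auto simp: presented_carrier presented_mult presented_one)

definition word_ev :: "('b, 'm) monoid_scheme \<Rightarrow> ('a \<Rightarrow> 'b) \<Rightarrow> 'a list \<Rightarrow> 'b" where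
  "word_ev H f u = foldr (\<lambda>a x. f a \<otimes>\<^bsub>H\<^esub> x) u \<one>\<^bsub>H\<^esub>"

lemma word_ev_Nil [simp]: "word_ev H f [] = \<one>\<^bsub>H\<^esub>"
  and word_ev_Cons [simp]: "word_ev H f (a # u) = f a \<otimes>\<^bsub>H\<^esub> word_ev H f u"
  by (simp_all add: word_ev_def)

lemma (in monoid) word_ev_closed [simp]:
  "f \<in> S \<rightarrow> carrier G \<Longrightarrow> u \<in> lists S \<Longrightarrow> word_ev G f u \<in> carrier G"
  by (induction u) auto

lemma (in monoid) word_ev_append:
  "f \<in> S \<rightarrow> carrier G \<Longrightarrow> u \<in> lists S \<Longrightarrow> v \<in> lists S
    \<Longrightarrow> word_ev G f (u @ v) = word_ev G f u \<otimes> word_ev G f v"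
proof (induction u)
  case Nil
  then show ?case using word_ev_closed[of f S v] by simp
next
  case (Cons a u)
  then show ?case
    using word_ev_closed[of f S u] word_ev_closed[of f S v] by (auto simp: m_assoc Pi_iff)
qed

definition respects_rels ::
  "('b, 'm) monoid_scheme \<Rightarrow> ('a \<Rightarrow> 'b) \<Rightarrow> 'a set \<Rightarrow> ('a list \<times> 'a list) set \<Rightarrow> bool" where
  "respects_rels H f S R \<longleftrightarrow> f \<in> S \<rightarrow> carrier H \<and>
    (\<forall>(a, b)\<in>R. a \<in> lists S \<longrightarrow> b \<in> lists S \<longrightarrow> word_ev H f a = word_ev H f b)"

lemma (in monoid) word_ev_cong:
  assumes "respects_rels G f S R"
  shows "(u, v) \<in> word_cong S R \<Longrightarrow> word_ev G f u = word_ev G f v"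
proof (induction rule: word_cong.induct)
  case (rel a b x y)
  moreover have f: "f \<in> S \<rightarrow> carrier G" using assms by (simp add: respects_rels_def)
  ultimately have "word_ev G f a = word_ev G f b" using assms by (auto simp: respects_rels_def)
  then show ?case using rel by (simp add: word_ev_append[OF f])
qed auto

definition presented_lift :: "('b, 'm) monoid_scheme \<Rightarrow> ('a \<Rightarrow> 'b) \<Rightarrow> 'a list set \<Rightarrow> 'b" where
  "presented_lift H f P = word_ev H f (SOME u. u \<in> P)"

lemma (in monoid) presented_lift_class:
  assumes "respects_rels G f S R" "u \<in> lists S"
  shows "presented_lift G f (word_class S R u) = word_ev G f u"
proof -
  have "u \<in> word_class S R u" using assms by (auto intro: word_cong.refl)
  then have "(SOME w. w \<in> word_class S R u) \<in> word_class S R u" by (rule someI)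
  then show ?thesis
    using word_ev_cong[OF assms(1)] unfolding presented_lift_def by (metis Image_singleton_iff)
qed

lemma (in monoid) presented_lift_hom:
  assumes "respects_rels G f S R"
  shows "presented_lift G f \<in> hom (presented S R) G"
proof -
  have f: "f \<in> S \<rightarrow> carrier G" using assms by (simp add: respects_rels_def)
  show ?thesis
    by (auto intro!: homI simp: presented_carrier presented_mult presented_lift_class[OF assms]
        word_ev_closed[OF f] word_ev_append[OF f])
qed

lemma word_ev_class:
  assumes "u \<in> lists S" "\<And>a. a \<in> S \<Longrightarrow> s a \<in> lists S'"
  shows "word_ev (presented S' R') (\<lambda>a. word_class S' R' (s a)) u
    = word_class S' R' (concat (map s u))"
  using assms(1)
proof (induction u)
  case Nil
  then show ?case by (simp add: presented_one)
next
  case (Cons a u)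
  moreover have "concat (map s u) \<in> lists S'"
    using Cons.hyps(2) assms(2) by (induction u) auto
  ultimately show ?case using assms(2) by (simp add: presented_mult)
qed

text \<open>The left side has the shape of \<open>induced_map\<close>. The substitution respects the
  relations, so all representatives contribute the same class, and the union is the value of the
  homomorphism given by the universal property.\<close>

lemma Union_word_class:
  assumes "respects_rels (presented S' R') (\<lambda>a. word_class S' R' (s a)) S R" "u \<in> lists S"
    and s: "\<And>a. a \<in> S \<Longrightarrow> s a \<in> lists S'"
  shows "(\<Union>p\<in>word_class S R u. word_class S' R' (concat (map s p)))
    = presented_lift (presented S' R') (\<lambda>a. word_class S' R' (s a)) (word_class S R u)"
proof -
  have "word_class S' R' (concat (map s p)) = word_class S' R' (concat (map s u))"
    if "p \<in> word_class S R u" for p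
  proof -
    have "p \<in> lists S" "(u, p) \<in> word_cong S R" using that word_cong_lists[of u p S R] by auto
    then show ?thesis
      using monoid.word_ev_cong[OF presented_monoid assms(1), of u p] assms(2)
        word_ev_class[of _ S s S', OF _ s] by simp
  qed
  moreover have "u \<in> word_class S R u" using assms by (auto intro: word_cong.refl)
  ultimately have "(\<Union>p\<in>word_class S R u. word_class S' R' (concat (map s p)))
      = word_class S' R' (concat (map s u))" by blast
  then show ?thesis
    using assms by (simp add: monoid.presented_lift_class[OF presented_monoid] word_ev_class)
qed

lemma hom_presented_class:
  assumes "monoid H" "h \<in> hom (presented S R) H" "h \<one>\<^bsub>presented S R\<^esub> = \<one>\<^bsub>H\<^esub>" "u \<in> lists S"
  shows "h (word_class S R u) = word_ev H (\<lambda>a. h (word_class S R [a])) u"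
  using assms(4)
proof (induction u)
  case Nil
  then show ?case using assms by (simp add: presented_one)
next
  case (Cons a u)
  have "h (word_class S R ([a] @ u)) = h (word_class S R [a]) \<otimes>\<^bsub>H\<^esub> h (word_class S R u)"
    using Cons.hyps assms(2)
    by (subst presented_mult[symmetric]) (auto intro!: hom_mult)
  then show ?case using Cons by simp
qed

lemma hom_presented_eq:
  assumes "group (presented S R)" "group H" "h \<in> hom (presented S R) H" "k \<in> hom (presented S R) H"
    and eq: "\<And>a. a \<in> S \<Longrightarrow> h (word_class S R [a]) = k (word_class S R [a])"
    and "x \<in> carrier (presented S R)"
  shows "h x = k x"
proof -
  obtain u where u: "u \<in> lists S" "x = word_class S R u" using assms(6) by (auto simp: presented_carrier)
  have "word_ev H (\<lambda>a. h (word_class S R [a])) u = word_ev H (\<lambda>a. k (word_class S R [a])) u"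
    using u(1) eq by (induction u) auto
  then show ?thesis
    using u assms hom_presented_class[of H h S R u] hom_presented_class[of H k S R u]
    by (simp add: hom_one group.is_monoid)
qed

section \<open>Free products\<close>

lemma free_product_rels_cases:
  assumes "(a, b) \<in> free_product_rels I G"
  obtains i where "i \<in> I" "a = [(i, \<one>\<^bsub>G i\<^esub>)]" "b = []"
  | i g h where "i \<in> I" "g \<in> carrier (G i)" "h \<in> carrier (G i)" "a = [(i, g), (i, h)]"
      "b = [(i, g \<otimes>\<^bsub>G i\<^esub> h)]"
  using assms unfolding free_product_rels_def by auto

lemma free_product_class_one:
  "group (G i) \<Longrightarrow> i \<in> I \<Longrightarrow> free_product_class I G [(i, \<one>\<^bsub>G i\<^esub>)] = free_product_class I G []"
  by (rule word_class_rel)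
    (auto simp: free_product_rels_def free_product_letters_def group.is_monoid monoid.one_closed)

lemma free_product_class_mult:
  "group (G i) \<Longrightarrow> i \<in> I \<Longrightarrow> g \<in> carrier (G i) \<Longrightarrow> h \<in> carrier (G i) \<Longrightarrow>
    free_product_class I G [(i, g), (i, h)] = free_product_class I G [(i, g \<otimes>\<^bsub>G i\<^esub> h)]"
  by (rule word_class_rel)
    (auto simp: free_product_rels_def free_product_letters_def group.is_monoid monoid.m_closed)

lemma free_product_group:
  assumes "\<And>i. i \<in> I \<Longrightarrow> group (G i)"
  shows "group (free_product I G)"
  unfolding free_product_def
proof (rule presented_group)
  fix a assume "a \<in> free_product_letters I G"
  then obtain i g where a: "a = (i, g)" "i \<in> I" "g \<in> carrier (G i)"
    by (auto simp: free_product_letters_def)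
  interpret group "G i" using a assms by auto
  show "\<exists>b\<in>lists (free_product_letters I G). free_product_class I G (b @ [a]) = free_product_class I G []"
    using a free_product_class_mult[of G i I "inv\<^bsub>G i\<^esub> g" g] free_product_class_one[of G i I]
    by (intro bexI[of _ "[(i, inv\<^bsub>G i\<^esub> g)]"]) (auto simp: free_product_letters_def group_axioms)
qed

lemma free_product_inj_hom:
  assumes "group (G i)" "i \<in> I"
  shows "(\<lambda>g. free_product_class I G [(i, g)]) \<in> hom (G i) (free_product I G)"
proof (rule homI)
  fix g h assume g: "g \<in> carrier (G i)" "h \<in> carrier (G i)"
  then show "free_product_class I G [(i, g \<otimes>\<^bsub>G i\<^esub> h)]
    = free_product_class I G [(i, g)] \<otimes>\<^bsub>free_product I G\<^esub> free_product_class I G [(i, h)]"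
    unfolding free_product_def using assms free_product_class_mult[of G i I g h]
    by (subst presented_mult) (auto simp: free_product_letters_def)
qed (use assms in \<open>auto simp: free_product_def free_product_letters_def\<close>)

lemma free_product_lift:
  assumes "\<And>i. i \<in> I \<Longrightarrow> group (G i)" "group H" and hom: "\<And>i. i \<in> I \<Longrightarrow> \<phi> i \<in> hom (G i) H"
  obtains h where "h \<in> hom (free_product I G) H"
    "\<And>i g. i \<in> I \<Longrightarrow> g \<in> carrier (G i) \<Longrightarrow> h (free_product_class I G [(i, g)]) = \<phi> i g"
proof
  interpret H: group H by fact
  have r: "respects_rels H (case_prod \<phi>) (free_product_letters I G) (free_product_rels I G)"
    unfolding respects_rels_def
  proof (intro conjI ballI)
    show "case_prod \<phi> \<in> free_product_letters I G \<rightarrow> carrier H"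
      using hom by (auto simp: free_product_letters_def hom_def)
    fix ab assume "ab \<in> free_product_rels I G"
    then obtain a b where "ab = (a, b)" "(a, b) \<in> free_product_rels I G" by (cases ab) auto
    then show "case ab of (a, b) \<Rightarrow> a \<in> lists (free_product_letters I G) \<longrightarrow> b \<in> lists (free_product_letters I G)
        \<longrightarrow> word_ev H (case_prod \<phi>) a = word_ev H (case_prod \<phi>) b"
      using assms hom_in_carrier[OF hom] hom_one[OF hom] hom_mult[OF hom]
      by (auto elim!: free_product_rels_cases)
  qed
  show "presented_lift H (case_prod \<phi>) \<in> hom (free_product I G) H"
    unfolding free_product_def by (rule H.presented_lift_hom[OF r])
  show "presented_lift H (case_prod \<phi>) (free_product_class I G [(i, g)]) = \<phi> i g"
    if "i \<in> I" "g \<in> carrier (G i)" for i g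
    using that hom_in_carrier[OF hom]
    by (subst H.presented_lift_class[OF r]) (auto simp: free_product_letters_def)
qed

lemma free_product_hom_eq:
  assumes "\<And>i. i \<in> I \<Longrightarrow> group (G i)" "group H" "h \<in> hom (free_product I G) H" "k \<in> hom (free_product I G) H"
    and "\<And>i g. i \<in> I \<Longrightarrow> g \<in> carrier (G i) \<Longrightarrow>
      h (free_product_class I G [(i, g)]) = k (free_product_class I G [(i, g)])"
    and "x \<in> carrier (free_product I G)"
  shows "h x = k x"
  using assms free_product_group[of I G] unfolding free_product_def
  by (intro hom_presented_eq[of _ _ H h k x]) (auto simp: free_product_letters_def)

text \<open>The retraction onto \<open>G i\<close> that kills the other factors sends the class of
  \<open>g\<close> back to \<open>g\<close>. It gives the injectivity of the maps \<open>h v\<close>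
  of a collapse.\<close>

lemma free_product_class_neq_one:
  assumes "\<And>i. i \<in> I \<Longrightarrow> group (G i)" "i \<in> I" "g \<in> carrier (G i)"
    "free_product_class I G [(i, g)] = \<one>\<^bsub>free_product I G\<^esub>"
  shows "g = \<one>\<^bsub>G i\<^esub>"
proof -
  interpret group "G i" using assms by auto
  have "(if j = i then (\<lambda>g. g) else (\<lambda>_. \<one>\<^bsub>G i\<^esub>)) \<in> hom (G j) (G i)" if "j \<in> I" for j
    by (auto intro!: homI)
  then obtain h where h: "h \<in> hom (free_product I G) (G i)"
    "\<And>j g. j \<in> I \<Longrightarrow> g \<in> carrier (G j) \<Longrightarrow> h (free_product_class I G [(j, g)])
      = (if j = i then (\<lambda>g. g) else (\<lambda>_. \<one>\<^bsub>G i\<^esub>)) g"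
    using free_product_lift[of I G "G i" "\<lambda>j. if j = i then (\<lambda>g. g) else (\<lambda>_. \<one>\<^bsub>G i\<^esub>)"] assms(1)
      group_axioms by blast
  then show ?thesis
    using assms hom_one[OF h(1)] free_product_group[of I G] group_axioms by force
qed

text \<open>The retraction onto \<open>G v\<close> inverts the inclusion, because letters from the
  other factors are identities. This is the situation of a contracted edge one of whose ends has
  trivial group.\<close>

lemma free_product_iso_factor:
  assumes G: "\<And>i. i \<in> I \<Longrightarrow> group (G i)" and v: "v \<in> I" and triv: "\<And>i. i \<in> I \<Longrightarrow> i \<noteq> v \<Longrightarrow> trivial_group (G i)"
  shows "\<exists>\<theta>\<in>iso (free_product I G) (G v). \<forall>i\<in>I. \<forall>g\<in>carrier (G i).
    \<theta> (free_product_class I G [(i, g)]) = (if i = v then g else \<one>\<^bsub>G v\<^esub>)"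
proof -
  interpret group "G v" using v G by auto
  have "(if j = v then (\<lambda>g. g) else (\<lambda>_. \<one>\<^bsub>G v\<^esub>)) \<in> hom (G j) (G v)" if "j \<in> I" for j
    by (auto intro!: homI)
  then obtain h where h: "h \<in> hom (free_product I G) (G v)"
    "\<And>j g. j \<in> I \<Longrightarrow> g \<in> carrier (G j) \<Longrightarrow> h (free_product_class I G [(j, g)])
      = (if j = v then (\<lambda>g. g) else (\<lambda>_. \<one>\<^bsub>G v\<^esub>)) g"
    using free_product_lift[of I G "G v" "\<lambda>j. if j = v then (\<lambda>g. g) else (\<lambda>_. \<one>\<^bsub>G v\<^esub>)"] G
      group_axioms by blast
  let ?k = "\<lambda>g. free_product_class I G [(v, g)]"
  have k: "?k \<in> hom (G v) (free_product I G)" using free_product_inj_hom[of G v I] G v by auto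
  note fg = free_product_group[of I G, OF G]
  have kh: "?k (h x) = x" if "x \<in> carrier (free_product I G)" for x
  proof (rule free_product_hom_eq[of I G "free_product I G" "?k \<circ> h" "\<lambda>x. x" x, simplified o_def])
    fix i g assume i: "i \<in> I" "g \<in> carrier (G i)"
    show "?k (h (free_product_class I G [(i, g)])) = free_product_class I G [(i, g)]"
    proof (cases "i = v")
      case False
      then have "g = \<one>\<^bsub>G i\<^esub>" using triv[of i] i by (auto simp: trivial_group_def)
      then have "h (free_product_class I G [(i, g)]) = \<one>\<^bsub>G v\<^esub>" using False i h(2) by simp
      then show ?thesis using False i v \<open>g = _\<close>
        free_product_class_one[of G v I, OF G[OF v] v] free_product_class_one[of G i I, OF G] by simp
    qed (use h i in auto)
  qed (use that G fg Group.hom_compose[OF h(1) k] in \<open>auto simp: o_def iso_set_refl iso_imp_homomorphism\<close>)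
  have hk: "h (?k g) = g" if "g \<in> carrier (G v)" for g using that h v by simp
  have "bij_betw h (carrier (free_product I G)) (carrier (G v))"
    by (rule bij_betw_byWitness[of _ ?k])
      (use kh hk h(1) k in \<open>auto simp: hom_def\<close>)
  then have "h \<in> iso (free_product I G) (G v)" using h(1) by (simp add: iso_def)
  then show ?thesis using h(2) by (intro bexI[of _ h]) auto
qed


section \<open>The group \<open>W n\<close>\<close>

definition gen :: "nat \<Rightarrow> nat \<Rightarrow> W_elt" where
  "gen n j = free_product_class {..<n} (\<lambda>_. F) [(j, 1)]"

lemma F_carrier: "carrier F = {0, 1}"
  by (auto simp: carrier_integer_mod_group)

lemma W_group: "group (W n)"
  unfolding W_def by (rule free_product_group) simp

text \<open>Van der Waerden's method: the generator \<open>i\<close> acts on reduced words by left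
  multiplication followed by cancellation. The words with \<open>distinct_adj\<close> are the normal
  forms.\<close>

fun cancel_step :: "nat \<Rightarrow> nat list \<Rightarrow> nat list" where
  "cancel_step i [] = [i]"
| "cancel_step i (j # r) = (if i = j then r else i # j # r)"

definition W_act :: "nat \<times> int \<Rightarrow> nat list \<Rightarrow> nat list" where
  "W_act a r = (if snd a = 0 then r else cancel_step (fst a) r)"

lemma distinct_adj_cancel_step: "distinct_adj r \<Longrightarrow> distinct_adj (cancel_step i r)"
  by (cases r) (auto dest: distinct_adj_ConsD)

text \<open>Reducedness is essential: two steps turn \<open>i # i # s\<close> into
  \<open>s\<close>.\<close>

lemma cancel_step_cancel_step: "distinct_adj r \<Longrightarrow> cancel_step i (cancel_step i r) = r"
  by (cases r; cases "tl r") auto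

lemma set_cancel_step: "set (cancel_step i r) \<subseteq> insert i (set r)"
  by (cases r) auto

lemma distinct_adj_W_act: "distinct_adj r \<Longrightarrow> distinct_adj (foldr W_act u r)"
  by (induction u) (auto simp: W_act_def distinct_adj_cancel_step)

text \<open>Both sides of each defining relation act alike on reduced words, and this passes on to
  congruent words.\<close>

lemma W_act_cong:
  "(u, v) \<in> word_cong (free_product_letters I (\<lambda>_. F)) (free_product_rels I (\<lambda>_. F)) \<Longrightarrow>
    distinct_adj r \<Longrightarrow> foldr W_act u r = foldr W_act v r"
proof (induction arbitrary: r rule: word_cong.induct)
  case (rel a b x y)
  have "foldr W_act a s = foldr W_act b s" if "distinct_adj s" for s
    using rel(1) that unfolding free_product_rels_def
    by (auto simp: F_carrier W_act_def cancel_step_cancel_step)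
  then show ?case using rel.prems by (simp add: distinct_adj_W_act)
qed auto

locale universal_coxeter =
  fixes n :: nat and G :: "W_elt monoid" (structure)
  defines "G \<equiv> W n"

sublocale universal_coxeter \<subseteq> group G
  unfolding G_def by (rule W_group)

context universal_coxeter
begin

abbreviation x :: "nat \<Rightarrow> W_elt" where "x \<equiv> gen n"

lemma x_closed [simp]: "j < n \<Longrightarrow> x j \<in> carrier G"
  unfolding gen_def G_def W_def free_product_def
  by (rule word_class_in_presented) (auto simp: free_product_letters_def F_carrier)

lemma x_x [simp]: "j < n \<Longrightarrow> x j \<otimes> x j = \<one>"
  using free_product_class_mult[of "\<lambda>_. F" j "{..<n}" 1 1] free_product_class_one[of "\<lambda>_. F" j "{..<n}"]
  unfolding gen_def G_def W_def free_product_def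
  by (subst presented_mult) (auto simp: free_product_letters_def F_carrier presented_one)

lemma hom_ext:
  assumes "group H" "h \<in> hom G H" "k \<in> hom G H" "\<And>j. j < n \<Longrightarrow> h (x j) = k (x j)" "g \<in> carrier G"
  shows "h g = k g"
proof -
  interpret H: group H by fact
  have "h \<one> = k \<one>" using assms hom_one[OF assms(2)] hom_one[OF assms(3)] is_group by simp
  moreover have "free_product_class {..<n} (\<lambda>_. F) [(j, 0)] = \<one>" if "j < n" for j
    using free_product_class_one[of "\<lambda>_. F" j "{..<n}"] that
    by (simp add: G_def W_def free_product_def presented_one)
  ultimately have "h (free_product_class {..<n} (\<lambda>_. F) [(i, e)]) = k (free_product_class {..<n} (\<lambda>_. F) [(i, e)])"
    if "i \<in> {..<n}" "e \<in> carrier F" for i e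
    using assms(4)[of i] that unfolding F_carrier gen_def by auto
  then show ?thesis
    using assms(1-3,5) unfolding G_def W_def
    by - (rule free_product_hom_eq[of "{..<n}" "\<lambda>_. F" H h k], simp_all)
qed

lemma lift:
  assumes "group H" "\<And>j. j < n \<Longrightarrow> y j \<in> carrier H" "\<And>j. j < n \<Longrightarrow> y j \<otimes>\<^bsub>H\<^esub> y j = \<one>\<^bsub>H\<^esub>"
  obtains h where "h \<in> hom G H" "\<And>j. j < n \<Longrightarrow> h (x j) = y j"
proof -
  interpret H: group H by fact
  have "(\<lambda>g. if g = 0 then \<one>\<^bsub>H\<^esub> else y j) \<in> hom F H" if "j < n" for j
    using that assms by (auto intro!: homI simp: F_carrier)
  then obtain h where "h \<in> hom (free_product {..<n} (\<lambda>_. F)) H"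
    "\<And>i g. i < n \<Longrightarrow> g \<in> carrier F \<Longrightarrow>
      h (free_product_class {..<n} (\<lambda>_. F) [(i, g)]) = (if g = 0 then \<one>\<^bsub>H\<^esub> else y i)"
    using free_product_lift[of "{..<n}" "\<lambda>_. F" H "\<lambda>j g. if g = 0 then \<one>\<^bsub>H\<^esub> else y j", OF _ assms(1)]
    by (metis (lifting) group_integer_mod_group lessThan_iff)
  then show ?thesis using that[of h] by (auto simp: F_carrier gen_def G_def W_def)
qed

abbreviation wval :: "nat list \<Rightarrow> W_elt" where "wval \<equiv> word_ev G x"

lemma wval_closed [simp]: "set r \<subseteq> {..<n} \<Longrightarrow> wval r \<in> carrier G"
  by (induction r) auto

lemma wval_append:
  "set r \<subseteq> {..<n} \<Longrightarrow> set s \<subseteq> {..<n} \<Longrightarrow> wval (r @ s) = wval r \<otimes> wval s"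
  by (rule word_ev_append[of _ "{..<n}"]) (auto simp: in_lists_conv_set)

lemma wval_rev: "set r \<subseteq> {..<n} \<Longrightarrow> wval r \<otimes> wval (rev r) = \<one>"
proof (induction r)
  case (Cons i r)
  then have i: "i < n" "set r \<subseteq> {..<n}" by auto
  then have "wval (i # r) \<otimes> wval (rev (i # r)) = x i \<otimes> (wval r \<otimes> wval (rev r)) \<otimes> x i"
    by (simp add: wval_append) (simp add: m_assoc)
  also have "\<dots> = \<one>" using Cons.IH[OF i(2)] i by simp
  finally show ?case .
qed simp

lemma wval_cancel_step:
  "set r \<subseteq> {..<n} \<Longrightarrow> i < n \<Longrightarrow> wval (cancel_step i r) = x i \<otimes> wval r"
proof (cases r)
  case (Cons j s)
  assume "set r \<subseteq> {..<n}" "i < n"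
  then show ?thesis using Cons m_assoc[of "x i" "x i" "wval s", symmetric] by auto
qed auto

lemma wval_class:
  "set r \<subseteq> {..<n} \<Longrightarrow> wval r = free_product_class {..<n} (\<lambda>_. F) (map (\<lambda>i. (i, 1)) r)"
  unfolding G_def W_def free_product_def gen_def
  by (subst word_ev_class[of r "{..<n}" "\<lambda>i. [(i, 1)]"])
    (auto simp: in_lists_conv_set free_product_letters_def F_carrier concat_map_singleton o_def)

text \<open>A reduced word acting on the empty word returns itself, so it can be recovered from its
  class.\<close>

lemma reduced_unique:
  assumes "distinct_adj r" "set r \<subseteq> {..<n}" "distinct_adj s" "set s \<subseteq> {..<n}" "wval r = wval s"
  shows "r = s"
proof -
  have "foldr W_act (map (\<lambda>i. (i, 1)) t) [] = t" if "distinct_adj t" for t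
    using that
  proof (induction t)
    case (Cons i t)
    then show ?case by (cases t) (auto simp: W_act_def)
  qed auto
  moreover have "(map (\<lambda>i. (i, 1)) r, map (\<lambda>i. (i, 1)) s)
      \<in> word_cong (free_product_letters {..<n} (\<lambda>_. F)) (free_product_rels {..<n} (\<lambda>_. F))"
  proof (subst word_class_eq_iff[symmetric])
    show "free_product_class {..<n} (\<lambda>_. F) (map (\<lambda>i. (i, 1)) r)
        = free_product_class {..<n} (\<lambda>_. F) (map (\<lambda>i. (i, 1)) s)"
      using assms by (simp add: wval_class[symmetric])
  qed (use assms in \<open>auto simp: in_lists_conv_set free_product_letters_def F_carrier\<close>)
  ultimately show ?thesis using W_act_cong[of "map (\<lambda>i. (i, 1)) r" "map (\<lambda>i. (i, 1)) s" "{..<n}" "[]"] assms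
    by simp
qed

lemma reduced_exists:
  assumes "g \<in> carrier G"
  obtains r where "distinct_adj r" "set r \<subseteq> {..<n}" "g = wval r"
proof -
  obtain u where u: "u \<in> lists (free_product_letters {..<n} (\<lambda>_. F))"
    "g = free_product_class {..<n} (\<lambda>_. F) u"
    using assms by (auto simp: G_def W_def free_product_def presented_carrier)
  have "\<exists>r. distinct_adj r \<and> set r \<subseteq> {..<n} \<and> free_product_class {..<n} (\<lambda>_. F) u = wval r"
    using u(1)
  proof (induction u)
    case Nil
    then show ?case by (intro exI[of _ "[]"]) (simp add: G_def W_def free_product_def presented_one)
  next
    case (Cons a u)
    then obtain r where r: "distinct_adj r" "set r \<subseteq> {..<n}" "free_product_class {..<n} (\<lambda>_. F) u = wval r"
      by auto
    obtain i e where a: "a = (i, e)" "i < n" "e = 0 \<or> e = 1"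
      using Cons.hyps by (auto simp: free_product_letters_def F_carrier)
    have "free_product_class {..<n} (\<lambda>_. F) ([a] @ u) = free_product_class {..<n} (\<lambda>_. F) [a] \<otimes> wval r"
      unfolding r(3)[symmetric] unfolding G_def W_def free_product_def using Cons.hyps
      by (subst presented_mult) auto
    moreover have "free_product_class {..<n} (\<lambda>_. F) [a] = (if e = 0 then \<one> else x i)"
      using a free_product_class_one[of "\<lambda>_. F" i "{..<n}"]
      by (auto simp: gen_def G_def W_def free_product_def presented_one)
    ultimately show ?case
      using r a set_cancel_step[of i r]
      by (intro exI[of _ "if e = 0 then r else cancel_step i r"])
        (auto simp: distinct_adj_cancel_step wval_cancel_step)
  qed
  then show ?thesis using that u by auto
qed

lemma wval_inv: "set r \<subseteq> {..<n} \<Longrightarrow> inv wval r = wval (rev r)"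
  using wval_rev[of "rev r"] by (intro inv_equality) auto

lemma x_neq_one: "j < n \<Longrightarrow> x j \<noteq> \<one>"
  using reduced_unique[of "[j]" "[]"] by auto

lemma x_inj: "i < n \<Longrightarrow> j < n \<Longrightarrow> x i = x j \<Longrightarrow> i = j"
  using reduced_unique[of "[i]" "[j]"] by auto

text \<open>After splitting off a leading \<open>l\<close>, the element is given by a word
  \<open>s\<close> such that \<open>l # s\<close> is reduced and \<open>wval s\<close> commutes with
  \<open>x l\<close>. Uniqueness of normal forms yields \<open>s @ [l] = l # s\<close>, so
  \<open>s\<close> would start with \<open>l\<close> unless it is empty.\<close>

lemma centralizer_x:
  assumes "g \<in> carrier G" "l < n" "g \<otimes> x l = x l \<otimes> g"
  shows "g = \<one> \<or> g = x l"
proof -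
  have *: "s = []" if s: "distinct_adj (l # s)" "set s \<subseteq> {..<n}" "wval s \<otimes> x l = x l \<otimes> wval s" for s
  proof (cases s rule: rev_cases)
    case (snoc t k)
    have "wval (s @ [l]) = wval (l # s)" using s assms(2) by (simp add: wval_append)
    moreover have "set (l # s) \<subseteq> {..<n}" using s assms by auto
    \<comment> \<open>If \<open>s\<close> ended in \<open>l\<close>, cancellation would leave the
      shorter reduced word \<open>t\<close> with the same value as \<open>l # s\<close>.\<close>
    moreover have False if "k = l"
    proof -
      have "wval (s @ [l]) = wval t \<otimes> (x l \<otimes> x l)"
        using snoc s that assms(2) by (simp add: wval_append m_assoc)
      moreover have "wval (s @ [l]) = wval s \<otimes> x l" using s assms(2) by (simp add: wval_append)
      ultimately have "wval t = wval (l # s)" using s snoc assms(2) by simp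
      moreover have "distinct_adj t" using s(1) snoc by (auto simp: distinct_adj_append_iff distinct_adj_Cons)
      ultimately have "t = l # s" using s snoc assms(2) by (intro reduced_unique) auto
      then show False using snoc by auto
    qed
    then have "distinct_adj (s @ [l])" using s(1) snoc
      by (auto simp: distinct_adj_append_iff distinct_adj_Cons)
    ultimately have "s @ [l] = l # s" using s assms(2) by (intro reduced_unique) auto
    then show ?thesis using s(1) by (cases s) auto
  qed simp
  obtain r where r: "distinct_adj r" "set r \<subseteq> {..<n}" "g = wval r" using reduced_exists assms by blast
  show ?thesis
  proof (cases "r \<noteq> [] \<and> hd r = l")
    case True
    then obtain s where s: "r = l # s" by (cases r) auto
    have "wval s \<otimes> x l = x l \<otimes> wval s"
    proof -
      have g: "g = x l \<otimes> wval s" using r s by simp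
      have "x l \<otimes> (wval s \<otimes> x l) = x l \<otimes> (x l \<otimes> wval s)"
        using assms(3) g r s assms(2) by (simp add: m_assoc)
      then show ?thesis using r s assms(2) by simp
    qed
    then have "s = []" using * r s by auto
    then show ?thesis using r s assms by simp
  next
    case False
    then have "distinct_adj (l # r)" using r(1) by (cases r) auto
    then have "r = []" using * r assms by simp
    then show ?thesis using r by simp
  qed
qed

text \<open>The reduced word of an involution equals its reversal. A nonempty palindrome of even
  length has two equal letters in the middle, so a reduced one has odd length and a single middle
  letter.\<close>

lemma involution_conj_x:
  assumes "g \<in> carrier G" "g \<otimes> g = \<one>" "g \<noteq> \<one>"
  obtains u j where "set u \<subseteq> {..<n}" "j < n" "g = wval (u @ [j] @ rev u)"
proof -
  obtain r where r: "distinct_adj r" "set r \<subseteq> {..<n}" "g = wval r" using reduced_exists assms by blast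
  have "inv g = g" using assms by (intro inv_equality) auto
  then have rev: "rev r = r" using r wval_inv[of r] by (intro reduced_unique) auto
  define m where "m = length r div 2"
  have len: "length r = 2 * m + 1"
  proof (rule ccontr)
    assume "length r \<noteq> 2 * m + 1"
    then have l: "length r = 2 * m" unfolding m_def by presburger
    have "r \<noteq> []" using r assms by auto
    then have m: "m > 0" using l by (cases m) auto
    have "r ! (m - 1) = rev r ! (m - 1)" by (simp add: rev)
    also have "\<dots> = r ! m" using l m by (simp add: rev_nth)
    finally have "r ! (m - 1) = r ! Suc (m - 1)" using m by simp
    then show False using r(1) l m
      unfolding distinct_adj_conv_nth by (metis Suc_diff_1 lessI less_add_same_cancel2 less_trans_Suc mult_2)
  qed
  define u where "u = take m r"
  have "r = take m r @ [r ! m] @ drop (Suc m) r" using len by (simp add: id_take_nth_drop)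
  moreover have "drop (Suc m) r = rev (take m r)"
  proof -
    have "rev (take m r) = rev (take m (rev r))" by (simp add: rev)
    then show ?thesis using len by (simp add: rev_take)
  qed
  ultimately have "r = u @ [r ! m] @ rev u" by (simp add: u_def)
  moreover have "r ! m \<in> set r" using len by auto
  moreover have "set u \<subseteq> set r" by (simp add: u_def set_take_subset)
  ultimately show ?thesis using that[of u "r ! m"] r by auto
qed

end

section \<open>Bases of \<open>W n\<close>\<close>

lemma (in group) inv_self: "b \<in> carrier G \<Longrightarrow> b \<otimes> b = \<one> \<Longrightarrow> inv b = b"
  by (rule inv_equality)

lemma (in group) conj_iso: "c \<in> carrier G \<Longrightarrow> (\<lambda>g. c \<otimes> g \<otimes> inv c) \<in> iso G G"
proof -
  assume c: "c \<in> carrier G"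
  have "(c \<otimes> g \<otimes> inv c) \<otimes> (c \<otimes> h \<otimes> inv c) = c \<otimes> (g \<otimes> h) \<otimes> inv c"
    if "g \<in> carrier G" "h \<in> carrier G" for g h
  proof -
    have "(c \<otimes> g \<otimes> inv c) \<otimes> (c \<otimes> h \<otimes> inv c) = c \<otimes> g \<otimes> (inv c \<otimes> c) \<otimes> h \<otimes> inv c"
      using c that by (simp only: m_assoc m_closed inv_closed)
    then show ?thesis using c that by (simp add: m_assoc)
  qed
  then show ?thesis
    using c unfolding iso_def
    by (auto intro!: homI bij_betw_byWitness[of _ "\<lambda>g. inv c \<otimes> g \<otimes> c"] simp: m_assoc)
      (simp_all add: m_assoc[symmetric])
qed

lemma (in group) conj_mult:
  "c \<in> carrier G \<Longrightarrow> g \<in> carrier G \<Longrightarrow> h \<in> carrier G \<Longrightarrow>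
    (c \<otimes> g \<otimes> inv c) \<otimes> (c \<otimes> h \<otimes> inv c) = c \<otimes> (g \<otimes> h) \<otimes> inv c"
  using conj_iso[of c] by (auto simp: iso_def hom_def)

lemma (in group) conj_conj:
  "c \<in> carrier G \<Longrightarrow> d \<in> carrier G \<Longrightarrow> g \<in> carrier G \<Longrightarrow>
    c \<otimes> (d \<otimes> g \<otimes> inv d) \<otimes> inv c = (c \<otimes> d) \<otimes> g \<otimes> inv (c \<otimes> d)"
  by (simp add: inv_mult_group m_assoc)

context universal_coxeter
begin

definition basis :: "(nat \<Rightarrow> W_elt) \<Rightarrow> bool" where
  "basis b \<longleftrightarrow> (\<exists>\<psi>\<in>iso G G. \<forall>j<n. b j = \<psi> (x j))"

lemma basisE:
  assumes "basis b"
  obtains \<psi> where "\<psi> \<in> iso G G" "\<And>j. j < n \<Longrightarrow> b j = \<psi> (x j)"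
  using assms by (auto simp: basis_def)

lemma basis_closed [simp]: "basis b \<Longrightarrow> j < n \<Longrightarrow> b j \<in> carrier G"
  by (metis basisE hom_in_carrier iso_imp_homomorphism x_closed)

lemma basis_square [simp]: "basis b \<Longrightarrow> j < n \<Longrightarrow> b j \<otimes> b j = \<one>"
proof -
  assume "basis b" "j < n"
  then obtain \<psi> where "\<psi> \<in> hom G G" "b j = \<psi> (x j)" using basisE iso_imp_homomorphism by metis
  then show ?thesis using hom_mult[of \<psi> G G "x j" "x j"] hom_one[of \<psi> G G] \<open>j < n\<close> is_group by simp
qed

lemma basis_inv [simp]: "basis b \<Longrightarrow> j < n \<Longrightarrow> inv b j = b j"
  by (simp add: inv_self)

lemma basis_x: "basis x"
  unfolding basis_def by (intro bexI[of _ "\<lambda>g. g"]) (auto simp: iso_set_refl)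

lemma basis_cong: "basis b \<Longrightarrow> (\<And>j. j < n \<Longrightarrow> b' j = b j) \<Longrightarrow> basis b'"
  by (auto simp: basis_def)

lemma basis_pull_back:
  assumes "basis b"
  obtains \<psi> where "\<psi> \<in> iso G G" "\<And>j. j < n \<Longrightarrow> \<psi> (b j) = x j"
proof -
  obtain \<psi> where p: "\<psi> \<in> iso G G" "\<And>j. j < n \<Longrightarrow> b j = \<psi> (x j)" using basisE assms by blast
  show ?thesis
  proof
    show "inv_into (carrier G) \<psi> \<in> iso G G" using p(1) by (rule iso_set_sym)
    show "\<And>j. j < n \<Longrightarrow> inv_into (carrier G) \<psi> (b j) = x j"
      using p by (auto simp: iso_def bij_betw_def inv_into_f_f)
  qed
qed

lemma basis_hom_ext:
  assumes "basis b" "group H" "h \<in> hom G H" "k \<in> hom G H" "\<And>j. j < n \<Longrightarrow> h (b j) = k (b j)" "g \<in> carrier G"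
  shows "h g = k g"
proof -
  obtain \<psi> where p: "\<psi> \<in> iso G G" "\<And>j. j < n \<Longrightarrow> b j = \<psi> (x j)" using basisE assms by blast
  obtain g' where g': "g' \<in> carrier G" "g = \<psi> g'" using p(1) assms(6) by (auto simp: iso_def bij_betw_def)
  have "(h \<circ> \<psi>) g' = (k \<circ> \<psi>) g'"
    by (rule hom_ext[of H])
      (use assms(2,3,4,5) p(2)[symmetric] g' Group.hom_compose[OF iso_imp_homomorphism[OF p(1)]]
        in \<open>simp_all add: o_def\<close>)
  then show ?thesis using g' by simp
qed

lemma basis_lift:
  assumes "basis b" "group H" "\<And>j. j < n \<Longrightarrow> y j \<in> carrier H" "\<And>j. j < n \<Longrightarrow> y j \<otimes>\<^bsub>H\<^esub> y j = \<one>\<^bsub>H\<^esub>"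
  obtains h where "h \<in> hom G H" "\<And>j. j < n \<Longrightarrow> h (b j) = y j"
proof -
  obtain h where h: "h \<in> hom G H" "\<And>j. j < n \<Longrightarrow> h (x j) = y j" using lift[of H y] assms by blast
  obtain \<psi> where p: "\<psi> \<in> iso G G" "\<And>j. j < n \<Longrightarrow> \<psi> (b j) = x j" using basis_pull_back assms by blast
  show ?thesis using that[of "h \<circ> \<psi>"] h p Group.hom_compose[OF iso_imp_homomorphism[OF p(1)] h(1)] by auto
qed

lemma basis_centralizer:
  assumes "basis b" "g \<in> carrier G" "l < n" "g \<otimes> b l = b l \<otimes> g"
  shows "g = \<one> \<or> g = b l"
proof -
  obtain \<psi> where p: "\<psi> \<in> iso G G" "\<And>j. j < n \<Longrightarrow> \<psi> (b j) = x j" using basis_pull_back assms by blast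
  then have hom: "\<psi> \<in> hom G G" and inj: "inj_on \<psi> (carrier G)" by (auto simp: iso_def bij_betw_def)
  have "\<psi> (g \<otimes> b l) = \<psi> (b l \<otimes> g)" by (simp add: assms)
  then have "\<psi> g \<otimes> x l = x l \<otimes> \<psi> g"
    using assms(1-3) p(2)[of l] hom_mult[OF hom, of g "b l"] hom_mult[OF hom, of "b l" g] by simp
  then have "\<psi> g = \<psi> \<one> \<or> \<psi> g = \<psi> (b l)"
    using centralizer_x[of "\<psi> g" l] assms p hom_in_carrier[OF hom] hom_one[OF hom] is_group by simp
  then show ?thesis using inj_onD[OF inj, of g] assms(1-3) by (metis basis_closed one_closed)
qed

lemma basis_neq_one: "basis b \<Longrightarrow> j < n \<Longrightarrow> b j \<noteq> \<one>"
  by (metis basis_pull_back hom_one is_group iso_imp_homomorphism x_neq_one)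

lemma basis_inj: "basis b \<Longrightarrow> i < n \<Longrightarrow> j < n \<Longrightarrow> b i = b j \<Longrightarrow> i = j"
  by (metis basis_pull_back x_inj)

lemma basis_centralizer2:
  assumes "basis b" "g \<in> carrier G" "i < n" "j < n" "i \<noteq> j"
    "g \<otimes> b i = b i \<otimes> g" "g \<otimes> b j = b j \<otimes> g"
  shows "g = \<one>"
  using assms basis_centralizer[of b g i] basis_centralizer[of b g j] basis_inj[of b i j] by auto

text \<open>Pulled back to the generators, both sides are reduced words of length five with
  different first letters. This is the obstruction to a common member \<open>l\<close> of
  \<open>S\<close> and \<open>T\<close> on an 8-cycle.\<close>

lemma basis_not_commuting:
  assumes "basis b" "i < n" "j < n" "l < n" "i \<noteq> j" "i \<noteq> l" "j \<noteq> l"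
  shows "b j \<otimes> (b i \<otimes> b l \<otimes> b i) \<otimes> b j \<noteq> b i \<otimes> (b j \<otimes> b l \<otimes> b j) \<otimes> b i"
proof
  assume eq: "b j \<otimes> (b i \<otimes> b l \<otimes> b i) \<otimes> b j = b i \<otimes> (b j \<otimes> b l \<otimes> b j) \<otimes> b i"
  obtain \<psi> where p: "\<psi> \<in> iso G G" "\<And>j. j < n \<Longrightarrow> \<psi> (b j) = x j" using basis_pull_back assms by blast
  then have hom: "\<psi> \<in> hom G G" by (auto simp: iso_def)
  have "wval [j, i, l, i, j] = wval [i, j, l, j, i]"
    using arg_cong[OF eq, of \<psi>] assms p by (simp add: hom_mult[OF hom] m_assoc)
  then have "[j, i, l, i, j] = [i, j, l, j, i]" using assms by (intro reduced_unique) auto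
  then show False using assms by simp
qed

text \<open>\<open>par\<close> is the exponent sum of \<open>b m\<close> mod 2, that is, the
  homomorphism to \<open>F\<close> with value 1 on \<open>b m\<close> and 0 on the other
  members.\<close>

lemma basis_parity:
  assumes "basis b" "m < n"
  obtains par :: "W_elt \<Rightarrow> bool" where
    "\<And>g h. g \<in> carrier G \<Longrightarrow> h \<in> carrier G \<Longrightarrow> par (g \<otimes> h) \<longleftrightarrow> par g \<noteq> par h"
    "\<And>j. j < n \<Longrightarrow> par (b j) \<longleftrightarrow> j = m"
proof -
  obtain h where h: "h \<in> hom G F" "\<And>j. j < n \<Longrightarrow> h (b j) = (if j = m then 1 else 0)"
    by (rule basis_lift[of b F "\<lambda>j. if j = m then 1 else 0"]) (use assms in \<open>auto simp: F_carrier\<close>)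
  show ?thesis
  proof (rule that[of "\<lambda>g. h g = 1"])
    fix g k assume g: "g \<in> carrier G" "k \<in> carrier G"
    then show "h (g \<otimes> k) = 1 \<longleftrightarrow> (h g = 1) \<noteq> (h k = 1)"
      using hom_in_carrier[OF h(1), of g] hom_in_carrier[OF h(1), of k] hom_mult[OF h(1), of g k]
      by (auto simp: F_carrier)
  qed (use h in auto)
qed

lemma basis_image: "basis b \<Longrightarrow> \<phi> \<in> iso G G \<Longrightarrow> basis (\<phi> \<circ> b)"
  unfolding basis_def by (metis (no_types, lifting) comp_apply iso_set_trans)

text \<open>Homomorphisms are determined on a basis, so \<open>\<phi>\<close> and
  \<open>\<psi>\<close> are inverse to each other on all of \<open>G\<close>.\<close>

lemma basisI_inverse:
  assumes "basis b" "\<phi> \<in> hom G G" "\<psi> \<in> hom G G"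
    "\<And>j. j < n \<Longrightarrow> \<psi> (\<phi> (b j)) = b j" "\<And>j. j < n \<Longrightarrow> \<phi> (\<psi> (b j)) = b j"
  shows "basis (\<phi> \<circ> b)"
proof (rule basis_image)
  have "\<psi> (\<phi> g) = g" "\<phi> (\<psi> g) = g" if "g \<in> carrier G" for g
    using basis_hom_ext[OF assms(1) is_group, of "\<psi> \<circ> \<phi>" "\<lambda>g. g" g]
      basis_hom_ext[OF assms(1) is_group, of "\<phi> \<circ> \<psi>" "\<lambda>g. g" g]
      Group.hom_compose[OF assms(2,3)] Group.hom_compose[OF assms(3,2)] that assms iso_set_refl[of G]
    by (auto simp: iso_def)
  then have "bij_betw \<phi> (carrier G) (carrier G)"
    using hom_in_carrier[OF assms(2)] hom_in_carrier[OF assms(3)]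
    by (intro bij_betw_byWitness[of _ \<psi>]) auto
  then show "\<phi> \<in> iso G G" using assms by (simp add: iso_def)
qed fact

lemma basis_permute:
  assumes "basis b" "\<sigma> permutes {..<n}"
  shows "basis (b \<circ> \<sigma>)"
proof -
  have s: "\<sigma> j < n \<longleftrightarrow> j < n" "inv_into UNIV \<sigma> j < n \<longleftrightarrow> j < n" for j
    using permutes_in_image[OF assms(2)] permutes_in_image[OF permutes_inv[OF assms(2)]] by auto
  obtain h where h: "h \<in> hom G G" "\<And>j. j < n \<Longrightarrow> h (b j) = b (\<sigma> j)"
    using basis_lift[OF assms(1) is_group, of "b \<circ> \<sigma>"] assms(1) s by auto
  obtain k where k: "k \<in> hom G G" "\<And>j. j < n \<Longrightarrow> k (b j) = b (inv_into UNIV \<sigma> j)"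
    using basis_lift[OF assms(1) is_group, of "b \<circ> inv_into UNIV \<sigma>"] assms(1) s by auto
  have "basis (h \<circ> b)"
    using h k s permutes_inverses[OF assms(2)] by (intro basisI_inverse[OF assms(1) h(1) k(1)]) auto
  then show ?thesis by (rule basis_cong) (simp add: h)
qed

text \<open>Subtracting \<open>i\<close> from \<open>S\<close> keeps the conjugating element itself
  fixed. For a basis \<open>b i\<close> is an involution and takes the place of its inverse on the
  right.\<close>

definition partial_conj :: "nat \<Rightarrow> nat set \<Rightarrow> (nat \<Rightarrow> W_elt) \<Rightarrow> nat \<Rightarrow> W_elt" where
  "partial_conj i S b = (\<lambda>l. if l \<in> S - {i} then b i \<otimes> b l \<otimes> b i else b l)"

text \<open>The endomorphism \<open>h\<close> fixes \<open>b i\<close> and conjugates the chosen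
  members by it, so it is its own inverse.\<close>

lemma basis_partial_conj:
  assumes "basis b" "i < n"
  shows "basis (partial_conj i S b)"
proof -
  have sq: "b i \<otimes> (b i \<otimes> g) = g" if "g \<in> carrier G" for g
    using that assms by (simp add: m_assoc[symmetric])
  have invol: "b i \<otimes> (b i \<otimes> g \<otimes> b i) \<otimes> b i = g" if "g \<in> carrier G" for g
    using that assms sq by (simp add: m_assoc)
  have "b i \<otimes> b l \<otimes> b i \<otimes> (b i \<otimes> b l \<otimes> b i) = \<one>" if "l < n" for l
    using that assms sq[of "b l \<otimes> b i"] m_assoc[of "b l" "b l" "b i", symmetric] by (simp add: m_assoc)
  then obtain h where h: "h \<in> hom G G" "\<And>j. j < n \<Longrightarrow> h (b j) = partial_conj i S b j"
    by - (rule basis_lift[OF assms(1) is_group, of "partial_conj i S b"],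
      use assms in \<open>simp_all add: partial_conj_def\<close>)
  have "basis (h \<circ> b)"
    using assms h invol hom_mult[OF h(1)]
    by (intro basisI_inverse[OF assms(1) h(1) h(1)]) (auto simp: partial_conj_def)
  then show ?thesis by (rule basis_cong) (simp add: h)
qed

lemma partial_conj_partial_conj:
  assumes "basis b" "i < n" "l < n"
  shows "partial_conj i S (partial_conj i S b) l = b l"
proof -
  have "b i \<otimes> (b i \<otimes> g) = g" if "g \<in> carrier G" for g
    using that assms by (simp add: m_assoc[symmetric])
  then show ?thesis using assms by (auto simp: partial_conj_def m_assoc)
qed

section \<open>Nielsen reduction to the standard basis\<close>

inductive connected_to_x :: "(nat \<Rightarrow> W_elt) \<Rightarrow> bool" where
  start: "(\<And>j. j < n \<Longrightarrow> b j = x j) \<Longrightarrow> connected_to_x b"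
| move: "connected_to_x b \<Longrightarrow> i < n \<Longrightarrow> (\<And>j. j < n \<Longrightarrow> b' j = partial_conj i S b j) \<Longrightarrow> connected_to_x b'"

text \<open>A repeated letter inside \<open>u\<close> cancels together with its mirror image in
  \<open>rev u\<close>. If the repetition is at the end, \<open>u\<close> ends in \<open>j\<close>,
  and \<open>x j\<close> cubed is \<open>x j\<close>.\<close>

lemma conj_word_shorten:
  assumes "\<not> distinct_adj (u @ [j])" "set u \<subseteq> {..<n}" "j < n"
  obtains v where "length v < length u" "set v \<subseteq> {..<n}" "wval (v @ [j] @ rev v) = wval (u @ [j] @ rev u)"
proof -
  obtain k where k: "Suc k < length (u @ [j])" "(u @ [j]) ! k = (u @ [j]) ! Suc k"
    using assms(1) by (auto simp: distinct_adj_conv_nth)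
  define a p where "a = u ! k" and "p = take k u"
  have ka: "k < length u" using k by simp
  have p: "set p \<subseteq> {..<n}" using assms by (auto simp: p_def dest: in_set_takeD)
  have a: "a < n" using assms ka nth_mem[OF ka] unfolding a_def by blast
  have pa: "u = p @ a # drop (Suc k) u" unfolding p_def a_def using ka by (rule id_take_nth_drop)
  have aa: "x a \<otimes> (x a \<otimes> g) = g" if "g \<in> carrier G" for g
    using that a by (simp add: m_assoc[symmetric])
  show ?thesis
  proof (cases "Suc k < length u")
    case False
    then have "u = p @ [a]" "a = j" using pa k ka by (auto simp: a_def nth_append)
    then show ?thesis using that[of p] p a aa[of "x a \<otimes> wval (rev p)"] by (simp add: wval_append m_assoc)
  next
    case True
    then have "drop (Suc k) u = a # drop (Suc (Suc k)) u"
      using k by (simp add: a_def nth_append Cons_nth_drop_Suc)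
    moreover define q where "q = drop (Suc (Suc k)) u"
    ultimately have u: "u = p @ a # a # q" using pa by simp
    then have q: "set q \<subseteq> {..<n}" using assms by auto
    have "wval (u @ [j] @ rev u)
      = wval p \<otimes> (x a \<otimes> (x a \<otimes> (wval q \<otimes> (x j \<otimes> (wval (rev q) \<otimes> (x a \<otimes> (x a \<otimes> wval (rev p))))))))"
      using u p q a assms(3) by (simp add: wval_append m_assoc)
    also have "\<dots> = wval ((p @ q) @ [j] @ rev (p @ q))"
      using aa p q a assms(3) by (simp add: wval_append)
    finally show ?thesis using that[of "p @ q"] u p q by simp
  qed
qed

lemma common_prefix_split:
  obtains c s t where "u = c @ s" "v = c @ t" "s = [] \<or> t = [] \<or> hd s \<noteq> hd t"
proof (induction u arbitrary: v thesis)
  case Nil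
  then show ?case by (metis append_Nil)
next
  case (Cons a u)
  show ?case
  proof (cases "v \<noteq> [] \<and> hd v = a")
    case True
    then obtain w where "v = a # w" by (cases v) auto
    then show ?thesis using Cons.IH[of w] Cons.prems by (metis append_Cons)
  next
    case False
    then show ?thesis using Cons.prems[of "[]" "a # u" v] by auto
  qed
qed

text \<open>Between consecutive factors only the common prefix of \<open>u k\<close> and
  \<open>u j\<close> cancels, so the middle letters survive. Hence the reduced form of a product
  still ends in the middle letter and the second half of its last factor.\<close>

lemma no_prefix_product:
  assumes u: "\<And>j. j < n \<Longrightarrow> set (u j) \<subseteq> {..<n}" "\<And>j. j < n \<Longrightarrow> distinct_adj (u j @ [j])"
    and b: "\<And>j. j < n \<Longrightarrow> b j = wval (u j @ [j] @ rev (u j))"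
    and no_prefix: "\<And>i j r. i < n \<Longrightarrow> j < n \<Longrightarrow> i \<noteq> j \<Longrightarrow> u j \<noteq> u i @ [i] @ r"
    and "js \<noteq> []" "distinct_adj js" "set js \<subseteq> {..<n}"
  shows "\<exists>v. word_ev G b js = wval (v @ [last js] @ rev (u (last js))) \<and> set v \<subseteq> {..<n} \<and>
    distinct_adj (v @ [last js] @ rev (u (last js)))"
  using assms(5-)
proof (induction js rule: rev_induct)
  case (snoc j js)
  have b_closed: "b \<in> {..<n} \<rightarrow> carrier G"
    using u b by (auto intro!: wval_closed)
  have j: "j < n" using snoc by simp
  have rev_u: "distinct_adj (i # rev (u i))" if "i < n" for i
    using u(2)[OF that] by (metis distinct_adj_rev rev.simps(2) rev_rev_ident rev_append rev_singleton_conv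
      append_Cons append_Nil rev_is_rev_conv)
  show ?case
  proof (cases "js = []")
    case True
    have "distinct_adj ((u j @ [j]) @ rev (u j))"
      using u(2)[OF j] rev_u[OF j] by (auto simp: distinct_adj_append_iff distinct_adj_Cons)
    then show ?thesis using True b j u by (intro exI[of _ "u j"]) (auto intro!: r_one wval_closed)
  next
    case False
    define k where "k = last js"
    have js: "distinct_adj js" "set js \<subseteq> {..<n}" "k \<noteq> j" "k < n"
      using snoc.prems False last_in_set[OF False] by (auto simp: distinct_adj_append_iff k_def subset_iff)
    then obtain v where v: "word_ev G b js = wval (v @ [k] @ rev (u k))" "set v \<subseteq> {..<n}"
      "distinct_adj (v @ [k] @ rev (u k))"
      using snoc.IH False by (auto simp: k_def)
    obtain c s t where cst: "u k = c @ s" "u j = c @ t" "s = [] \<or> t = [] \<or> hd s \<noteq> hd t"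
      by (rule common_prefix_split)
    have sets: "set c \<subseteq> {..<n}" "set s \<subseteq> {..<n}" "set t \<subseteq> {..<n}"
      using u(1)[OF j] u(1)[OF js(4)] cst by auto
    have "word_ev G b (js @ [j]) = wval (v @ [k] @ rev (u k)) \<otimes> wval (u j @ [j] @ rev (u j))"
      using js j b v(1) b_closed u(1)[OF j]
      by (subst word_ev_append[OF b_closed]) (auto simp: in_lists_conv_set intro!: r_one wval_closed)
    also have "\<dots> = wval (v @ [k] @ rev s) \<otimes> (wval (rev c) \<otimes> wval c) \<otimes> wval (t @ [j] @ rev (u j))"
      using v(2) js j sets unfolding cst by (simp add: wval_append m_assoc)
    also have "\<dots> = wval ((v @ [k] @ rev s @ t) @ [j] @ rev (u j))"
      using v(2) js j sets wval_rev[of "rev c"] u(1)[OF j] by (simp add: wval_append m_assoc)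
    finally have 1: "word_ev G b (js @ [j]) = wval ((v @ [k] @ rev s @ t) @ [j] @ rev (u j))" .
    have vks: "distinct_adj (v @ [k] @ rev s)"
      using v(3) distinct_adj_appendD1[of "v @ [k] @ rev s" "rev c"] unfolding cst by simp
    have tju: "distinct_adj (t @ [j] @ rev (u j))"
      using u(2)[OF j] rev_u[OF j] unfolding cst(2)
      by (auto simp: distinct_adj_append_iff distinct_adj_Cons)
    \<comment> \<open>These are the letters that meet after the cancellation of \<open>c\<close>.
      They differ by maximality of the common prefix if \<open>s\<close> and \<open>t\<close> are
      nonempty, by \<open>no_prefix\<close> if exactly one of them is empty, and since
      \<open>k \<noteq> j\<close> if both are.\<close>
    have "last ([k] @ rev s) \<noteq> hd (t @ [j])"
    proof (cases s)
      case Nil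
      show ?thesis
      proof (cases t)
        case (Cons d t')
        then show ?thesis using no_prefix[of k j t'] Nil cst js j by auto
      qed (use Nil js in auto)
    next
      case s: (Cons a s')
      show ?thesis
      proof (cases t)
        case Nil
        then show ?thesis using no_prefix[of j k s'] s cst js j by auto
      qed (use s cst in auto)
    qed
    then have "distinct_adj ((v @ [k] @ rev s) @ (t @ [j] @ rev (u j)))"
      using vks tju by (subst distinct_adj_append_iff) (auto simp: hd_append split: if_splits)
    then show ?thesis using 1 v(2) js sets
      by (intro exI[of _ "v @ [k] @ rev s @ t"]) auto
  qed
qed simp

lemma basis_word:
  assumes "basis b" "g \<in> carrier G"
  obtains js where "distinct_adj js" "set js \<subseteq> {..<n}" "g = word_ev G b js"
proof -
  obtain \<psi> where p: "\<psi> \<in> iso G G" "\<And>j. j < n \<Longrightarrow> b j = \<psi> (x j)" using basisE assms by blast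
  then have hom: "\<psi> \<in> hom G G" by (auto simp: iso_def)
  obtain g' where g': "g' \<in> carrier G" "g = \<psi> g'" using p(1) assms by (auto simp: iso_def bij_betw_def)
  obtain r where r: "distinct_adj r" "set r \<subseteq> {..<n}" "g' = wval r" using reduced_exists g' by blast
  have "\<psi> (wval r) = word_ev G b r"
    using r(2) by (induction r) (auto simp: hom_mult[OF hom] hom_one[OF hom is_group is_group] p)
  then show ?thesis using that r g' by auto
qed

text \<open>Nielsen reduction: if \<open>u i @ [i]\<close> is a prefix of \<open>u j\<close>, then conjugating \<open>b j\<close> by \<open>b i\<close> shortens
  it; if there is no such prefix, products of the \<open>b j\<close> are too long to be generators.\<close>

lemma connected_to_x_words:
  assumes "basis b" "\<And>j. j < n \<Longrightarrow> set (u j) \<subseteq> {..<n}"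
    and "\<And>j. j < n \<Longrightarrow> b j = wval (u j @ [j] @ rev (u j))"
  shows "connected_to_x b"
  using assms
proof (induction "\<Sum>j<n. length (u j)" arbitrary: b u rule: less_induct)
  case less
  have upd: "(\<Sum>l<n. length ((u(j := w)) l)) < (\<Sum>l<n. length (u l))" if "j < n" "length w < length (u j)" for j w
    using that by (intro sum_strict_mono_ex1) auto
  consider (shorten) j where "j < n" "\<not> distinct_adj (u j @ [j])"
    | (prefix) i j r where "i < n" "j < n" "i \<noteq> j" "u j = u i @ [i] @ r"
    | (reduced) "\<And>j. j < n \<Longrightarrow> distinct_adj (u j @ [j])"
      "\<And>i j r. i < n \<Longrightarrow> j < n \<Longrightarrow> i \<noteq> j \<Longrightarrow> u j \<noteq> u i @ [i] @ r"
    by blast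
  then show ?case
  proof cases
    case shorten
    then obtain v where v: "length v < length (u j)" "set v \<subseteq> {..<n}"
      "wval (v @ [j] @ rev v) = wval (u j @ [j] @ rev (u j))"
      using conj_word_shorten less.prems(2) by metis
    show ?thesis
      by (rule less.hyps[of "u(j := v)"]) (use v shorten upd less.prems in auto)
  next
    case prefix
    define b' where "b' = partial_conj i {j} b"
    \<comment> \<open>In \<open>b i \<otimes> b j\<close> the part \<open>[i] @ rev (u i)\<close> of
      \<open>b i\<close> cancels against the prefix \<open>u i @ [i]\<close> of \<open>u j\<close>.
      What remains in front of \<open>j\<close> is \<open>u i @ r\<close>, one letter shorter than
      \<open>u j\<close>.\<close>
    let ?v = "u i @ r"
    have sets: "set (u i) \<subseteq> {..<n}" "set r \<subseteq> {..<n}" using less.prems(2)[of i] less.prems(2)[of j] prefix by auto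
    have cancel: "g \<otimes> (inv g \<otimes> h) = h" "inv g \<otimes> (g \<otimes> h) = h" if "g \<in> carrier G" "h \<in> carrier G" for g h
      using that by (simp_all add: m_assoc[symmetric])
    have xx: "x i \<otimes> (x i \<otimes> g) = g" if "g \<in> carrier G" for g
      using that prefix by (simp add: m_assoc[symmetric])
    have "b i \<otimes> b j \<otimes> b i = wval (?v @ [j] @ rev ?v)"
      using prefix sets less.prems(3)[of i] less.prems(3)[of j]
      by (simp add: wval_append wval_inv[symmetric] m_assoc cancel xx)
    then have "b' l = wval ((u(j := ?v)) l @ [l] @ rev ((u(j := ?v)) l))" if "l < n" for l
      using prefix less.prems(3) that by (auto simp: b'_def partial_conj_def)
    then have "connected_to_x b'"
      using upd[of j ?v] prefix sets less.prems basis_partial_conj[of b i "{j}"]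
      by (intro less.hyps[of "u(j := ?v)" b']) (auto simp: b'_def)
    \<comment> \<open>The same move leads back from \<open>b'\<close> to \<open>b\<close>.\<close>
    then show ?thesis
      using prefix less.prems partial_conj_partial_conj[of b i _ "{j}"]
      by (intro connected_to_x.move[of b' i b "{j}"]) (auto simp: b'_def)
  next
    case reduced
    have "b m = x m" if m: "m < n" for m
    proof -
      obtain js where js: "distinct_adj js" "set js \<subseteq> {..<n}" "x m = word_ev G b js"
        using basis_word less.prems(1) m x_closed by metis
      have "js \<noteq> []" using js x_neq_one[OF m] by auto
      then obtain v where v: "x m = wval (v @ [last js] @ rev (u (last js)))" "set v \<subseteq> {..<n}"
        "distinct_adj (v @ [last js] @ rev (u (last js)))"
        using no_prefix_product[of u b js] less.prems reduced js by auto
      have l: "last js < n" using js last_in_set[OF \<open>js \<noteq> []\<close>] by auto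
      then have "[m] = v @ [last js] @ rev (u (last js))"
        using v m less.prems(2) by (intro reduced_unique) auto
      then have "m = last js" "u (last js) = []" by (auto simp: Cons_eq_append_conv)
      then show ?thesis using less.prems(3)[OF m] m by simp
    qed
    then show ?thesis by (rule connected_to_x.start)
  qed
qed

text \<open>Involutions are conjugates of generators, so \<open>b j\<close> is a conjugate of
  \<open>x (k j)\<close>. If \<open>k\<close> missed \<open>m\<close>, all products of the
  \<open>b j\<close> would have even exponent sum in \<open>x m\<close>, which fails for
  \<open>x m\<close> itself. So \<open>k\<close> is a permutation, and its inverse reorders
  \<open>b\<close>.\<close>

lemma connected_to_x_exists:
  assumes "basis b"
  obtains \<sigma> where "\<sigma> permutes {..<n}" "connected_to_x (b \<circ> \<sigma>)"
proof -
  have "\<exists>u k. set u \<subseteq> {..<n} \<and> k < n \<and> b j = wval (u @ [k] @ rev u)" if "j < n" for j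
    using involution_conj_x[of "b j"] that assms basis_neq_one by (metis basis_closed basis_square)
  then obtain u k where uk: "\<And>j. j < n \<Longrightarrow> set (u j) \<subseteq> {..<n} \<and> k j < n \<and> b j = wval (u j @ [k j] @ rev (u j))"
    by metis
  have "m \<in> k ` {..<n}" if m: "m < n" for m
  proof (rule ccontr)
    assume no: "m \<notin> k ` {..<n}"
    obtain par where par: "\<And>g h. g \<in> carrier G \<Longrightarrow> h \<in> carrier G \<Longrightarrow> par (g \<otimes> h) \<longleftrightarrow> par g \<noteq> par h"
      "\<And>j. j < n \<Longrightarrow> par (x j) \<longleftrightarrow> j = m"
      using basis_parity[OF basis_x m] by blast
    have one: "\<not> par \<one>" using par(1)[of \<one> \<one>] by auto
    have "\<not> par (b j)" if "j < n" for j
    proof -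
      have "par (wval (u j)) = par (wval (rev (u j)))"
        using par(1)[of "wval (u j)" "wval (rev (u j))"] one uk[OF that] wval_rev[of "u j"] by auto
      then show ?thesis using uk[OF that] no that par by (auto simp: wval_append)
    qed
    then have "\<not> par (word_ev G b js)" if "set js \<subseteq> {..<n}" for js
      using that
    proof (induction js)
      case (Cons a js)
      moreover have "word_ev G b js \<in> carrier G"
        using Cons assms by (intro word_ev_closed[of b "{..<n}"]) (auto simp: in_lists_conv_set)
      ultimately show ?case using par(1)[of "b a" "word_ev G b js"] assms by auto
    qed (simp add: one)
    then show False using basis_word[OF assms, of "x m"] par(2)[OF m] m by (metis x_closed)
  qed
  then have surj: "k ` {..<n} = {..<n}" using uk by auto
  then have inj: "inj_on k {..<n}" by (intro eq_card_imp_inj_on) auto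
  define \<tau> where "\<tau> j = (if j < n then k j else j)" for j
  have "\<tau> permutes {..<n}"
    using surj inj by (intro bij_imp_permutes) (auto simp: bij_betw_def \<tau>_def inj_on_def image_def)
  then have perm: "inv_into UNIV \<tau> permutes {..<n}" by (rule permutes_inv)
  have lt: "inv_into UNIV \<tau> j < n" "k (inv_into UNIV \<tau> j) = j" if "j < n" for j
    using permutes_in_image[OF perm, of j] permutes_inverses(1)[OF \<open>\<tau> permutes _\<close>, of j] that
    by (auto simp: \<tau>_def split: if_splits)
  have "connected_to_x (b \<circ> inv_into UNIV \<tau>)"
    using uk lt by (intro connected_to_x_words[of _ "u \<circ> inv_into UNIV \<tau>"] basis_permute assms perm) fastforce+
  then show ?thesis using that perm by blast
qed

end

section \<open>Path groups of graphs of groups with trivial edge groups\<close>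

abbreviation vert_class ::
  "('v, 'e, 'g, 'h) graph_of_groups \<Rightarrow> 'v \<Rightarrow> 'g \<Rightarrow> ('v, 'e, 'g) letter list set" where
  "vert_class X v g \<equiv> path_class X [Vert v g]"

abbreviation edge_class ::
  "('v, 'e, 'g, 'h) graph_of_groups \<Rightarrow> 'e \<Rightarrow> ('v, 'e, 'g) letter list set" where
  "edge_class X e \<equiv> path_class X [Edge e]"

locale trivially_edged =
  fixes X :: "('v, 'e, 'g, 'h) graph_of_groups" and P :: "('v, 'e, 'g) letter list set monoid" (structure)
  defines "P \<equiv> path_group X"
  assumes gog: "is_graph_of_groups X"
    and triv: "\<And>e. e \<in> arcs (graph X) \<Longrightarrow> trivial_group (egroup X e)"
begin

sublocale bidirected_digraph "graph X" "rev_arc X"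
  using gog by (simp add: is_graph_of_groups_def)

lemma vgroup_group: "v \<in> verts (graph X) \<Longrightarrow> group (vgroup X v)"
  using gog by (simp add: is_graph_of_groups_def)

lemma vgroup_monoid: "v \<in> verts (graph X) \<Longrightarrow> monoid (vgroup X v)"
  by (simp add: vgroup_group group.is_monoid)

lemma emb_one:
  assumes "e \<in> arcs (graph X)" "g \<in> carrier (egroup X e)"
  shows "emb X e g = \<one>\<^bsub>vgroup X (head (graph X) e)\<^esub>"
proof -
  have "g = \<one>\<^bsub>egroup X e\<^esub>" using triv assms by (auto simp: trivial_group_def)
  moreover have "emb X e \<in> hom (egroup X e) (vgroup X (head (graph X) e))" "group (egroup X e)"
    using gog assms by (auto simp: is_graph_of_groups_def mon_def)
  ultimately show ?thesis using hom_one vgroup_group assms by (metis head_in_verts)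
qed

abbreviation "letters \<equiv> path_letters X"

lemma Vert_letter [simp]:
  "Vert v g \<in> letters \<longleftrightarrow> v \<in> verts (graph X) \<and> g \<in> carrier (vgroup X v)"
  by (auto simp: path_letters_def)

lemma Edge_letter [simp]: "Edge e \<in> letters \<longleftrightarrow> e \<in> arcs (graph X)"
  by (auto simp: path_letters_def)

lemma vert_class_mult':
  "v \<in> verts (graph X) \<Longrightarrow> g \<in> carrier (vgroup X v) \<Longrightarrow> h \<in> carrier (vgroup X v) \<Longrightarrow>
    path_class X [Vert v g, Vert v h] = vert_class X v (g \<otimes>\<^bsub>vgroup X v\<^esub> h)"
  by (rule word_class_rel) (auto simp: path_rels_def vgroup_monoid monoid.m_closed)

lemma vert_class_one':
  "v \<in> verts (graph X) \<Longrightarrow> vert_class X v \<one>\<^bsub>vgroup X v\<^esub> = path_class X []"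
  by (rule word_class_rel) (auto simp: path_rels_def vgroup_monoid monoid.one_closed)

lemma edge_class_rev':
  "e \<in> arcs (graph X) \<Longrightarrow> path_class X [Edge e, Edge (rev_arc X e)] = path_class X []"
  by (rule word_class_rel) (auto simp: path_rels_def)

sublocale group P
  unfolding P_def path_group_def
proof (rule presented_group)
  fix a assume a: "a \<in> letters"
  show "\<exists>b\<in>lists letters. path_class X (b @ [a]) = path_class X []"
  proof (cases a)
    case (Vert v g)
    interpret v: group "vgroup X v" using a Vert vgroup_group by simp
    show ?thesis
      using a Vert vert_class_mult'[of v "inv\<^bsub>vgroup X v\<^esub> g" g] vert_class_one'[of v]
      by (intro bexI[of _ "[Vert v (inv\<^bsub>vgroup X v\<^esub> g)]"]) auto
  next
    case (Edge e)
    then show ?thesis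
      using a edge_class_rev'[of "rev_arc X e"] by (intro bexI[of _ "[Edge (rev_arc X e)]"]) auto
  qed
qed

lemma path_class_closed [simp]: "p \<in> lists letters \<Longrightarrow> path_class X p \<in> carrier P"
  unfolding P_def path_group_def by (rule word_class_in_presented)

lemma path_class_Nil [simp]: "path_class X [] = \<one>"
  unfolding P_def path_group_def by (simp add: presented_one)

lemma path_class_append:
  "p \<in> lists letters \<Longrightarrow> q \<in> lists letters \<Longrightarrow> path_class X (p @ q) = path_class X p \<otimes> path_class X q"
  unfolding P_def path_group_def by (simp add: presented_mult)

lemma path_class_Cons:
  "a \<in> letters \<Longrightarrow> p \<in> lists letters \<Longrightarrow> path_class X (a # p) = path_class X [a] \<otimes> path_class X p"
  using path_class_append[of "[a]" p] by simp

lemma vert_class_mult: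
  "v \<in> verts (graph X) \<Longrightarrow> g \<in> carrier (vgroup X v) \<Longrightarrow> h \<in> carrier (vgroup X v) \<Longrightarrow>
    vert_class X v g \<otimes> vert_class X v h = vert_class X v (g \<otimes>\<^bsub>vgroup X v\<^esub> h)"
  using vert_class_mult' path_class_append[of "[Vert v g]" "[Vert v h]"] by simp

lemma vert_class_one [simp]: "v \<in> verts (graph X) \<Longrightarrow> vert_class X v \<one>\<^bsub>vgroup X v\<^esub> = \<one>"
  using vert_class_one' by simp

lemma vert_class_hom: "v \<in> verts (graph X) \<Longrightarrow> vert_class X v \<in> hom (vgroup X v) P"
  by (rule homI) (simp_all add: vert_class_mult)

lemma edge_class_rev:
  "e \<in> arcs (graph X) \<Longrightarrow> edge_class X e \<otimes> edge_class X (rev_arc X e) = \<one>"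
  using edge_class_rev' path_class_append[of "[Edge e]" "[Edge (rev_arc X e)]"] by simp

lemma edge_class_inv: "e \<in> arcs (graph X) \<Longrightarrow> edge_class X (rev_arc X e) = inv (edge_class X e)"
  using edge_class_rev[of "rev_arc X e"] by (intro inv_equality[symmetric]) simp_all

lemma path_carrierE:
  assumes "a \<in> carrier P"
  obtains p where "p \<in> lists letters" "a = path_class X p"
  using assms by (auto simp: P_def path_group_def presented_carrier)

text \<open>Embeddings of trivial edge groups only produce identities, so homomorphisms on the
  vertex groups and mutually inverse values on opposite arcs suffice. The last two conclusions
  reveal the construction, by which \<open>induced_map\<close> is later identified with such a
  lift.\<close>

lemma path_lift:
  assumes "group H" "\<And>v. v \<in> verts (graph X) \<Longrightarrow> \<phi> v \<in> hom (vgroup X v) H"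
    and "\<And>e. e \<in> arcs (graph X) \<Longrightarrow> \<epsilon> e \<in> carrier H"
    and "\<And>e. e \<in> arcs (graph X) \<Longrightarrow> \<epsilon> e \<otimes>\<^bsub>H\<^esub> \<epsilon> (rev_arc X e) = \<one>\<^bsub>H\<^esub>"
  obtains h where "h \<in> hom P H"
    "\<And>v g. v \<in> verts (graph X) \<Longrightarrow> g \<in> carrier (vgroup X v) \<Longrightarrow> h (vert_class X v g) = \<phi> v g"
    "\<And>e. e \<in> arcs (graph X) \<Longrightarrow> h (edge_class X e) = \<epsilon> e"
    "h = presented_lift H (\<lambda>a. case a of Vert v g \<Rightarrow> \<phi> v g | Edge e \<Rightarrow> \<epsilon> e)"
    "respects_rels H (\<lambda>a. case a of Vert v g \<Rightarrow> \<phi> v g | Edge e \<Rightarrow> \<epsilon> e) letters (path_rels X)"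
proof -
  interpret H: group H by fact
  let ?f = "\<lambda>a. case a of Vert v g \<Rightarrow> \<phi> v g | Edge e \<Rightarrow> \<epsilon> e"
  have closed: "\<phi> v g \<in> carrier H" if "v \<in> verts (graph X)" "g \<in> carrier (vgroup X v)" for v g
    using assms(2) that by (auto simp: hom_def)
  have one: "\<phi> v \<one>\<^bsub>vgroup X v\<^esub> = \<one>\<^bsub>H\<^esub>" if "v \<in> verts (graph X)" for v
    using hom_one[OF assms(2)] vgroup_group assms(1) that by blast
  have mult: "\<phi> v g \<otimes>\<^bsub>H\<^esub> \<phi> v h = \<phi> v (g \<otimes>\<^bsub>vgroup X v\<^esub> h)"
    if "v \<in> verts (graph X)" "g \<in> carrier (vgroup X v)" "h \<in> carrier (vgroup X v)" for v g h
    using hom_mult[OF assms(2)] that by metis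
  have mclosed: "g \<otimes>\<^bsub>vgroup X v\<^esub> h \<in> carrier (vgroup X v)"
    if "v \<in> verts (graph X)" "g \<in> carrier (vgroup X v)" "h \<in> carrier (vgroup X v)" for v g h
    using vgroup_monoid[OF that(1)] that by (simp add: monoid.m_closed)
  have r: "respects_rels H ?f letters (path_rels X)"
    unfolding respects_rels_def
  proof (intro conjI ballI)
    show "?f \<in> letters \<rightarrow> carrier H"
      using closed assms(3) by (auto simp: path_letters_def)
    fix ab assume ab: "ab \<in> path_rels X"
    have "word_ev H ?f (fst ab) = word_ev H ?f (snd ab)"
      using ab unfolding path_rels_def
    proof (elim UnE CollectE exE conjE)
      fix v assume "ab = ([Vert v \<one>\<^bsub>vgroup X v\<^esub>], [])" "v \<in> verts (graph X)"
      then show ?thesis using one by simp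
    next
      fix v g h assume "ab = ([Vert v g, Vert v h], [Vert v (g \<otimes>\<^bsub>vgroup X v\<^esub> h)])"
        "v \<in> verts (graph X)" "g \<in> carrier (vgroup X v)" "h \<in> carrier (vgroup X v)"
      then show ?thesis using mult closed mclosed by simp
    next
      fix e assume "ab = ([Edge e, Edge (rev_arc X e)], [])" "e \<in> arcs (graph X)"
      then show ?thesis using assms(3)[of "rev_arc X e"] assms(4) by simp
    next
      fix e g assume e: "ab = ([Edge e, Vert (head (graph X) e) (emb X e g)],
        [Vert (tail (graph X) e) (emb X (rev_arc X e) g), Edge e])"
        "e \<in> arcs (graph X)" "g \<in> carrier (egroup X e)"
      moreover have "egroup X (rev_arc X e) = egroup X e"
        using gog e by (auto simp: is_graph_of_groups_def)
      ultimately show ?thesis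
        using emb_one[of e g] emb_one[of "rev_arc X e" g] one assms(3) by simp
    qed
    then show "case ab of (a, b) \<Rightarrow> a \<in> lists letters \<longrightarrow> b \<in> lists letters \<longrightarrow> word_ev H ?f a = word_ev H ?f b"
      by (cases ab) simp
  qed
  have val: "presented_lift H ?f (path_class X [a]) = ?f a" if "a \<in> letters" for a
  proof -
    have "?f a \<in> carrier H" using closed assms(3) that by (cases a) auto
    then show ?thesis using that by (subst H.presented_lift_class[OF r]) auto
  qed
  show ?thesis
    by (rule that[OF _ _ _ HOL.refl r]) (use H.presented_lift_hom[OF r] val in \<open>auto simp: P_def path_group_def\<close>)
qed

lemma is_path_verts: "is_path X u p w \<Longrightarrow> u \<in> verts (graph X) \<and> w \<in> verts (graph X)"
proof (induction p arbitrary: u)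
  case (Cons a p)
  then show ?case by (cases a) auto
qed simp

lemma is_path_letters: "is_path X u p w \<Longrightarrow> p \<in> lists letters"
proof (induction p arbitrary: u)
  case (Cons a p)
  then show ?case by (cases a) auto
qed simp

lemma is_path_append:
  "is_path X u (p @ q) w \<longleftrightarrow> (\<exists>m. is_path X u p m \<and> is_path X m q w)"
proof (induction p arbitrary: u)
  case Nil
  then show ?case using is_path_verts by auto
next
  case (Cons a p)
  then show ?case by (cases a) auto
qed

lemma is_path_appendI: "is_path X u p m \<Longrightarrow> is_path X m q w \<Longrightarrow> is_path X u (p @ q) w"
  by (auto simp: is_path_append)

lemma is_path_reverse:
  "is_path X u p w \<Longrightarrow> \<exists>q. is_path X w q u \<and> path_class X q = inv (path_class X p)"
proof (induction p arbitrary: u)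
  case Nil
  then show ?case by (intro exI[of _ "[]"]) auto
next
  case (Cons a p)
  show ?case
  proof (cases a)
    case (Vert v g)
    then have v: "v = u" "u \<in> verts (graph X)" "g \<in> carrier (vgroup X u)" "is_path X u p w"
      using Cons.prems by auto
    interpret v: group "vgroup X v" using v vgroup_group by simp
    obtain q where q: "is_path X w q u" "path_class X q = inv (path_class X p)"
      using Cons.IH v by blast
    have "vert_class X u (inv\<^bsub>vgroup X u\<^esub> g) \<otimes> vert_class X u g = \<one>"
      using v v.inv_closed v.l_inv[of g] by (simp add: vert_class_mult)
    then have "inv (vert_class X u g) = vert_class X u (inv\<^bsub>vgroup X u\<^esub> g)"
      using v v.inv_closed by (intro inv_equality) simp_all
    then show ?thesis
      unfolding Vert
      using v q is_path_letters[OF q(1)] is_path_letters[OF v(4)] v.inv_closed[of g]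
      by (intro exI[of _ "q @ [Vert u (inv\<^bsub>vgroup X u\<^esub> g)]"] conjI)
        (simp_all add: is_path_append path_class_append path_class_Cons[of _ p] inv_mult_group)
  next
    case (Edge e)
    then have e: "e \<in> arcs (graph X)" "u = tail (graph X) e" "is_path X (head (graph X) e) p w"
      using Cons.prems by auto
    then obtain q where q: "is_path X w q (head (graph X) e)" "path_class X q = inv (path_class X p)"
      using Cons.IH by blast
    then show ?thesis
      unfolding Edge
      using e is_path_letters[OF q(1)] is_path_letters[OF e(3)]
      by (intro exI[of _ "q @ [Edge (rev_arc X e)]"] conjI)
        (simp_all add: is_path_append path_class_append path_class_Cons[of _ p] inv_mult_group edge_class_inv)
  qed
qed

lemma fundamental_carrier:
  "carrier (fundamental_group X u) = {path_class X p | p. is_path X u p u}"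
  by (simp add: fundamental_group_def)

lemma hom_fundamentalI:
  "h \<in> hom H P \<Longrightarrow> h ` carrier H \<subseteq> carrier (fundamental_group X u) \<Longrightarrow> h \<in> hom H (fundamental_group X u)"
  by (auto simp: hom_def fundamental_group_def P_def)

lemma hom_fundamentalD: "h \<in> hom H (fundamental_group X u) \<Longrightarrow> h \<in> hom H P"
proof -
  assume h: "h \<in> hom H (fundamental_group X u)"
  have "carrier (fundamental_group X u) \<subseteq> carrier P"
    unfolding fundamental_carrier by (auto dest: is_path_letters)
  then show ?thesis
    using h unfolding hom_def fundamental_group_def P_def by (simp add: Pi_iff) blast
qed

lemma iso_fundamentalD:
  assumes "h \<in> iso H (fundamental_group X u)"
  shows "h \<in> hom H P" "inj_on h (carrier H)" "h ` carrier H = {path_class X p | p. is_path X u p u}"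
  using assms hom_fundamentalD by (auto simp: iso_def bij_betw_def fundamental_carrier)

end

text \<open>A common frame for the maps that isomorphisms and collapses induce on path groups:
  letters are replaced by paths, compatibly with the map \<open>c\<close> on vertices.\<close>

locale path_substitution = X: trivially_edged X P + Y: trivially_edged Y Q
  for X :: "('u, 'd, 'k, 'l) graph_of_groups" and P :: "('u, 'd, 'k) letter list set monoid" (structure)
    and Y :: "('v, 'e, 'g, 'h) graph_of_groups" and Q :: "('v, 'e, 'g) letter list set monoid"  +
  fixes s :: "('u, 'd, 'k) letter \<Rightarrow> ('v, 'e, 'g) letter list" and c :: "'u \<Rightarrow> 'v"
  assumes vert_path: "\<And>v g. v \<in> verts (graph X) \<Longrightarrow> g \<in> carrier (vgroup X v) \<Longrightarrow>
      is_path Y (c v) (s (Vert v g)) (c v)"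
    and edge_path: "\<And>e. e \<in> arcs (graph X) \<Longrightarrow>
      is_path Y (c (tail (graph X) e)) (s (Edge e)) (c (head (graph X) e))"
    and vert_hom: "\<And>v. v \<in> verts (graph X) \<Longrightarrow> (\<lambda>g. path_class Y (s (Vert v g))) \<in> hom (vgroup X v) Q"
    and edge_rev: "\<And>e. e \<in> arcs (graph X) \<Longrightarrow>
      path_class Y (s (Edge e)) \<otimes>\<^bsub>Q\<^esub> path_class Y (s (Edge (rev_arc X e))) = \<one>\<^bsub>Q\<^esub>"
    and verts: "\<And>v. v \<in> verts (graph X) \<Longrightarrow> c v \<in> verts (graph Y)"
begin

abbreviation "ind \<equiv> induced_map Y s"

lemma s_letters: "a \<in> X.letters \<Longrightarrow> s a \<in> lists Y.letters"
  using vert_path edge_path by (cases a) (auto dest: Y.is_path_letters)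

text \<open>\<open>induced_map\<close> is a union over representatives; on the carrier it agrees
  with the lift given by the images of the letters.\<close>

lemma ind_hom: "ind \<in> hom P Q"
  and ind_class: "p \<in> lists X.letters \<Longrightarrow> ind (path_class X p) = path_class Y (concat (map s p))"
proof -
  have closed: "path_class Y (s a) \<in> carrier Q" if "a \<in> X.letters" for a
    using s_letters[OF that] by simp
  obtain h where h: "h \<in> hom P Q"
    "h = presented_lift Q (\<lambda>a. case a of Vert v g \<Rightarrow> path_class Y (s (Vert v g)) | Edge e \<Rightarrow> path_class Y (s (Edge e)))"
    "respects_rels Q (\<lambda>a. case a of Vert v g \<Rightarrow> path_class Y (s (Vert v g)) | Edge e \<Rightarrow> path_class Y (s (Edge e)))
      X.letters (path_rels X)"
    by (rule X.path_lift[of Q "\<lambda>v g. path_class Y (s (Vert v g))" "\<lambda>e. path_class Y (s (Edge e))"])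
      (use vert_hom closed edge_rev Y.group_axioms in auto)
  have eq: "(\<lambda>a. case a of Vert v g \<Rightarrow> path_class Y (s (Vert v g)) | Edge e \<Rightarrow> path_class Y (s (Edge e)))
      = (\<lambda>a. path_class Y (s a))"
    by (rule ext) (simp split: letter.split)
  note h' = h(2,3)[unfolded eq]
  have ind: "ind (path_class X p) = h (path_class X p)" if "p \<in> lists X.letters" for p
    using Union_word_class[OF h'(2)[unfolded Y.P_def path_group_def] that s_letters]
    by (simp add: induced_map_def h' Y.P_def path_group_def)
  show "ind \<in> hom P Q"
    using X.hom_eq[OF h(1), of ind] ind by (metis X.path_carrierE)
  show "ind (path_class X p) = path_class Y (concat (map s p))" if "p \<in> lists X.letters"
    using that ind[OF that] Y.presented_lift_class[OF h'(2) that] h'(1)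
      word_ev_class[of p X.letters s Y.letters "path_rels Y", OF that s_letters]
    by (simp add: Y.P_def path_group_def)
qed

lemma ind_path:
  "is_path X u p w \<Longrightarrow> is_path Y (c u) (concat (map s p)) (c w)"
proof (induction p arbitrary: u)
  case Nil
  then show ?case using verts by auto
next
  case (Cons a p)
  then show ?case
    using vert_path edge_path by (cases a) (auto intro!: Y.is_path_appendI)
qed

lemma ind_vert: "v \<in> verts (graph X) \<Longrightarrow> g \<in> carrier (vgroup X v) \<Longrightarrow>
    ind (vert_class X v g) = path_class Y (s (Vert v g))"
  by (simp add: ind_class)

lemma ind_edge: "e \<in> arcs (graph X) \<Longrightarrow> ind (edge_class X e) = path_class Y (s (Edge e))"
  by (simp add: ind_class)

end

section \<open>Stars\<close>

lemma iso_F_carrier: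
  assumes "group A" "A \<cong> F"
  obtains g where "carrier A = {\<one>\<^bsub>A\<^esub>, g}" "g \<noteq> \<one>\<^bsub>A\<^esub>" "g \<otimes>\<^bsub>A\<^esub> g = \<one>\<^bsub>A\<^esub>"
proof -
  interpret A: group A by fact
  obtain h where h: "h \<in> iso A F" using assms(2) by (auto simp: is_iso_def)
  then have hom: "h \<in> hom A F" and bij: "bij_betw h (carrier A) {0, 1}" by (auto simp: iso_def F_carrier)
  obtain g where g: "g \<in> carrier A" "h g = 1" using bij by (metis bij_betw_imp_surj_on imageE insertCI)
  have one: "h \<one>\<^bsub>A\<^esub> = 0" using hom_one[OF hom] A.group_axioms by simp
  have "k = \<one>\<^bsub>A\<^esub> \<or> k = g" if "k \<in> carrier A" for k
  proof -
    have "h k \<in> {0, 1}" using bij_betwE[OF bij] that by blast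
    then have "h k = h \<one>\<^bsub>A\<^esub> \<or> h k = h g" using g one by simp
    then show ?thesis using bij_betw_imp_inj_on[OF bij] that g A.one_closed by (meson inj_onD)
  qed
  then have "carrier A = {\<one>\<^bsub>A\<^esub>, g}" using g A.one_closed by blast
  moreover have "h (g \<otimes>\<^bsub>A\<^esub> g) = h \<one>\<^bsub>A\<^esub>" using hom_mult[OF hom, of g g] g one by simp
  then have "g \<otimes>\<^bsub>A\<^esub> g = \<one>\<^bsub>A\<^esub>"
    using bij_betw_imp_inj_on[OF bij] g A.one_closed A.m_closed by (meson inj_onD)
  moreover have "g \<noteq> \<one>\<^bsub>A\<^esub>" using g one by force
  ultimately show ?thesis using that[of g] by blast
qed

definition flip :: "('g, 'm) monoid_scheme \<Rightarrow> 'g" where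
  "flip A = (SOME g. g \<in> carrier A \<and> g \<noteq> \<one>\<^bsub>A\<^esub>)"

lemma flip:
  assumes "group A" "A \<cong> F"
  shows "flip A \<in> carrier A" "flip A \<noteq> \<one>\<^bsub>A\<^esub>" "flip A \<otimes>\<^bsub>A\<^esub> flip A = \<one>\<^bsub>A\<^esub>" "carrier A = {\<one>\<^bsub>A\<^esub>, flip A}"
proof -
  obtain g where g: "carrier A = {\<one>\<^bsub>A\<^esub>, g}" "g \<noteq> \<one>\<^bsub>A\<^esub>" "g \<otimes>\<^bsub>A\<^esub> g = \<one>\<^bsub>A\<^esub>"
    by (rule iso_F_carrier[OF assms])
  have "flip A \<in> carrier A \<and> flip A \<noteq> \<one>\<^bsub>A\<^esub>"
    unfolding flip_def by (rule someI[of _ g]) (use g(1,2) in blast)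
  then have "flip A = g" using g(1) by blast
  then show "flip A \<in> carrier A" "flip A \<noteq> \<one>\<^bsub>A\<^esub>" "flip A \<otimes>\<^bsub>A\<^esub> flip A = \<one>\<^bsub>A\<^esub>" "carrier A = {\<one>\<^bsub>A\<^esub>, flip A}"
    using g by blast+
qed

lemma flip_unique: "group A \<Longrightarrow> A \<cong> F \<Longrightarrow> g \<in> carrier A \<Longrightarrow> g \<noteq> \<one>\<^bsub>A\<^esub> \<Longrightarrow> g = flip A"
  using flip(4)[of A] by blast

text \<open>A group with two elements is abelian. So a twist at the vertex that a loop goes around
  does not change the loop.\<close>

lemma hom_flip_commute:
  assumes "group A" "A \<cong> F" "group H" "h \<in> hom A H" "c \<in> carrier A"
  shows "h c \<otimes>\<^bsub>H\<^esub> h (flip A) = h (flip A) \<otimes>\<^bsub>H\<^esub> h c"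
proof -
  interpret A: group A by fact
  have "c \<otimes>\<^bsub>A\<^esub> flip A = flip A \<otimes>\<^bsub>A\<^esub> c"
    using flip(1,4)[OF assms(1,2)] assms(5) A.l_one A.r_one by (metis insertE singletonD)
  then show ?thesis using assms(4,5) flip(1)[OF assms(1,2)] by (metis hom_mult)
qed

text \<open>The vertices of a star are numbered such that \<open>v k\<close> is the centre and \<open>v j\<close>, \<open>j < n\<close>, are
  the vertices with group \<open>F\<close>. So \<open>k = n\<close> for a \<open>{0}\<close>-star, and \<open>k < n\<close> for an \<open>F\<close>-star.\<close>

definition star :: "nat \<Rightarrow> nat \<Rightarrow> ('v, 'e, 'g, 'h) graph_of_groups \<Rightarrow> (nat \<Rightarrow> 'v) \<Rightarrow> (nat \<Rightarrow> 'e) \<Rightarrow> bool" where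
  "star n k X v e \<longleftrightarrow>
    k \<le> n \<and> inj_on v (insert k {..<n}) \<and> verts (graph X) = v ` insert k {..<n} \<and>
    (\<forall>j<n. vgroup X (v j) \<cong> F) \<and> (k = n \<longrightarrow> trivial_group (vgroup X (v n))) \<and>
    (\<forall>j\<in>{..<n} - {k}. e j \<in> arcs (graph X) \<and> tail (graph X) (e j) = v k \<and> head (graph X) (e j) = v j) \<and>
    arcs (graph X) = (\<Union>j\<in>{..<n} - {k}. {e j, rev_arc X (e j)})"

text \<open>The element of the path group that is \<open>arm j\<close> runs along \<open>p\<close> to the centre, picks up \<open>\<kappa> j\<close>
  there and proceeds to \<open>v j\<close>.\<close>

definition arm where
  "arm k X v e p \<kappa> j = path_class X p \<otimes>\<^bsub>path_group X\<^esub> vert_class X (v k) (\<kappa> j) \<otimes>\<^bsub>path_group X\<^esub>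
    (if j = k then \<one>\<^bsub>path_group X\<^esub> else edge_class X (e j))"

text \<open>Along the arm to \<open>v j\<close>, through the nontrivial element of its group, and
  back. These loops correspond under a marking to the members of a basis.\<close>

definition loop where
  "loop k X v e p \<kappa> j = arm k X v e p \<kappa> j \<otimes>\<^bsub>path_group X\<^esub> vert_class X (v j) (flip (vgroup X (v j)))
    \<otimes>\<^bsub>path_group X\<^esub> inv\<^bsub>path_group X\<^esub> arm k X v e p \<kappa> j"

locale star_of_groups = trivially_edged X P
  for X :: "('v, 'e, 'g, 'h) graph_of_groups" and P :: "('v, 'e, 'g) letter list set monoid" (structure) +
  fixes n k :: nat and v :: "nat \<Rightarrow> 'v" and e :: "nat \<Rightarrow> 'e"
  assumes star: "star n k X v e"
begin

lemma k_le: "k \<le> n"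
  and v_inj: "inj_on v (insert k {..<n})"
  and verts_eq: "verts (graph X) = v ` insert k {..<n}"
  and vgroup_F: "j < n \<Longrightarrow> vgroup X (v j) \<cong> F"
  and vgroup_centre: "k = n \<Longrightarrow> trivial_group (vgroup X (v n))"
  and e_arc: "j < n \<Longrightarrow> j \<noteq> k \<Longrightarrow> e j \<in> arcs (graph X)"
  and tail_e: "j < n \<Longrightarrow> j \<noteq> k \<Longrightarrow> tail (graph X) (e j) = v k"
  and head_e: "j < n \<Longrightarrow> j \<noteq> k \<Longrightarrow> head (graph X) (e j) = v j"
  and arcs_eq: "arcs (graph X) = (\<Union>j\<in>{..<n} - {k}. {e j, rev_arc X (e j)})"
  using star by (auto simp: star_def)

lemma v_vert [simp]: "j < n \<Longrightarrow> v j \<in> verts (graph X)" "v k \<in> verts (graph X)"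
  by (auto simp: verts_eq)

lemma v_eq_iff: "i < n \<or> i = k \<Longrightarrow> j < n \<or> j = k \<Longrightarrow> v i = v j \<longleftrightarrow> i = j"
  using v_inj by (auto simp: inj_on_def)

lemma flip_closed [simp]: "j < n \<Longrightarrow> flip (vgroup X (v j)) \<in> carrier (vgroup X (v j))"
  by (simp add: flip(1) vgroup_group vgroup_F)

lemma vgroup_abelian_flip:
  "j < n \<Longrightarrow> c \<in> carrier (vgroup X (v j)) \<Longrightarrow>
    vert_class X (v j) c \<otimes> vert_class X (v j) (flip (vgroup X (v j)))
      = vert_class X (v j) (flip (vgroup X (v j))) \<otimes> vert_class X (v j) c"
  by (rule hom_flip_commute[OF _ _ _ vert_class_hom]) (simp_all add: vgroup_group vgroup_F is_group)

lemma flip_square: "j < n \<Longrightarrow> vert_class X (v j) (flip (vgroup X (v j))) \<otimes> vert_class X (v j) (flip (vgroup X (v j))) = \<one>"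
  by (simp add: vert_class_mult flip(3) vgroup_group vgroup_F)

definition arm_path where
  "arm_path p \<kappa> j = p @ [Vert (v k) (\<kappa> j)] @ (if j = k then [] else [Edge (e j)])"

context
  fixes u p \<kappa>
  assumes p: "is_path X u p (v k)" and \<kappa>_all: "\<forall>j<n. \<kappa> j \<in> carrier (vgroup X (v k))"
begin

lemma centre_twist: "j < n \<Longrightarrow> \<kappa> j \<in> carrier (vgroup X (v k))"
  using \<kappa>_all by simp

lemma p_letters [simp]: "p \<in> lists letters"
  using p by (rule is_path_letters)

lemma arm_path: "j < n \<Longrightarrow> is_path X u (arm_path p \<kappa> j) (v j)"
  using p centre_twist e_arc tail_e head_e by (auto simp: arm_path_def is_path_append)

lemma arm_class: "j < n \<Longrightarrow> path_class X (arm_path p \<kappa> j) = arm k X v e p \<kappa> j"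
  using centre_twist[of j] e_arc[of j] p_letters
  by (cases "j = k") (simp_all add: arm_path_def arm_def path_class_append path_class_Cons[of _ "[Edge (e j)]"]
      P_def[symmetric] m_assoc)

lemma arm_closed [simp]: "j < n \<Longrightarrow> arm k X v e p \<kappa> j \<in> carrier P"
  using arm_class[of j] arm_path[of j] is_path_letters path_class_closed by metis

lemma loop_closed [simp]: "j < n \<Longrightarrow> loop k X v e p \<kappa> j \<in> carrier P"
  by (simp add: loop_def P_def[symmetric])

lemma loop_square: "j < n \<Longrightarrow> loop k X v e p \<kappa> j \<otimes> loop k X v e p \<kappa> j = \<one>"
  unfolding loop_def P_def[symmetric] by (subst conj_mult) (simp_all add: flip_square)

lemma loop_fundamental: "j < n \<Longrightarrow> loop k X v e p \<kappa> j \<in> carrier (fundamental_group X u)"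
proof -
  assume j: "j < n"
  obtain q where q: "is_path X (v j) q u" "path_class X q = inv (arm k X v e p \<kappa> j)"
    using is_path_reverse[OF arm_path[OF j]] arm_class[OF j] by auto
  let ?l = "arm_path p \<kappa> j @ [Vert (v j) (flip (vgroup X (v j)))] @ q"
  have "is_path X u ?l u"
    using arm_path[OF j] q j by (auto simp: is_path_append)
  moreover have "path_class X ?l = loop k X v e p \<kappa> j"
    using is_path_letters[OF q(1)] is_path_letters[OF arm_path[OF j]] j
    by (simp add: path_class_append path_class_Cons[of _ q] q arm_class loop_def P_def[symmetric] m_assoc)
  ultimately show ?thesis by (auto simp: fundamental_carrier)
qed

lemma vert_class_centre:
  assumes "c \<in> carrier (vgroup X (v k))"
  shows "c = \<one>\<^bsub>vgroup X (v k)\<^esub> \<or> k < n \<and> c = flip (vgroup X (v k))"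
proof (cases "k < n")
  case True
  then show ?thesis using assms flip(4)[of "vgroup X (v k)"] vgroup_group vgroup_F by auto
next
  case False
  then show ?thesis using assms vgroup_centre k_le by (auto simp: trivial_group_def)
qed

text \<open>The twist \<open>\<kappa> k\<close> commutes with the flip in the same group and drops
  out.\<close>

lemma loop_centre: "k < n \<Longrightarrow> loop k X v e p \<kappa> k
    = path_class X p \<otimes> vert_class X (v k) (flip (vgroup X (v k))) \<otimes> inv (path_class X p)"
proof -
  assume k: "k < n"
  let ?a = "vert_class X (v k) (\<kappa> k)" and ?f = "vert_class X (v k) (flip (vgroup X (v k)))"
  have cl: "?a \<in> carrier P" "?f \<in> carrier P" using k centre_twist by simp_all
  have "loop k X v e p \<kappa> k = path_class X p \<otimes> (?a \<otimes> ?f \<otimes> inv ?a) \<otimes> inv (path_class X p)"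
    using cl by (simp add: loop_def arm_def P_def[symmetric] inv_mult_group m_assoc)
  also have "?a \<otimes> ?f \<otimes> inv ?a = ?f"
    using cl vgroup_abelian_flip[OF k centre_twist[OF k]] by (simp add: m_assoc)
  finally show ?thesis .
qed

text \<open>The edges \<open>e j\<close> form a spanning tree. A letter, completed by tree paths to
  a closed path at the centre and transported to \<open>u\<close> along \<open>p\<close>, lies in
  \<open>H\<close>, and the completed letters of a closed path telescope.\<close>

lemma loops_generate:
  assumes "subgroup H P" "\<And>j. j < n \<Longrightarrow> loop k X v e p \<kappa> j \<in> H"
    and "is_path X u s u"
  shows "path_class X s \<in> H"
proof -
  interpret H: subgroup H P by fact
  let ?c = "path_class X p"
  define in_H where "in_H a \<longleftrightarrow> ?c \<otimes> a \<otimes> inv ?c \<in> H" for a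
  have mult: "in_H (a \<otimes> b)" if "in_H a" "in_H b" "a \<in> carrier P" "b \<in> carrier P" for a b
    using that H.m_closed[of "?c \<otimes> a \<otimes> inv ?c" "?c \<otimes> b \<otimes> inv ?c"] unfolding in_H_def by (simp add: conj_mult)
  have one: "in_H \<one>" by (simp add: in_H_def)
  have inv: "in_H (inv a)" if "in_H a" "a \<in> carrier P" for a
    using that H.m_inv_closed[of "?c \<otimes> a \<otimes> inv ?c"] unfolding in_H_def
    by (simp add: inv_mult_group m_assoc)
  have centre: "in_H (vert_class X (v k) c)" if "c \<in> carrier (vgroup X (v k))" for c
  proof -
    consider "c = \<one>\<^bsub>vgroup X (v k)\<^esub>" | "k < n" "c = flip (vgroup X (v k))"
      using vert_class_centre[OF \<open>c \<in> carrier (vgroup X (v k))\<close>] by blast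
    then show ?thesis
    proof cases
      case 2
      then show ?thesis using assms(2)[of k] loop_centre by (simp add: in_H_def)
    qed (simp add: one)
  qed
  \<comment> \<open>\<open>t w\<close> is the tree path from the centre to \<open>w\<close>.\<close>
  define t where "t w = (let j = inv_into (insert k {..<n}) v w in
    if j = k then \<one> else edge_class X (e j))" for w
  have inv_v: "inv_into (insert k {..<n}) v (v j) = j" if "j < n \<or> j = k" for j
    using that v_inj by (intro inv_into_f_f) auto
  have t: "t (v j) = (if j = k then \<one> else edge_class X (e j))" if "j < n \<or> j = k" for j
    using that by (simp add: t_def inv_v)
  have t_closed [simp]: "t w \<in> carrier P" if "w \<in> verts (graph X)" for w
    using that t e_arc by (auto simp: verts_eq)
  have vert: "in_H (t (v j) \<otimes> vert_class X (v j) c \<otimes> inv (t (v j)))"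
    if "j < n \<or> j = k" "c \<in> carrier (vgroup X (v j))" for j c
  proof (cases "j = k")
    case True
    then show ?thesis using centre that t by simp
  next
    case False
    then have j: "j < n" using that by simp
    show ?thesis
    proof (cases "c = \<one>\<^bsub>vgroup X (v j)\<^esub>")
      case True
      then show ?thesis using j one by simp
    next
      case c: False
      then have c: "c = flip (vgroup X (v j))" using that j by (intro flip_unique) (simp_all add: vgroup_group vgroup_F)
      let ?a = "vert_class X (v k) (\<kappa> j)" and ?E = "edge_class X (e j)" and ?f = "vert_class X (v j) c"
      have cl: "?a \<in> carrier P" "?E \<in> carrier P" "?f \<in> carrier P" using centre_twist j False e_arc c by simp_all
      have "loop k X v e p \<kappa> j = ?c \<otimes> (?a \<otimes> (?E \<otimes> ?f \<otimes> inv ?E) \<otimes> inv ?a) \<otimes> inv ?c"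
        using False cl by (simp add: loop_def arm_def P_def[symmetric] c inv_mult_group m_assoc)
      then have "in_H (?a \<otimes> (?E \<otimes> ?f \<otimes> inv ?E) \<otimes> inv ?a)"
        using assms(2)[OF j] by (simp add: in_H_def)
      moreover have "in_H ?a" using centre centre_twist j by simp
      \<comment> \<open>The loop around \<open>v j\<close> carries the twist \<open>?a\<close>,
        which satisfies \<open>in_H\<close> as an element of the centre group, so it can be
        conjugated away.\<close>
      ultimately have "in_H (inv ?a \<otimes> ((?a \<otimes> (?E \<otimes> ?f \<otimes> inv ?E) \<otimes> inv ?a) \<otimes> ?a))"
        using cl by (intro mult[of "inv _"] mult[of "_ \<otimes> _ \<otimes> inv _"] inv) simp_all
      also have "inv ?a \<otimes> ((?a \<otimes> (?E \<otimes> ?f \<otimes> inv ?E) \<otimes> inv ?a) \<otimes> ?a) = ?E \<otimes> ?f \<otimes> inv ?E"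
        using cl by (simp add: m_assoc) (simp add: m_assoc[symmetric])
      finally show ?thesis using False t that by simp
    qed
  qed
  have edge: "t (tail (graph X) a) \<otimes> edge_class X a \<otimes> inv (t (head (graph X) a)) = \<one>"
    if "a \<in> arcs (graph X)" for a
  proof -
    obtain j where j: "j < n" "j \<noteq> k" "a = e j \<or> a = rev_arc X (e j)"
      using \<open>a \<in> arcs (graph X)\<close> arcs_eq by auto
    then show ?thesis using t e_arc tail_e head_e edge_class_inv edge_class_rev by auto
  qed
  have path: "in_H (t w \<otimes> path_class X s \<otimes> inv (t w'))" if "is_path X w s w'" for w s w'
    using that
  proof (induction s arbitrary: w)
    case Nil
    then have "w' \<in> verts (graph X)" "w = w'" by auto
    then show ?case using one by simp
  next
    case (Cons a s)
    obtain m where m: "is_path X w [a] m" "is_path X m s w'"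
      using Cons.prems is_path_append[of w "[a]" s w'] by auto
    have verts: "w \<in> verts (graph X)" "m \<in> verts (graph X)" "w' \<in> verts (graph X)"
      using is_path_verts m by blast+
    have lets: "[a] \<in> lists letters" "s \<in> lists letters" using is_path_letters m by blast+
    have "in_H (t w \<otimes> path_class X [a] \<otimes> inv (t m))"
    proof (cases a)
      case (Vert y c)
      then obtain j where "j < n \<or> j = k" "w = v j" "y = w" "m = w" "c \<in> carrier (vgroup X (v j))"
        using m(1) verts by (auto simp: verts_eq)
      then show ?thesis using vert Vert by simp
    next
      case (Edge a')
      then show ?thesis using m(1) edge[of a'] one by auto
    qed
    then have "in_H ((t w \<otimes> path_class X [a] \<otimes> inv (t m)) \<otimes> (t m \<otimes> path_class X s \<otimes> inv (t w')))"
      using Cons.IH[OF m(2)] verts lets by (intro mult[of "_ \<otimes> _ \<otimes> inv _" "_ \<otimes> _ \<otimes> inv _"]) simp_all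
    also have "(t w \<otimes> path_class X [a] \<otimes> inv (t m)) \<otimes> (t m \<otimes> path_class X s \<otimes> inv (t w'))
        = t w \<otimes> path_class X [a] \<otimes> (inv (t m) \<otimes> t m) \<otimes> path_class X s \<otimes> inv (t w')"
      using verts lets by (simp only: m_assoc m_closed inv_closed t_closed path_class_closed)
    also have "\<dots> = t w \<otimes> path_class X (a # s) \<otimes> inv (t w')"
      using verts lets by (simp add: path_class_Cons[of a s] m_assoc)
    finally show ?case .
  qed
  obtain q where q: "is_path X (v k) q u" "path_class X q = inv ?c" using is_path_reverse[OF p] by auto
  have "is_path X (v k) (q @ s @ p) (v k)" using q p assms(3) by (meson is_path_appendI)
  from path[OF this] have "in_H (inv ?c \<otimes> path_class X s \<otimes> ?c)"
    using t[of k] is_path_letters[OF q(1)] is_path_letters[OF assms(3)] q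
    by (simp add: path_class_append m_assoc)
  then show ?thesis
    using is_path_letters[OF assms(3)] unfolding in_H_def by (simp add: m_assoc) (simp add: m_assoc[symmetric])
qed

end

text \<open>The loops are involutions, so \<open>\<eta>\<close> exists, and it is onto by
  \<open>loops_generate\<close>. For injectivity a homomorphism \<open>r\<close> from the path group
  back to \<open>W n\<close> is constructed for which \<open>r \<circ> \<eta>\<close> is an inner
  automorphism.\<close>

lemma marking_exists:
  assumes p: "is_path X u p (v k)" and \<kappa>_all: "\<forall>j<n. \<kappa> j \<in> carrier (vgroup X (v k))"
  obtains \<eta> where "\<eta> \<in> iso (W n) (fundamental_group X u)" "\<And>j. j < n \<Longrightarrow> \<eta> (gen n j) = loop k X v e p \<kappa> j"
proof -
  note \<kappa> = centre_twist[OF p \<kappa>_all]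
  interpret W: universal_coxeter n "W n" by unfold_locales simp
  note loop = loop_closed[OF p \<kappa>_all] loop_square[OF p \<kappa>_all] loop_fundamental[OF p \<kappa>_all]
  obtain \<eta> where \<eta>: "\<eta> \<in> hom (W n) P" "\<And>j. j < n \<Longrightarrow> \<eta> (gen n j) = loop k X v e p \<kappa> j"
    by (rule W.lift[OF is_group, of "loop k X v e p \<kappa>"]) (use loop in simp_all)
  define ind where "ind w = inv_into (insert k {..<n}) v w" for w
  have ind_v: "ind (v j) = j" if "j < n \<or> j = k" for j
    unfolding ind_def using that v_inj by (intro inv_into_f_f) auto
  define \<phi> where "\<phi> w g = (if g \<noteq> \<one>\<^bsub>vgroup X w\<^esub> \<and> ind w < n then gen n (ind w) else \<one>\<^bsub>W n\<^esub>)" for w g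
  have \<phi>_hom: "\<phi> w \<in> hom (vgroup X w) (W n)" if "w \<in> verts (graph X)" for w
  proof -
    obtain j where j: "w = v j" "j < n \<or> j = k" using \<open>w \<in> _\<close> by (auto simp: verts_eq)
    interpret w: group "vgroup X w" using that by (rule vgroup_group)
    show ?thesis
    proof (cases "j < n")
      case True
      note fl = flip[OF vgroup_group[OF that], unfolded j(1), OF vgroup_F[OF True]]
      show ?thesis
        unfolding j(1) using fl(2,3) True
        by (intro homI) (auto simp: \<phi>_def ind_v fl(4) vgroup_monoid monoid.l_one monoid.r_one
          monoid.one_closed fl(1))
    next
      case False
      then have "trivial_group (vgroup X w)" using j vgroup_centre k_le by auto
      then show ?thesis using False j
        by (intro homI) (auto simp: \<phi>_def trivial_group_def ind_v)
    qed
  qed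
  \<comment> \<open>The value on \<open>e j\<close> cancels the image of the twist
    \<open>\<kappa> j\<close>, so that \<open>r\<close> sends the arms with
    \<open>j \<noteq> k\<close> to one and the same element \<open>?c\<close>.\<close>
  define \<epsilon> where "\<epsilon> a = (if tail (graph X) a = v k then inv\<^bsub>W n\<^esub> \<phi> (v k) (\<kappa> (ind (head (graph X) a)))
    else \<phi> (v k) (\<kappa> (ind (tail (graph X) a))))" for a
  have \<phi>_closed: "\<phi> (v k) (\<kappa> j) \<in> carrier (W n)" if "j < n" for j
    using \<phi>_hom[of "v k"] \<kappa>[OF that] by (auto simp: hom_def)
  have \<epsilon>_e: "\<epsilon> (e j) = inv\<^bsub>W n\<^esub> \<phi> (v k) (\<kappa> j)" "\<epsilon> (rev_arc X (e j)) = \<phi> (v k) (\<kappa> j)"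
    if "j < n" "j \<noteq> k" for j
    using that e_arc tail_e head_e by (simp_all add: \<epsilon>_def ind_v v_eq_iff)
  have \<epsilon>: "\<epsilon> a \<in> carrier (W n) \<and> \<epsilon> a \<otimes>\<^bsub>W n\<^esub> \<epsilon> (rev_arc X a) = \<one>\<^bsub>W n\<^esub>" if "a \<in> arcs (graph X)" for a
  proof -
    obtain j where j: "j < n" "j \<noteq> k" "a = e j \<or> a = rev_arc X (e j)"
      using \<open>a \<in> arcs (graph X)\<close> arcs_eq by auto
    from j(3) show ?thesis
    proof
      assume "a = e j" then show ?thesis using j \<epsilon>_e \<phi>_closed by simp
    next
      assume "a = rev_arc X (e j)" then show ?thesis using j \<epsilon>_e \<phi>_closed by simp
    qed
  qed
  obtain r where r: "r \<in> hom P (W n)"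
    "\<And>w g. w \<in> verts (graph X) \<Longrightarrow> g \<in> carrier (vgroup X w) \<Longrightarrow> r (vert_class X w g) = \<phi> w g"
    "\<And>a. a \<in> arcs (graph X) \<Longrightarrow> r (edge_class X a) = \<epsilon> a"
    by (rule path_lift[OF W.is_group, of \<phi> \<epsilon>]) (use \<phi>_hom \<epsilon> in auto)
  let ?c = "r (path_class X p)"
  have c: "?c \<in> carrier (W n)" using hom_in_carrier[OF r(1)] p_letters[OF p \<kappa>_all] by simp
  have r_mult: "r (a \<otimes> b) = r a \<otimes>\<^bsub>W n\<^esub> r b" if "a \<in> carrier P" "b \<in> carrier P" for a b
    using hom_mult[OF r(1)] that by simp
  have r_inv: "r (inv a) = inv\<^bsub>W n\<^esub> r a" if "a \<in> carrier P" for a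
    using that group_hom.hom_inv[of P "W n" r] r(1) W.is_group is_group
    by (simp add: group_hom_def group_hom_axioms_def)
  have r_loop: "r (loop k X v e p \<kappa> j) = ?c \<otimes>\<^bsub>W n\<^esub> gen n j \<otimes>\<^bsub>W n\<^esub> inv\<^bsub>W n\<^esub> ?c" if j: "j < n" for j
  proof (cases "j = k")
    case True
    then have k: "k < n" using j by simp
    have "\<phi> (v k) (flip (vgroup X (v k))) = gen n k"
      using k flip(2)[OF vgroup_group vgroup_F[OF k]] by (simp add: \<phi>_def ind_v)
    then show ?thesis
      using loop_centre[OF p \<kappa>_all k] True k p_letters[OF p \<kappa>_all] r(2)[of "v k"] by (simp add: r_mult r_inv)
  next
    case False
    have cl: "path_class X p \<in> carrier P" "vert_class X (v k) (\<kappa> j) \<in> carrier P"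
      "edge_class X (e j) \<in> carrier P" "arm k X v e p \<kappa> j \<in> carrier P"
      using p_letters[OF p \<kappa>_all] \<kappa>[OF j] e_arc[OF j False] arm_closed[OF p \<kappa>_all j] by simp_all
    have "r (arm k X v e p \<kappa> j) = ?c \<otimes>\<^bsub>W n\<^esub> \<phi> (v k) (\<kappa> j) \<otimes>\<^bsub>W n\<^esub> inv\<^bsub>W n\<^esub> \<phi> (v k) (\<kappa> j)"
      using False cl r(2)[of "v k" "\<kappa> j"] r(3)[OF e_arc[OF j False]] \<epsilon>_e[OF j False] \<kappa>[OF j]
      by (simp add: arm_def P_def[symmetric] r_mult)
    then have "r (arm k X v e p \<kappa> j) = ?c" using c \<phi>_closed[OF j] by (simp add: W.m_assoc)
    moreover have "\<phi> (v j) (flip (vgroup X (v j))) = gen n j"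
      using j flip(2)[OF vgroup_group vgroup_F[OF j]] by (simp add: \<phi>_def ind_v)
    ultimately show ?thesis
      using cl j r(2)[of "v j"] by (simp add: loop_def P_def[symmetric] r_mult r_inv)
  qed
  have r\<eta>: "r (\<eta> w) = ?c \<otimes>\<^bsub>W n\<^esub> w \<otimes>\<^bsub>W n\<^esub> inv\<^bsub>W n\<^esub> ?c" if "w \<in> carrier (W n)" for w
    using W.hom_ext[OF W.is_group Group.hom_compose[OF \<eta>(1) r(1)] iso_imp_homomorphism[OF W.conj_iso[OF c]] _ that]
      \<eta>(2) r_loop by simp
  have inj: "inj_on \<eta> (carrier (W n))"
  proof (rule inj_onI)
    fix w w' assume w: "w \<in> carrier (W n)" "w' \<in> carrier (W n)" "\<eta> w = \<eta> w'"
    then show "w = w'" using r\<eta>[of w] r\<eta>[of w'] W.conj_iso[OF c] by (auto simp: iso_def bij_betw_def inj_on_def)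
  qed
  have sub: "subgroup (carrier (fundamental_group X u)) P"
  proof (rule subgroupI)
    show "carrier (fundamental_group X u) \<subseteq> carrier P"
      by (auto simp: fundamental_carrier dest: is_path_letters)
    have "is_path X u [] u" using is_path_verts[OF p] by simp
    then show "carrier (fundamental_group X u) \<noteq> {}" unfolding fundamental_carrier by blast
    show "inv a \<in> carrier (fundamental_group X u)" if "a \<in> carrier (fundamental_group X u)" for a
    proof -
      obtain s where s: "is_path X u s u" "a = path_class X s"
        using \<open>a \<in> _\<close> unfolding fundamental_carrier by blast
      from is_path_reverse[OF s(1)] show ?thesis unfolding s(2) fundamental_carrier by (metis (mono_tags, lifting) mem_Collect_eq)
    qed
    show "a \<otimes> b \<in> carrier (fundamental_group X u)"
      if "a \<in> carrier (fundamental_group X u)" "b \<in> carrier (fundamental_group X u)" for a b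
    proof -
      obtain s t where "is_path X u s u" "a = path_class X s" "is_path X u t u" "b = path_class X t"
        using \<open>a \<in> _\<close> \<open>b \<in> _\<close> unfolding fundamental_carrier by blast
      then have "is_path X u (s @ t) u \<and> a \<otimes> b = path_class X (s @ t)"
        using is_path_appendI is_path_letters path_class_append by simp
      then show ?thesis unfolding fundamental_carrier by blast
    qed
  qed
  have img_sub: "\<eta> ` carrier (W n) \<subseteq> carrier (fundamental_group X u)"
  proof -
    have "\<eta> (word_ev (W n) (gen n) js) \<in> carrier (fundamental_group X u)" if "set js \<subseteq> {..<n}" for js
      using that
    proof (induction js)
      case Nil
      then show ?case using hom_one[OF \<eta>(1)] W.is_group is_group subgroup.one_closed[OF sub] by simp
    next
      case (Cons j js)
      then show ?case
        using \<eta>(2)[of j] loop(3)[of j] hom_mult[OF \<eta>(1), where x = "gen n j" and y = "word_ev (W n) (gen n) js"]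
          subgroup.m_closed[OF sub] by simp
    qed
    then show ?thesis using W.reduced_exists by (metis image_subsetI)
  qed
  have "subgroup (\<eta> ` carrier (W n)) P"
    using group_hom.img_is_subgroup[of "W n" P \<eta>] \<eta>(1) W.is_group is_group
    by (simp add: group_hom_def group_hom_axioms_def)
  moreover have "loop k X v e p \<kappa> j \<in> \<eta> ` carrier (W n)" if "j < n" for j
    using \<eta>(2)[OF that] that by (metis W.x_closed imageI)
  ultimately have "carrier (fundamental_group X u) \<subseteq> \<eta> ` carrier (W n)"
    using loops_generate[OF p \<kappa>_all] by (auto simp: fundamental_carrier)
  then have "bij_betw \<eta> (carrier (W n)) (carrier (fundamental_group X u))"
    using inj img_sub by (auto simp: bij_betw_def)
  then have "\<eta> \<in> iso (W n) (fundamental_group X u)"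
    using hom_fundamentalI[OF \<eta>(1) img_sub] by (simp add: iso_def)
  then show ?thesis using that \<eta>(2) by blast
qed

end

section \<open>Equivalence of marked stars\<close>

text \<open>For an arc followed by its reverse, the factors contributed by the twists and the arcs
  cancel in pairs from the inside out.\<close>

lemma path_substitution_iso:
  assumes "trivially_edged X" "trivially_edged Y" and f: "gog_iso X Y f"
  shows "path_substitution X Y (iso_letter X Y f) (on_verts f)"
proof -
  interpret X: trivially_edged X "path_group X" by fact
  interpret Y: trivially_edged Y "path_group Y" by fact
  note fI = f[unfolded gog_iso_def]
  have fv: "on_verts f v \<in> verts (graph Y)" if "v \<in> verts (graph X)" for v
    using fI that by (auto simp: bij_betw_def)
  have fg: "on_vgroup f v \<in> hom (vgroup X v) (vgroup Y (on_verts f v))" if "v \<in> verts (graph X)" for v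
    using fI that by (auto simp: iso_def)
  have fe: "on_arcs f e \<in> arcs (graph Y)" if "e \<in> arcs (graph X)" for e
    using fI that by (auto simp: bij_betw_def)
  have ends: "tail (graph Y) (on_arcs f e) = on_verts f (tail (graph X) e)"
    "head (graph Y) (on_arcs f e) = on_verts f (head (graph X) e)"
    "rev_arc Y (on_arcs f e) = on_arcs f (rev_arc X e)"
    "twist f e \<in> carrier (vgroup Y (on_verts f (head (graph X) e)))"
    if "e \<in> arcs (graph X)" for e
    using fI that by auto
  have tw: "twist f (rev_arc X e) \<in> carrier (vgroup Y (on_verts f (tail (graph X) e)))"
    if "e \<in> arcs (graph X)" for e
    using ends(4)[of "rev_arc X e"] that by simp
  have inv_tw: "inv\<^bsub>vgroup Y (on_verts f (head (graph X) e))\<^esub> twist f e \<in> carrier (vgroup Y (on_verts f (head (graph X) e)))"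
    "inv\<^bsub>vgroup Y (on_verts f (tail (graph X) e))\<^esub> twist f (rev_arc X e) \<in> carrier (vgroup Y (on_verts f (tail (graph X) e)))"
    if "e \<in> arcs (graph X)" for e
    using ends(4)[OF that] tw[OF that] Y.vgroup_group[OF fv] that
    by (simp_all add: group.inv_closed)
  show ?thesis
  proof
    show "is_path Y (on_verts f v) (iso_letter X Y f (Vert v g)) (on_verts f v)"
      if "v \<in> verts (graph X)" "g \<in> carrier (vgroup X v)" for v g
      using fv that hom_in_carrier[OF fg] by simp
    show "is_path Y (on_verts f (tail (graph X) e)) (iso_letter X Y f (Edge e)) (on_verts f (head (graph X) e))"
      if "e \<in> arcs (graph X)" for e
      using that fv ends fe tw inv_tw by (simp add: Let_def)
    show "(\<lambda>g. path_class Y (iso_letter X Y f (Vert v g))) \<in> hom (vgroup X v) (path_group Y)"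
      if "v \<in> verts (graph X)" for v
      using Group.hom_compose[OF fg[OF that] Y.vert_class_hom[OF fv[OF that]]] by (simp add: o_def)
    show "path_class Y (iso_letter X Y f (Edge e)) \<otimes>\<^bsub>path_group Y\<^esub>
        path_class Y (iso_letter X Y f (Edge (rev_arc X e))) = \<one>\<^bsub>path_group Y\<^esub>"
      if e: "e \<in> arcs (graph X)" for e
    proof -
      let ?s = "on_verts f (tail (graph X) e)" and ?t = "on_verts f (head (graph X) e)"
      let ?a = "vert_class Y ?s (twist f (rev_arc X e))" and ?a' = "vert_class Y ?s (inv\<^bsub>vgroup Y ?s\<^esub> twist f (rev_arc X e))"
        and ?b = "vert_class Y ?t (twist f e)" and ?b' = "vert_class Y ?t (inv\<^bsub>vgroup Y ?t\<^esub> twist f e)"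
        and ?E = "edge_class Y (on_arcs f e)" and ?E' = "edge_class Y (rev_arc Y (on_arcs f e))"
      have st: "?s \<in> verts (graph Y)" "?t \<in> verts (graph Y)" using e fv by simp_all
      interpret s: group "vgroup Y ?s" using st by (simp add: Y.vgroup_group)
      interpret t: group "vgroup Y ?t" using st by (simp add: Y.vgroup_group)
      have cl: "?a \<in> carrier (path_group Y)" "?a' \<in> carrier (path_group Y)" "?b \<in> carrier (path_group Y)"
        "?b' \<in> carrier (path_group Y)" "?E \<in> carrier (path_group Y)" "?E' \<in> carrier (path_group Y)"
        using st tw[OF e] ends(4)[OF e] fe[OF e] by simp_all
      have 1: "?a \<otimes>\<^bsub>path_group Y\<^esub> ?a' = \<one>\<^bsub>path_group Y\<^esub>" "?b' \<otimes>\<^bsub>path_group Y\<^esub> ?b = \<one>\<^bsub>path_group Y\<^esub>"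
        "?E \<otimes>\<^bsub>path_group Y\<^esub> ?E' = \<one>\<^bsub>path_group Y\<^esub>"
        using st tw[OF e] ends(4)[OF e] fe[OF e] by (simp_all add: Y.vert_class_mult Y.edge_class_rev)
      have "path_class Y (iso_letter X Y f (Edge e)) = ?a \<otimes>\<^bsub>path_group Y\<^esub> ?E \<otimes>\<^bsub>path_group Y\<^esub> ?b'"
        using st tw[OF e] ends(4)[OF e] fe[OF e] cl
        by (simp add: Let_def Y.path_class_Cons[of _ "[_, _]"] Y.path_class_Cons[of _ "[_]"] Y.m_assoc)
      moreover have "path_class Y (iso_letter X Y f (Edge (rev_arc X e))) = ?b \<otimes>\<^bsub>path_group Y\<^esub> ?E' \<otimes>\<^bsub>path_group Y\<^esub> ?a'"
        using st tw[OF e] ends[OF e] fe[OF e] fe[of "rev_arc X e"] cl e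
        by (simp add: Let_def Y.path_class_Cons[of _ "[_, _]"] Y.path_class_Cons[of _ "[_]"] Y.m_assoc)
      moreover have "?a \<otimes>\<^bsub>path_group Y\<^esub> ?E \<otimes>\<^bsub>path_group Y\<^esub> ?b' \<otimes>\<^bsub>path_group Y\<^esub> (?b \<otimes>\<^bsub>path_group Y\<^esub> ?E' \<otimes>\<^bsub>path_group Y\<^esub> ?a')
        = ?a \<otimes>\<^bsub>path_group Y\<^esub> (?E \<otimes>\<^bsub>path_group Y\<^esub> (?b' \<otimes>\<^bsub>path_group Y\<^esub> ?b) \<otimes>\<^bsub>path_group Y\<^esub> ?E') \<otimes>\<^bsub>path_group Y\<^esub> ?a'"
        using cl by (simp only: Y.m_assoc Y.m_closed)
      ultimately show ?thesis using cl by (simp add: 1)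
    qed
  qed (use fv in auto)
qed

locale star_iso = star_of_groups X P n k v e + Y: trivially_edged Y Q
  for X :: "('v, 'e, 'g, 'h) graph_of_groups" and P :: "('v, 'e, 'g) letter list set monoid" (structure)
    and n k v e and Y :: "('v, 'e, 'g, 'h) graph_of_groups" and Q :: "('v, 'e, 'g) letter list set monoid" +
  fixes f :: "('v, 'e, 'g, 'h) gog_morphism"
  assumes f: "gog_iso X Y f"
begin

lemma f_vert: "w \<in> verts (graph X) \<Longrightarrow> on_verts f w \<in> verts (graph Y)"
  and f_vgroup: "w \<in> verts (graph X) \<Longrightarrow> on_vgroup f w \<in> iso (vgroup X w) (vgroup Y (on_verts f w))"
  and f_arc: "a \<in> arcs (graph X) \<Longrightarrow> on_arcs f a \<in> arcs (graph Y)"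
  and f_tail: "a \<in> arcs (graph X) \<Longrightarrow> tail (graph Y) (on_arcs f a) = on_verts f (tail (graph X) a)"
  and f_head: "a \<in> arcs (graph X) \<Longrightarrow> head (graph Y) (on_arcs f a) = on_verts f (head (graph X) a)"
  and f_rev: "a \<in> arcs (graph X) \<Longrightarrow> rev_arc Y (on_arcs f a) = on_arcs f (rev_arc X a)"
  and f_twist: "a \<in> arcs (graph X) \<Longrightarrow> twist f a \<in> carrier (vgroup Y (on_verts f (head (graph X) a)))"
  using f by (auto simp: gog_iso_def bij_betw_def)

sublocale iso: path_substitution X P Y Q "iso_letter X Y f" "on_verts f"
  unfolding P_def Y.P_def
  by (rule path_substitution_iso[OF _ _ f]) (use trivially_edged_axioms Y.trivially_edged_axioms in auto)

lemma star_image: "star n k Y (on_verts f \<circ> v) (on_arcs f \<circ> e)"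
  unfolding star_def
proof (intro conjI allI ballI impI)
  have bv: "bij_betw (on_verts f) (verts (graph X)) (verts (graph Y))"
    and ba: "bij_betw (on_arcs f) (arcs (graph X)) (arcs (graph Y))"
    using f by (auto simp: gog_iso_def)
  show "k \<le> n" by (rule k_le)
  show "inj_on (on_verts f \<circ> v) (insert k {..<n})"
    using v_inj bv unfolding verts_eq by (intro comp_inj_on) (auto simp: bij_betw_def)
  show "verts (graph Y) = (on_verts f \<circ> v) ` insert k {..<n}"
    using bv unfolding verts_eq by (auto simp: bij_betw_def)
  show "vgroup Y ((on_verts f \<circ> v) j) \<cong> F" if "j < n" for j
  proof -
    have "vgroup X (v j) \<cong> vgroup Y (on_verts f (v j))"
      using f_vgroup[OF v_vert(1)[OF that]] by (auto simp: is_iso_def)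
    then show ?thesis
      using vgroup_F[OF that] group.iso_sym[OF vgroup_group] that by (metis comp_apply iso_trans v_vert(1))
  qed
  show "trivial_group (vgroup Y ((on_verts f \<circ> v) n))" if "k = n"
  proof -
    have "vgroup X (v n) \<cong> vgroup Y (on_verts f (v n))" using f_vgroup[of "v n"] that v_vert by (auto simp: is_iso_def)
    then show ?thesis
      using vgroup_centre[OF that] isomorphic_group_triviality1 Y.vgroup_group[OF f_vert] v_vert that
      by (metis comp_apply)
  qed
  show "arcs (graph Y) = (\<Union>j\<in>{..<n} - {k}. {(on_arcs f \<circ> e) j, rev_arc Y ((on_arcs f \<circ> e) j)})"
  proof -
    have "arcs (graph Y) = on_arcs f ` (\<Union>j\<in>{..<n} - {k}. {e j, rev_arc X (e j)})"
      using ba unfolding arcs_eq by (auto simp: bij_betw_def)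
    also have "\<dots> = (\<Union>j\<in>{..<n} - {k}. {on_arcs f (e j), on_arcs f (rev_arc X (e j))})" by auto
    also have "\<dots> = (\<Union>j\<in>{..<n} - {k}. {(on_arcs f \<circ> e) j, rev_arc Y ((on_arcs f \<circ> e) j)})"
      by (rule SUP_cong) (use f_rev e_arc in auto)
    finally show ?thesis .
  qed
qed (use e_arc f_arc f_tail f_head tail_e head_e in auto)

sublocale Y: star_of_groups Y Q n k "on_verts f \<circ> v" "on_arcs f \<circ> e"
  by unfold_locales (rule star_image)

text \<open>The arc \<open>rev_arc X (e j)\<close> points to the centre, so its twist is what
  \<open>f\<close> inserts at the centre end of the arm. It is absorbed into the twist of the image
  star.\<close>

definition image_twist where
  "image_twist \<kappa> j = (if j = k then on_vgroup f (v k) (\<kappa> j)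
    else on_vgroup f (v k) (\<kappa> j) \<otimes>\<^bsub>vgroup Y (on_verts f (v k))\<^esub> twist f (rev_arc X (e j)))"

context
  fixes u p \<kappa> u' p0
  assumes p: "is_path X u p (v k)" and \<kappa>_all: "\<forall>j<n. \<kappa> j \<in> carrier (vgroup X (v k))"
    and p0: "is_path Y u' p0 (on_verts f u)"
begin

lemma f_vgroup_closed: "w \<in> verts (graph X) \<Longrightarrow> g \<in> carrier (vgroup X w) \<Longrightarrow>
    on_vgroup f w g \<in> carrier (vgroup Y (on_verts f w))"
  using hom_in_carrier[OF iso_imp_homomorphism[OF f_vgroup]] by blast

lemma twist_rev: "j < n \<Longrightarrow> j \<noteq> k \<Longrightarrow> twist f (rev_arc X (e j)) \<in> carrier (vgroup Y (on_verts f (v k)))"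
  using f_twist[of "rev_arc X (e j)"] e_arc tail_e by simp

lemma image_twist_closed: "\<forall>j<n. image_twist \<kappa> j \<in> carrier (vgroup Y ((on_verts f \<circ> v) k))"
  using \<kappa>_all f_vgroup_closed[of "v k"] twist_rev Y.vgroup_monoid[OF f_vert, of "v k"]
  by (auto simp: image_twist_def intro!: monoid.m_closed)

lemma image_path: "is_path Y u' (p0 @ concat (map (iso_letter X Y f) p)) ((on_verts f \<circ> v) k)"
  using Y.is_path_appendI[OF p0 iso.ind_path[OF p]] by simp

lemma f_flip: "j < n \<Longrightarrow> on_vgroup f (v j) (flip (vgroup X (v j))) = flip (vgroup Y (on_verts f (v j)))"
proof -
  assume j: "j < n"
  note iso = f_vgroup[OF v_vert(1)[OF j]]
  have gx: "group (vgroup X (v j))" using j by (simp add: vgroup_group)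
  have gy: "group (vgroup Y (on_verts f (v j)))" using j by (simp add: Y.vgroup_group f_vert)
  have "on_vgroup f (v j) (flip (vgroup X (v j))) \<noteq> \<one>\<^bsub>vgroup Y (on_verts f (v j))\<^esub>"
    using hom_one[OF iso_imp_homomorphism[OF iso] gx gy] flip(1,2)[OF gx vgroup_F[OF j]] iso
      monoid.one_closed[OF group.is_monoid[OF gx]]
    by (auto simp: iso_def bij_betw_def inj_on_def)
  then show ?thesis
    using flip_unique[OF gy] Y.vgroup_F[OF j] f_vgroup_closed[of "v j"] j by simp
qed

text \<open>The image of an arm is the arm of the image star up to a factor \<open>d\<close> in the
  group at its end. This factor stems from the twist of \<open>f\<close> there and commutes with the
  flip, so the loops agree.\<close>

lemma loop_image:
  assumes j: "j < n"
  shows "path_class Y p0 \<otimes>\<^bsub>Q\<^esub> iso.ind (loop k X v e p \<kappa> j) \<otimes>\<^bsub>Q\<^esub> inv\<^bsub>Q\<^esub> path_class Y p0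
    = loop k Y (on_verts f \<circ> v) (on_arcs f \<circ> e) (p0 @ concat (map (iso_letter X Y f) p)) (image_twist \<kappa>) j"
    (is "?l = ?r")
proof -
  interpret ind: group_hom P Q iso.ind
    using iso.ind_hom is_group Y.is_group by (simp add: group_hom_def group_hom_axioms_def)
  have p_lets: "p \<in> lists letters" using p by (rule is_path_letters)
  have p0_lets: "p0 \<in> lists Y.letters" using p0 by (rule Y.is_path_letters)
  have fp_lets: "concat (map (iso_letter X Y f) p) \<in> lists Y.letters"
    using iso.ind_path[OF p] by (rule Y.is_path_letters)
  have fp: "iso.ind (path_class X p) = path_class Y (concat (map (iso_letter X Y f) p))"
    using iso.ind_class[OF p_lets] .
  let ?f = "vert_class X (v j) (flip (vgroup X (v j)))"
    and ?f' = "vert_class Y (on_verts f (v j)) (flip (vgroup Y (on_verts f (v j))))"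
  have ff: "iso.ind ?f = ?f'" using j f_flip by (simp add: iso.ind_vert)
  have f'_cl: "?f' \<in> carrier Q" using Y.flip_closed[OF j] f_vert j by simp
  have \<kappa>: "\<kappa> j \<in> carrier (vgroup X (v k))" using \<kappa>_all j by simp
  define A where "A = arm k Y (on_verts f \<circ> v) (on_arcs f \<circ> e) (p0 @ concat (map (iso_letter X Y f) p)) (image_twist \<kappa>) j"
  have A_cl: "A \<in> carrier Q"
    unfolding A_def using Y.arm_closed[OF image_path image_twist_closed j] .
  have arm_cl: "arm k X v e p \<kappa> j \<in> carrier P" using arm_closed[OF p \<kappa>_all j] .
  have "\<exists>d\<in>carrier (vgroup Y (on_verts f (v j))).
    path_class Y p0 \<otimes>\<^bsub>Q\<^esub> iso.ind (arm k X v e p \<kappa> j) = A \<otimes>\<^bsub>Q\<^esub> vert_class Y (on_verts f (v j)) d"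
  proof (cases "j = k")
    case True
    have "path_class Y p0 \<otimes>\<^bsub>Q\<^esub> iso.ind (arm k X v e p \<kappa> j) = A"
      using True \<kappa> p_lets p0_lets fp_lets fp f_vert f_vgroup_closed[of "v k" "\<kappa> k"]
      by (simp add: A_def arm_def P_def[symmetric] Y.P_def[symmetric] image_twist_def iso.ind_vert
        Y.path_class_append Y.m_assoc)
    then show ?thesis
      using A_cl f_vert j Y.vgroup_monoid[OF f_vert[OF v_vert(1)[OF j]]]
      by (intro bexI[of _ "\<one>\<^bsub>vgroup Y (on_verts f (v j))\<^esub>"]) (auto simp: monoid.one_closed)
  next
    case False
    note a = e_arc[OF j False]
    let ?d = "inv\<^bsub>vgroup Y (on_verts f (v j))\<^esub> twist f (e j)"
    have d: "?d \<in> carrier (vgroup Y (on_verts f (v j)))"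
      using f_twist[OF a] head_e[OF j False] Y.vgroup_group[OF f_vert[OF v_vert(1)[OF j]]]
      by (simp add: group.inv_closed)
    have tw: "twist f (rev_arc X (e j)) \<in> carrier (vgroup Y (on_verts f (v k)))"
      by (rule twist_rev[OF j False])
    have cl: "vert_class Y (on_verts f (v k)) (twist f (rev_arc X (e j))) \<in> carrier Q"
      "vert_class Y (on_verts f (v k)) (on_vgroup f (v k) (\<kappa> j)) \<in> carrier Q"
      "edge_class Y (on_arcs f (e j)) \<in> carrier Q" "vert_class Y (on_verts f (v j)) ?d \<in> carrier Q"
      using tw d f_vert f_arc[OF a] j f_vgroup_closed[OF _ \<kappa>] by simp_all
    have "iso.ind (edge_class X (e j)) = vert_class Y (on_verts f (v k)) (twist f (rev_arc X (e j)))
        \<otimes>\<^bsub>Q\<^esub> edge_class Y (on_arcs f (e j)) \<otimes>\<^bsub>Q\<^esub> vert_class Y (on_verts f (v j)) ?d"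
      using a tail_e[OF j False] head_e[OF j False] tw d f_vert f_arc[OF a] j cl
      by (simp add: iso.ind_edge Let_def Y.path_class_Cons[of _ "[_, _]"] Y.path_class_Cons[of _ "[_]"] Y.m_assoc)
    moreover have "vert_class Y (on_verts f (v k)) (image_twist \<kappa> j)
      = vert_class Y (on_verts f (v k)) (on_vgroup f (v k) (\<kappa> j))
        \<otimes>\<^bsub>Q\<^esub> vert_class Y (on_verts f (v k)) (twist f (rev_arc X (e j)))"
      using False tw f_vgroup_closed[OF _ \<kappa>] f_vert by (simp add: image_twist_def Y.vert_class_mult)
    ultimately have "path_class Y p0 \<otimes>\<^bsub>Q\<^esub> iso.ind (arm k X v e p \<kappa> j) = A \<otimes>\<^bsub>Q\<^esub> vert_class Y (on_verts f (v j)) ?d"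
      using False \<kappa> p_lets p0_lets fp_lets fp f_vert f_vgroup_closed[of "v k" "\<kappa> j"] cl a
      by (simp add: A_def arm_def P_def[symmetric] Y.P_def[symmetric] iso.ind_vert Y.path_class_append Y.m_assoc)
    then show ?thesis using d by blast
  qed
  then obtain d where d: "d \<in> carrier (vgroup Y (on_verts f (v j)))"
    "path_class Y p0 \<otimes>\<^bsub>Q\<^esub> iso.ind (arm k X v e p \<kappa> j) = A \<otimes>\<^bsub>Q\<^esub> vert_class Y (on_verts f (v j)) d" by blast
  let ?d = "vert_class Y (on_verts f (v j)) d"
  have d_cl: "?d \<in> carrier Q" using d f_vert j by simp
  have "?l = path_class Y p0 \<otimes>\<^bsub>Q\<^esub> (iso.ind (arm k X v e p \<kappa> j) \<otimes>\<^bsub>Q\<^esub> ?f' \<otimes>\<^bsub>Q\<^esub> inv\<^bsub>Q\<^esub> iso.ind (arm k X v e p \<kappa> j)) \<otimes>\<^bsub>Q\<^esub> inv\<^bsub>Q\<^esub> path_class Y p0"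
    using arm_cl j by (simp add: loop_def P_def[symmetric] ff)
  also have "\<dots> = (A \<otimes>\<^bsub>Q\<^esub> ?d) \<otimes>\<^bsub>Q\<^esub> ?f' \<otimes>\<^bsub>Q\<^esub> inv\<^bsub>Q\<^esub> (A \<otimes>\<^bsub>Q\<^esub> ?d)"
    using arm_cl p0_lets f'_cl by (subst Y.conj_conj) (simp_all add: d(2))
  also have "\<dots> = A \<otimes>\<^bsub>Q\<^esub> (?d \<otimes>\<^bsub>Q\<^esub> ?f' \<otimes>\<^bsub>Q\<^esub> inv\<^bsub>Q\<^esub> ?d) \<otimes>\<^bsub>Q\<^esub> inv\<^bsub>Q\<^esub> A"
    using A_cl d_cl f'_cl by (subst Y.conj_conj) simp_all
  also have "?d \<otimes>\<^bsub>Q\<^esub> ?f' \<otimes>\<^bsub>Q\<^esub> inv\<^bsub>Q\<^esub> ?d = ?f'"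
    using Y.vgroup_abelian_flip[OF j, of d] d d_cl f'_cl by (simp add: Y.m_assoc)
  also have "A \<otimes>\<^bsub>Q\<^esub> ?f' \<otimes>\<^bsub>Q\<^esub> inv\<^bsub>Q\<^esub> A = ?r"
    by (simp add: A_def loop_def Y.P_def[symmetric])
  finally show ?thesis .
qed

end

end

text \<open>The dictionary between marked graphs and bases: the marking sends \<open>b\<close> to
  the loops for some numbering, some path to the centre and some twists at the centre. These choices
  account for reordering, simultaneous conjugation and independent conjugation by
  \<open>b k\<close>.\<close>

definition marks :: "nat \<Rightarrow> nat \<Rightarrow> marked_gog \<Rightarrow> (nat \<Rightarrow> W_elt) \<Rightarrow> bool" where
  "marks n k M b \<longleftrightarrow> (\<exists>v e p \<kappa>. star n k (gog M) v e \<and> is_path (gog M) (base M) p (v k) \<and>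
    (\<forall>j<n. \<kappa> j \<in> carrier (vgroup (gog M) (v k))) \<and>
    (\<forall>j<n. b j \<in> carrier (W n) \<and> marking M (b j) = loop k (gog M) v e p \<kappa> j))"

lemma trivially_edged_marked: "is_marked_gog n M \<Longrightarrow> trivially_edged (gog M)"
  by unfold_locales (auto simp: is_marked_gog_def)

lemma star_of_groups_marked:
  "is_marked_gog n M \<Longrightarrow> star n k (gog M) v e \<Longrightarrow> star_of_groups (gog M) n k v e"
  by (simp add: star_of_groups_def star_of_groups_axioms_def trivially_edged_marked)

context universal_coxeter
begin

text \<open>The map given by \<open>marking_exists\<close> takes the generators to the same loops,
  so the two isomorphisms differ by an automorphism that sends \<open>x j\<close> to
  \<open>b j\<close>.\<close>

lemma marks_basis:
  assumes M: "is_marked_gog n M" and b: "marks n k M b"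
  shows "basis b"
proof -
  obtain v e p \<kappa> where c: "star n k (gog M) v e" "is_path (gog M) (base M) p (v k)"
    "\<forall>j<n. \<kappa> j \<in> carrier (vgroup (gog M) (v k))"
    "\<forall>j<n. b j \<in> carrier G \<and> marking M (b j) = loop k (gog M) v e p \<kappa> j"
    using b unfolding marks_def G_def by blast
  interpret S: star_of_groups "gog M" "path_group (gog M)" n k v e by (rule star_of_groups_marked[OF M c(1)])
  obtain \<eta> where \<eta>: "\<eta> \<in> iso G (fundamental_group (gog M) (base M))"
    "\<And>j. j < n \<Longrightarrow> \<eta> (x j) = loop k (gog M) v e p \<kappa> j"
    by (rule S.marking_exists[OF c(2,3), folded G_def]) blast
  have \<mu>: "marking M \<in> iso G (fundamental_group (gog M) (base M))"
    using M by (simp add: is_marked_gog_def G_def)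
  let ?\<mu>' = "inv_into (carrier G) (marking M)"
  have "?\<mu>' \<circ> \<eta> \<in> iso G G" using iso_set_trans[OF \<eta>(1) iso_set_sym[OF \<mu>]] .
  moreover have "b j = (?\<mu>' \<circ> \<eta>) (x j)" if "j < n" for j
    using \<eta>(2)[OF that] c(4) that \<mu> by (simp add: iso_def bij_betw_def) (metis inv_into_f_f)
  ultimately show ?thesis unfolding basis_def by blast
qed

lemma marks_transfer:
  assumes M: "is_marked_gog n M" and N: "is_marked_gog n N" and eq: "marked_equiv n M N" and b: "marks n k M b"
  shows "marks n k N b"
proof -
  obtain v e p \<kappa> where c: "star n k (gog M) v e" "is_path (gog M) (base M) p (v k)"
    "\<forall>j<n. \<kappa> j \<in> carrier (vgroup (gog M) (v k))"
    "\<forall>j<n. b j \<in> carrier G \<and> marking M (b j) = loop k (gog M) v e p \<kappa> j"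
    using b unfolding marks_def G_def by blast
  obtain f p0 where f: "gog_iso (gog M) (gog N) f" "is_path (gog N) (base N) p0 (on_verts f (base M))"
    "\<forall>w\<in>carrier G. marking N w = path_class (gog N) p0 \<otimes>\<^bsub>path_group (gog N)\<^esub>
       induced_map (gog N) (iso_letter (gog M) (gog N) f) (marking M w) \<otimes>\<^bsub>path_group (gog N)\<^esub>
       inv\<^bsub>path_group (gog N)\<^esub> path_class (gog N) p0"
    using eq unfolding marked_equiv_def Let_def G_def by blast
  interpret S: star_iso "gog M" "path_group (gog M)" n k v e "gog N" "path_group (gog N)" f
    using star_of_groups_marked[OF M c(1)] trivially_edged_marked[OF N] f(1)
    by (simp add: star_iso_def star_iso_axioms_def)
  note loops = S.loop_image[OF c(2,3) f(2)]
  show ?thesis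
    unfolding marks_def
    using S.star_image S.image_path[OF c(2,3) f(2)] S.image_twist_closed[OF c(2,3) f(2)] c(4) f(3) loops
    unfolding G_def by metis
qed

text \<open>The numberings dictate the isomorphism of graphs; its twists can be chosen at the centre
  ends of the arcs such that they turn \<open>\<kappa>\<close> into \<open>\<kappa>'\<close>. Up to
  a change of path to the base, the markings then agree on the basis \<open>b\<close>, hence
  everywhere.\<close>

lemma marks_equiv:
  assumes M: "is_marked_gog n M" and N: "is_marked_gog n N"
    and bM: "marks n k M b" and bN: "marks n k N b"
  shows "marked_equiv n M N"
proof -
  let ?X = "gog M" and ?Y = "gog N"
  obtain v e p \<kappa> where c: "star n k ?X v e" "is_path ?X (base M) p (v k)"
    "\<forall>j<n. \<kappa> j \<in> carrier (vgroup ?X (v k))"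
    "\<forall>j<n. b j \<in> carrier G \<and> marking M (b j) = loop k ?X v e p \<kappa> j"
    using bM unfolding marks_def G_def by blast
  obtain v' e' p' \<kappa>' where c': "star n k ?Y v' e'" "is_path ?Y (base N) p' (v' k)"
    "\<forall>j<n. \<kappa>' j \<in> carrier (vgroup ?Y (v' k))"
    "\<forall>j<n. b j \<in> carrier G \<and> marking N (b j) = loop k ?Y v' e' p' \<kappa>' j"
    using bN unfolding marks_def G_def by blast
  interpret X: star_of_groups ?X "path_group ?X" n k v e by (rule star_of_groups_marked[OF M c(1)])
  interpret Z: star_of_groups ?Y "path_group ?Y" n k v' e' by (rule star_of_groups_marked[OF N c'(1)])
  define ind where "ind w = inv_into (insert k {..<n}) v w" for w
  have ind_v [simp]: "ind (v j) = j" if "j < n \<or> j = k" for j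
    unfolding ind_def using that X.v_inj by (intro inv_into_f_f) auto
  define fv where "fv w = v' (ind w)" for w
  define fa where "fa a = (if tail (graph ?X) a = v k then e' (ind (head (graph ?X) a))
    else rev_arc ?Y (e' (ind (tail (graph ?X) a))))" for a
  define fg where "fg w g = (if g = \<one>\<^bsub>vgroup ?X w\<^esub> then \<one>\<^bsub>vgroup ?Y (fv w)\<^esub> else flip (vgroup ?Y (fv w)))" for w g
  \<comment> \<open>An arc with head \<open>v k\<close> is some reversed \<open>e j\<close>. Its
    twist is chosen such that \<open>image_twist\<close> sends \<open>\<kappa> j\<close> to
    \<open>\<kappa>' j\<close>; leaf ends get the identity.\<close>
  define tw where "tw a = (if head (graph ?X) a = v k then
      inv\<^bsub>vgroup ?Y (v' k)\<^esub> fg (v k) (\<kappa> (ind (tail (graph ?X) a))) \<otimes>\<^bsub>vgroup ?Y (v' k)\<^esub> \<kappa>' (ind (tail (graph ?X) a))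
    else \<one>\<^bsub>vgroup ?Y (fv (head (graph ?X) a))\<^esub>)" for a
  define f where "f = \<lparr>on_verts = fv, on_arcs = fa, on_vgroup = fg,
    on_egroup = (\<lambda>a _. \<one>\<^bsub>egroup ?Y (fa a)\<^esub>), twist = tw\<rparr>"
  have fv_v [simp]: "fv (v j) = v' j" if "j < n \<or> j = k" for j using that by (simp add: fv_def)
  have arc_cases: "\<exists>j<n. j \<noteq> k \<and> (a = e j \<or> a = rev_arc ?X (e j))" if "a \<in> arcs (graph ?X)" for a
    using that X.arcs_eq by auto
  have fa_e [simp]: "fa (e j) = e' j" "fa (rev_arc ?X (e j)) = rev_arc ?Y (e' j)" if "j < n" "j \<noteq> k" for j
    using that X.e_arc X.tail_e X.head_e X.v_eq_iff by (simp_all add: fa_def)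
  have fg_iso: "fg w \<in> iso (vgroup ?X w) (vgroup ?Y (fv w))" if "w \<in> verts (graph ?X)" for w
  proof -
    obtain j where j: "w = v j" "j < n \<or> j = k" using \<open>w \<in> _\<close> X.verts_eq by auto
    show ?thesis
    proof (cases "j < n")
      case True
      note A = flip[OF X.vgroup_group X.vgroup_F[OF True]] and B = flip[OF Z.vgroup_group Z.vgroup_F[OF True]]
      have bij: "bij_betw (fg (v j)) (carrier (vgroup ?X (v j))) (carrier (vgroup ?Y (v' j)))"
        using A(2,4) B(2,4) True unfolding bij_betw_def inj_on_def by (auto simp: fg_def)
      have gx: "group (vgroup ?X (v j))" and gy: "group (vgroup ?Y (v' j))"
        using True by (simp_all add: X.vgroup_group Z.vgroup_group)
      have "fg (v j) \<in> hom (vgroup ?X (v j)) (vgroup ?Y (v' j))"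
        using A B True group.is_monoid[OF gx] group.is_monoid[OF gy]
        by (intro homI) (auto simp: fg_def monoid.l_one monoid.r_one monoid.one_closed)
      then show ?thesis using bij j True by (simp add: iso_def)
    next
      case False
      then have "k = n" "j = n" using j X.k_le by auto
      then have "trivial_group (vgroup ?X (v n))" "trivial_group (vgroup ?Y (v' n))"
        using X.vgroup_centre Z.vgroup_centre by auto
      moreover from this have "\<one>\<^bsub>vgroup ?X (v n)\<^esub> \<otimes>\<^bsub>vgroup ?X (v n)\<^esub> \<one>\<^bsub>vgroup ?X (v n)\<^esub> = \<one>\<^bsub>vgroup ?X (v n)\<^esub>"
        "\<one>\<^bsub>vgroup ?Y (v' n)\<^esub> \<otimes>\<^bsub>vgroup ?Y (v' n)\<^esub> \<one>\<^bsub>vgroup ?Y (v' n)\<^esub> = \<one>\<^bsub>vgroup ?Y (v' n)\<^esub>"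
        by (simp_all add: trivial_group_def group.is_monoid monoid.l_one monoid.one_closed)
      ultimately show ?thesis using j \<open>j = n\<close> \<open>k = n\<close>
        by (simp add: trivial_group_def fg_def iso_def hom_def bij_betw_def)
    qed
  qed
  have fg_closed: "fg (v k) (\<kappa> j) \<in> carrier (vgroup ?Y (v' k))" if "j < n" for j
    using hom_in_carrier[OF iso_imp_homomorphism[OF fg_iso[of "v k"]]] c(3) that by simp
  have gk: "group (vgroup ?Y (v' k))" by (simp add: Z.vgroup_group)
  have tw_closed: "inv\<^bsub>vgroup ?Y (v' k)\<^esub> fg (v k) (\<kappa> j) \<otimes>\<^bsub>vgroup ?Y (v' k)\<^esub> \<kappa>' j \<in> carrier (vgroup ?Y (v' k))"
    if "j < n" for j
    using that fg_closed c'(3) gk by (simp add: group.inv_closed group.is_monoid monoid.m_closed)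
  have f: "gog_iso ?X ?Y f"
    unfolding gog_iso_def
  proof (intro conjI ballI)
    have "inj_on fv (verts (graph ?X))"
      using Z.v_eq_iff unfolding X.verts_eq by (auto simp: inj_on_def)
    moreover have "fv ` verts (graph ?X) = verts (graph ?Y)"
      unfolding X.verts_eq Z.verts_eq by (auto simp: image_image)
    ultimately show "bij_betw (on_verts f) (verts (graph ?X)) (verts (graph ?Y))"
      by (simp add: f_def bij_betw_def)
    have "fa ` arcs (graph ?X) = (\<Union>j\<in>{..<n} - {k}. {fa (e j), fa (rev_arc ?X (e j))})"
      unfolding X.arcs_eq by (simp only: image_UN image_insert image_empty)
    also have "\<dots> = arcs (graph ?Y)" unfolding Z.arcs_eq by (rule SUP_cong) auto
    finally have "fa ` arcs (graph ?X) = arcs (graph ?Y)" .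
    moreover have "inj_on fa (arcs (graph ?X))"
    proof (rule inj_onI)
      fix a a' assume a: "a \<in> arcs (graph ?X)" "a' \<in> arcs (graph ?X)" "fa a = fa a'"
      obtain i j where i: "i < n" "i \<noteq> k" "a = e i \<or> a = rev_arc ?X (e i)"
        and j: "j < n" "j \<noteq> k" "a' = e j \<or> a' = rev_arc ?X (e j)"
        using arc_cases a by metis
      have ends: "tail (graph ?Y) (e' i) = v' k" "head (graph ?Y) (e' i) = v' i"
        "tail (graph ?Y) (rev_arc ?Y (e' i)) = v' i" "head (graph ?Y) (rev_arc ?Y (e' i)) = v' k"
        if "i < n" "i \<noteq> k" for i
        using that Z.e_arc Z.tail_e Z.head_e by simp_all
      show "a = a'"
        using i j a(3) ends[of i] ends[of j] Z.v_eq_iff by (metis fa_e)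
    qed
    ultimately show "bij_betw (on_arcs f) (arcs (graph ?X)) (arcs (graph ?Y))"
      by (simp add: f_def bij_betw_def)
    show "on_vgroup f w \<in> iso (vgroup ?X w) (vgroup ?Y (on_verts f w))" if "w \<in> verts (graph ?X)" for w
      using fg_iso[OF that] by (simp add: f_def)
  next
    fix a assume a: "a \<in> arcs (graph ?X)"
    obtain j where j: "j < n" "j \<noteq> k" "a = e j \<or> a = rev_arc ?X (e j)" using arc_cases a by metis
    note e = X.e_arc[OF j(1,2)] X.tail_e[OF j(1,2)] X.head_e[OF j(1,2)]
      Z.e_arc[OF j(1,2)] Z.tail_e[OF j(1,2)] Z.head_e[OF j(1,2)]
    show "tail (graph ?Y) (on_arcs f a) = on_verts f (tail (graph ?X) a)"
      "head (graph ?Y) (on_arcs f a) = on_verts f (head (graph ?X) a)"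
      and rev: "rev_arc ?Y (on_arcs f a) = on_arcs f (rev_arc ?X a)"
      using j(3) e j(1,2) by (auto simp: f_def)
    have fa: "fa a \<in> arcs (graph ?Y)" using j(3) e j(1,2) by auto
    have triv: "trivial_group (egroup ?X a)" "trivial_group (egroup ?Y (fa a))"
      using X.triv[OF a] Z.triv[OF fa] .
    then show "on_egroup f a \<in> iso (egroup ?X a) (egroup ?Y (on_arcs f a))"
      by (auto simp: f_def trivial_group_def iso_def hom_def bij_betw_def group.is_monoid)
    show twist: "twist f a \<in> carrier (vgroup ?Y (on_verts f (head (graph ?X) a)))"
      using j(3) e j(1,2) tw_closed[OF j(1)] X.v_eq_iff[of j k] Z.vgroup_monoid[of "v' j"]
      by (auto simp: f_def tw_def monoid.one_closed)
    fix g assume g: "g \<in> carrier (egroup ?X a)"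
    have "egroup ?Y (rev_arc ?Y (fa a)) = egroup ?Y (fa a)"
      using Z.gog fa by (auto simp: is_graph_of_groups_def)
    then show "on_egroup f (rev_arc ?X a) g = on_egroup f a g"
      using rev by (simp add: f_def)
    have head: "fv (head (graph ?X) a) = head (graph ?Y) (fa a)" using j(3) e j(1,2) by auto
    have "emb ?Y (fa a) \<one>\<^bsub>egroup ?Y (fa a)\<^esub> = \<one>\<^bsub>vgroup ?Y (fv (head (graph ?X) a))\<^esub>"
      using Z.emb_one[OF fa, of "\<one>\<^bsub>egroup ?Y (fa a)\<^esub>"] triv(2) unfolding head by (auto simp: trivial_group_def)
    moreover have "group (vgroup ?Y (fv (head (graph ?X) a)))"
      unfolding head using Z.vgroup_group Z.head_in_verts[OF fa] by blast
    then have "tw a \<otimes>\<^bsub>vgroup ?Y (fv (head (graph ?X) a))\<^esub> \<one>\<^bsub>vgroup ?Y (fv (head (graph ?X) a))\<^esub>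
      \<otimes>\<^bsub>vgroup ?Y (fv (head (graph ?X) a))\<^esub> inv\<^bsub>vgroup ?Y (fv (head (graph ?X) a))\<^esub> tw a
      = \<one>\<^bsub>vgroup ?Y (fv (head (graph ?X) a))\<^esub>"
      using twist by (simp add: f_def group.is_monoid monoid.r_one group.r_inv)
    ultimately show "let K = vgroup ?Y (on_verts f (head (graph ?X) a)) in
        on_vgroup f (head (graph ?X) a) (emb ?X a g) =
          twist f a \<otimes>\<^bsub>K\<^esub> emb ?Y (on_arcs f a) (on_egroup f a g) \<otimes>\<^bsub>K\<^esub> inv\<^bsub>K\<^esub> twist f a"
      using X.emb_one[OF a g] by (simp add: f_def fg_def)
  qed
  interpret S: star_iso ?X "path_group ?X" n k v e ?Y "path_group ?Y" f
    using X.star_of_groups_axioms Z.trivially_edged_axioms f by (simp add: star_iso_def star_iso_axioms_def)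
  \<comment> \<open>\<open>q\<close> runs back along the image of \<open>p\<close>, so
    \<open>p' @ q\<close> followed by this image has the class of \<open>p'\<close>.\<close>
  obtain q where q: "is_path ?Y (v' k) q (fv (base M))"
    "path_class ?Y q = inv\<^bsub>path_group ?Y\<^esub> path_class ?Y (concat (map (iso_letter ?X ?Y f) p))"
    using Z.is_path_reverse[OF S.iso.ind_path[OF c(2)]] by (auto simp: f_def)
  have p0: "is_path ?Y (base N) (p' @ q) (on_verts f (base M))"
    using Z.is_path_appendI[OF c'(2) q(1)] by (simp add: f_def)
  let ?c = "path_class ?Y (p' @ q)"
  have lets: "p' \<in> lists Z.letters" "q \<in> lists Z.letters" "concat (map (iso_letter ?X ?Y f) p) \<in> lists Z.letters"
    using Z.is_path_letters[OF c'(2)] Z.is_path_letters[OF q(1)] Z.is_path_letters[OF S.iso.ind_path[OF c(2)]]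
    by auto
  have c_cl: "?c \<in> carrier (path_group ?Y)" using lets by simp
  have cls: "path_class ?Y ((p' @ q) @ concat (map (iso_letter ?X ?Y f) p)) = path_class ?Y p'"
    using lets by (simp add: Z.path_class_append q(2) Z.m_assoc)
  have loop_eq: "loop k ?Y (on_verts f \<circ> v) (on_arcs f \<circ> e) ((p' @ q) @ concat (map (iso_letter ?X ?Y f) p)) (S.image_twist \<kappa>) j
    = loop k ?Y v' e' p' \<kappa>' j" if j: "j < n" for j
  proof (cases "j = k")
    case True
    then have k: "k < n" using j by simp
    show ?thesis
      unfolding True Z.loop_centre[OF c'(2,3) k] S.Y.loop_centre[OF S.image_path[OF c(2,3) p0] S.image_twist_closed[OF c(2,3) p0] k] cls
      by (simp add: f_def)
  next
    case False
    have "S.image_twist \<kappa> j = \<kappa>' j"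
    proof -
      interpret K: group "vgroup ?Y (v' k)" by (rule gk)
      show ?thesis
        using False j X.e_arc X.tail_e X.head_e fg_closed[OF j] c'(3)
        unfolding S.image_twist_def by (simp add: f_def tw_def K.m_assoc[symmetric])
    qed
    then show ?thesis unfolding loop_def arm_def cls using j False by (simp add: f_def)
  qed
  have hN: "marking N \<in> hom G (path_group ?Y)"
    using N Z.iso_fundamentalD(1)[of "marking N" G "base N"] by (simp add: is_marked_gog_def G_def)
  have hM: "marking M \<in> hom G (path_group ?X)"
    using M X.iso_fundamentalD(1)[of "marking M" G "base M"] by (simp add: is_marked_gog_def G_def)
  have "marking N w = ?c \<otimes>\<^bsub>path_group ?Y\<^esub> S.iso.ind (marking M w) \<otimes>\<^bsub>path_group ?Y\<^esub> inv\<^bsub>path_group ?Y\<^esub> ?c"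
    if w: "w \<in> carrier G" for w
  proof -
    let ?h = "(\<lambda>g. ?c \<otimes>\<^bsub>path_group ?Y\<^esub> g \<otimes>\<^bsub>path_group ?Y\<^esub> inv\<^bsub>path_group ?Y\<^esub> ?c) \<circ> (S.iso.ind \<circ> marking M)"
    have "?h \<in> hom G (path_group ?Y)"
      by (intro Group.hom_compose[OF Group.hom_compose[OF hM S.iso.ind_hom]] iso_imp_homomorphism Z.conj_iso c_cl)
    moreover have "marking N (b j) = ?h (b j)" if j: "j < n" for j
      using c(4) c'(4) j S.loop_image[OF c(2,3) p0 j] loop_eq[OF j] by simp
    ultimately have "marking N w = ?h w"
      by (intro basis_hom_ext[OF marks_basis[OF M bM] Z.is_group hN _ _ w])
    then show ?thesis by simp
  qed
  then show ?thesis
    unfolding marked_equiv_def Let_def using f p0 by (auto simp: G_def intro!: exI[of _ f] exI[of _ "p' @ q"])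
qed

text \<open>By \<open>marks_transfer\<close> and \<open>marks_equiv\<close> its members form one
  equivalence class; for a basis \<open>b\<close> and \<open>k \<le> n\<close> it is inhabited by a
  standard star.\<close>

definition star_class :: "nat \<Rightarrow> (nat \<Rightarrow> W_elt) \<Rightarrow> marked_gog set" where
  "star_class k b = {M. is_marked_gog n M \<and> marks n k M b}"

lemma star_class_eqI:
  assumes "is_marked_gog n M" "marks n k M b" "marks n k' M b'"
  shows "star_class k b = star_class k' b'"
  using assms marks_transfer marks_equiv unfolding star_class_def by blast

lemma marked_rel_star_class:
  assumes "is_marked_gog n M" "marks n k M b"
  shows "marked_rel n `` {M} = star_class k b"
  using assms marks_transfer marks_equiv unfolding star_class_def marked_rel_def by blast

end

section \<open>Bases defining the same star\<close>

context star_of_groups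
begin

context
  fixes u p \<kappa>
  assumes p: "is_path X u p (v k)" and \<kappa>_all: "\<forall>j<n. \<kappa> j \<in> carrier (vgroup X (v k))"
begin

text \<open>The centre group has two elements, so a different twist is \<open>\<kappa> j\<close>
  multiplied by the flip. Inserting this flip after \<open>p\<close> amounts to prefixing the arm by
  the loop around the centre.\<close>

lemma loop_conj_centre:
  assumes j: "j < n" "j \<noteq> k" and k: "k < n" and c: "c \<in> carrier (vgroup X (v k))"
    "c \<noteq> \<kappa> j" "\<kappa>' j = c"
  shows "loop k X v e p \<kappa>' j = loop k X v e p \<kappa> k \<otimes> loop k X v e p \<kappa> j \<otimes> loop k X v e p \<kappa> k"
proof -
  note fk = flip[OF vgroup_group vgroup_F[OF k], simplified]
  have \<kappa>: "\<kappa> j \<in> carrier (vgroup X (v k))" using \<kappa>_all j by simp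
  interpret K: group "vgroup X (v k)" using k by (simp add: vgroup_group)
  have c_eq: "c = flip (vgroup X (v k)) \<otimes>\<^bsub>vgroup X (v k)\<^esub> \<kappa> j"
    using c(1,2) \<kappa> fk(4) fk(1,3) k by auto
  let ?f = "vert_class X (v k) (flip (vgroup X (v k)))" and ?c = "path_class X p"
    and ?a = "vert_class X (v k) (\<kappa> j)" and ?E = "edge_class X (e j)"
  have cl: "?f \<in> carrier P" "?c \<in> carrier P" "?a \<in> carrier P" "?E \<in> carrier P" "loop k X v e p \<kappa> k \<in> carrier P"
    "loop k X v e p \<kappa> j \<in> carrier P" "arm k X v e p \<kappa> j \<in> carrier P"
    "vert_class X (v j) (flip (vgroup X (v j))) \<in> carrier P"
    using k j \<kappa> p_letters[OF p \<kappa>_all] e_arc loop_closed[OF p \<kappa>_all] arm_closed[OF p \<kappa>_all] by simp_all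
  have "arm k X v e p \<kappa>' j = ?c \<otimes> (?f \<otimes> ?a) \<otimes> ?E"
    using j c(3) c_eq \<kappa> k vert_class_mult[of "v k"] by (simp add: arm_def P_def[symmetric])
  also have "\<dots> = (?c \<otimes> ?f \<otimes> (inv ?c \<otimes> ?c)) \<otimes> ?a \<otimes> ?E"
    using cl by (simp add: m_assoc)
  also have "\<dots> = loop k X v e p \<kappa> k \<otimes> arm k X v e p \<kappa> j"
    unfolding loop_centre[OF p \<kappa>_all k]
    using cl j by (simp only: arm_def P_def[symmetric] if_False m_assoc m_closed inv_closed)
  finally have "loop k X v e p \<kappa>' j = loop k X v e p \<kappa> k \<otimes> loop k X v e p \<kappa> j \<otimes> inv (loop k X v e p \<kappa> k)"
    using cl by (simp add: loop_def[of _ _ _ _ _ _ j] P_def[symmetric] inv_mult_group m_assoc)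
  then show ?thesis using loop_square[OF p \<kappa>_all k] inv_self[of "loop k X v e p \<kappa> k"] cl by simp
qed

lemma loop_centre_independent:
  "k < n \<Longrightarrow> \<forall>j<n. \<kappa>' j \<in> carrier (vgroup X (v k)) \<Longrightarrow> loop k X v e p \<kappa>' k = loop k X v e p \<kappa> k"
  using loop_centre[OF p \<kappa>_all] loop_centre[OF p] by simp

lemma loop_prepend:
  assumes "is_path X w s u" "j < n"
  shows "loop k X v e (s @ p) \<kappa> j = path_class X s \<otimes> loop k X v e p \<kappa> j \<otimes> inv (path_class X s)"
proof -
  have s: "path_class X s \<in> carrier P" "s \<in> lists letters" using is_path_letters[OF assms(1)] by simp_all
  have cl: "arm k X v e p \<kappa> j \<in> carrier P" "vert_class X (v j) (flip (vgroup X (v j))) \<in> carrier P"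
    "path_class X p \<in> carrier P" "vert_class X (v k) (\<kappa> j) \<in> carrier P"
    using arm_closed[OF p \<kappa>_all] p_letters[OF p \<kappa>_all] \<kappa>_all assms(2) by simp_all
  have "arm k X v e (s @ p) \<kappa> j = path_class X s \<otimes> arm k X v e p \<kappa> j"
    using s cl p_letters[OF p \<kappa>_all] e_arc[of j] assms(2)
    by (simp add: arm_def P_def[symmetric] path_class_append m_assoc)
  then show ?thesis
    using s cl by (simp add: loop_def P_def[symmetric] inv_mult_group m_assoc)
qed

end

lemma star_permute:
  assumes "\<sigma> permutes {..<n}" "\<sigma> k' = k"
  shows "star n k' X (v \<circ> \<sigma>) (e \<circ> \<sigma>)"
proof -
  have lt: "\<sigma> j < n \<longleftrightarrow> j < n" for j using permutes_in_image[OF assms(1), of j] by simp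
  have inj: "inj \<sigma>" using assms(1) by (rule permutes_inj)
  have img: "\<sigma> ` insert k' {..<n} = insert k {..<n}"
    using permutes_image[OF assms(1)] assms(2) by simp
  have k': "k' = n \<longleftrightarrow> k = n" "k' \<le> n"
  proof -
    have "k' < n \<longleftrightarrow> k < n" using lt[of k'] assms(2) by simp
    moreover have "\<not> k' < n \<Longrightarrow> k' = k" using assms permutes_not_in[OF assms(1), of k'] by simp
    ultimately show "k' = n \<longleftrightarrow> k = n" "k' \<le> n" using k_le by auto
  qed
  have ne: "\<sigma> j \<noteq> k" if "j \<noteq> k'" for j using inj that assms(2) by (metis injD)
  show ?thesis
    unfolding star_def
  proof (intro conjI allI ballI impI)
    show "inj_on (v \<circ> \<sigma>) (insert k' {..<n})"
      by (rule comp_inj_on[OF inj_on_subset[OF inj subset_UNIV]]) (unfold img, rule v_inj)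
    show "verts (graph X) = (v \<circ> \<sigma>) ` insert k' {..<n}"
      unfolding verts_eq image_comp[symmetric] img ..
    show "trivial_group (vgroup X ((v \<circ> \<sigma>) n))" if "k' = n"
      using vgroup_centre k' that assms(2) by auto
    have "\<sigma> ` ({..<n} - {k'}) = {..<n} - {k}"
      using permutes_image[OF assms(1)] inj assms(2) by (simp add: image_set_diff)
    then show "arcs (graph X) = (\<Union>j\<in>{..<n} - {k'}. {(e \<circ> \<sigma>) j, rev_arc X ((e \<circ> \<sigma>) j)})"
      unfolding arcs_eq by (metis (no_types, lifting) SUP_cong comp_apply image_image)
  qed (use k' vgroup_F lt e_arc tail_e head_e ne assms in auto)
qed

lemma loop_permute:
  assumes "\<sigma> permutes {..<n}" "\<sigma> k' = k" "\<kappa>' j = \<kappa> (\<sigma> j)"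
  shows "loop k' X (v \<circ> \<sigma>) (e \<circ> \<sigma>) p \<kappa>' j = loop k X v e p \<kappa> (\<sigma> j)"
proof -
  have "\<sigma> j = k \<longleftrightarrow> j = k'" using permutes_inj[OF assms(1)] assms(2) by (metis injD)
  then show ?thesis using assms(2,3) by (simp add: loop_def arm_def)
qed

lemma arc_from_centre:
  "a \<in> arcs (graph X) \<Longrightarrow> tail (graph X) a = v k \<Longrightarrow> \<exists>j<n. j \<noteq> k \<and> a = e j"
proof -
  assume a: "a \<in> arcs (graph X)" "tail (graph X) a = v k"
  then obtain j where j: "j < n" "j \<noteq> k" "a = e j \<or> a = rev_arc X (e j)" unfolding arcs_eq by auto
  have "tail (graph X) (rev_arc X (e j)) \<noteq> v k"
    using e_arc[OF j(1,2)] head_e[OF j(1,2)] v_eq_iff[of j k] j by simp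
  then show ?thesis using j a(2) by auto
qed

lemma arc_from_leaf:
  "a \<in> arcs (graph X) \<Longrightarrow> j < n \<Longrightarrow> j \<noteq> k \<Longrightarrow> tail (graph X) a = v j \<Longrightarrow> a = rev_arc X (e j)"
proof -
  assume a: "a \<in> arcs (graph X)" "j < n" "j \<noteq> k" "tail (graph X) a = v j"
  then obtain i where i: "i < n" "i \<noteq> k" "a = e i \<or> a = rev_arc X (e i)" unfolding arcs_eq by auto
  then have "a \<noteq> e i" using a tail_e[OF i(1,2)] v_eq_iff[of j k] by auto
  then show ?thesis using i a e_arc[OF i(1,2)] head_e[OF i(1,2)] v_eq_iff[of j i] by auto
qed

lemma leaves_eq: "k = n \<Longrightarrow> v ` {..<n} = verts (graph X) - {v k}"
  using v_eq_iff[of _ k] by (auto simp: verts_eq)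

lemma card_verts: "card (verts (graph X)) = (if k = n then Suc n else n)"
proof -
  have "card (verts (graph X)) = card (insert k {..<n})"
    unfolding verts_eq by (rule card_image[OF v_inj])
  then show ?thesis using k_le by (simp add: card_insert_if)
qed

text \<open>A leaf emits one arc, the centre several. This identifies the centre, and only a
  permutation of the leaves is left.\<close>

lemma star_unique:
  assumes "star n k' X v' e'" "n \<ge> 4"
  obtains \<sigma> where "\<sigma> permutes {..<n}" "\<sigma> k' = k" "\<And>j. j < n \<or> j = k' \<Longrightarrow> v' j = v (\<sigma> j)"
    "\<And>j. j < n \<Longrightarrow> j \<noteq> k' \<Longrightarrow> e' j = e (\<sigma> j)"
proof -
  interpret Z: star_of_groups X P n k' v' e'
    by unfold_locales (rule assms(1))
  have kk': "k = n \<longleftrightarrow> k' = n"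
    using card_verts Z.card_verts by (metis n_not_Suc_n)
  have centre: "v' k' = v k"
  proof (rule ccontr)
    assume ne: "v' k' \<noteq> v k"
    have "v' k' \<in> v ` insert k {..<n}" using Z.v_vert(2) verts_eq by simp
    then obtain j where j: "j < n" "v' k' = v j" "j \<noteq> k" using ne by auto
    \<comment> \<open>Two leaves of the second numbering: their arcs start at \<open>v' k'\<close>,
      which could not emit two arcs if it were a leaf of the first numbering. The witnesses are the
      two smallest indices other than \<open>k'\<close>.\<close>
    obtain i i' where i: "i < n" "i' < n" "i \<noteq> i'" "i \<noteq> k'" "i' \<noteq> k'"
      by (rule that[of "if k' = 0 then 1 else 0" "if k' \<le> 1 then 2 else 1"]) (use assms(2) in auto)
    then have "e' i = rev_arc X (e j)" "e' i' = rev_arc X (e j)"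
      using arc_from_leaf[of _ j] j Z.e_arc Z.tail_e by metis+
    then show False using i Z.head_e Z.v_eq_iff by metis
  qed
  have "v ` {..<n} = v' ` {..<n}"
  proof (cases "k = n")
    case True
    then show ?thesis using centre leaves_eq Z.leaves_eq kk' by simp
  next
    case False
    then have "insert k {..<n} = {..<n}" "insert k' {..<n} = {..<n}" using k_le Z.k_le kk' by auto
    then show ?thesis using verts_eq Z.verts_eq by simp
  qed
  note img = this
  define \<sigma> where "\<sigma> j = (if j < n then inv_into {..<n} v (v' j) else j)" for j
  have inj: "inj_on v {..<n}" "inj_on v' {..<n}" using v_inj Z.v_inj by (auto simp: inj_on_def)
  have v\<sigma>: "\<sigma> j < n" "v (\<sigma> j) = v' j" if "j < n" for j
  proof -
    have "v' j \<in> v ` {..<n}" using that img by auto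
    then show "\<sigma> j < n" "v (\<sigma> j) = v' j"
      using that inv_into_into[of "v' j" v "{..<n}"] f_inv_into_f[of "v' j" v "{..<n}"] by (auto simp: \<sigma>_def)
  qed
  have "inj_on \<sigma> {..<n}"
  proof (rule inj_onI)
    fix i j assume "i \<in> {..<n}" "j \<in> {..<n}" "\<sigma> i = \<sigma> j"
    then show "i = j" using v\<sigma>(2)[of i] v\<sigma>(2)[of j] inj_onD[OF inj(2), of i j] by simp
  qed
  moreover have "\<sigma> ` {..<n} \<subseteq> {..<n}" using v\<sigma> by auto
  ultimately have "bij_betw \<sigma> {..<n} {..<n}"
    using endo_inj_surj[of "{..<n}" \<sigma>] by (simp add: bij_betw_def)
  then have perm: "\<sigma> permutes {..<n}" by (rule bij_imp_permutes) (simp add: \<sigma>_def)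
  have \<sigma>k: "\<sigma> k' = k"
  proof (cases "k' < n")
    case True
    then show ?thesis using v\<sigma>[OF True] centre v_eq_iff[of "\<sigma> k'" k] by simp
  next
    case False
    then show ?thesis using kk' k_le Z.k_le by (simp add: \<sigma>_def)
  qed
  show ?thesis
  proof (rule that[OF perm \<sigma>k])
    show "v' j = v (\<sigma> j)" if "j < n \<or> j = k'" for j using that v\<sigma> centre \<sigma>k by auto
    show "e' j = e (\<sigma> j)" if j: "j < n" "j \<noteq> k'" for j
    proof -
      obtain i where i: "i < n" "i \<noteq> k" "e' j = e i"
        using arc_from_centre[of "e' j"] Z.e_arc[OF j] Z.tail_e[OF j] centre by auto
      then have "v i = v (\<sigma> j)" using head_e[OF i(1,2)] Z.head_e[OF j] v\<sigma>(2)[OF j(1)] by simp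
      then show ?thesis using i v\<sigma>(1)[OF j(1)] v_eq_iff[of i "\<sigma> j"] by auto
    qed
  qed
qed

end

context universal_coxeter
begin

text \<open>\<open>T\<close> consists of the members whose twist at the centre changes. It is empty
  for \<open>k = n\<close>, where the centre group is trivial and \<open>b n\<close> is no member of
  the basis.\<close>

definition star_equiv :: "nat \<Rightarrow> (nat \<Rightarrow> W_elt) \<Rightarrow> nat \<Rightarrow> (nat \<Rightarrow> W_elt) \<Rightarrow> bool" where
  "star_equiv k b k' b' \<longleftrightarrow> (\<exists>\<sigma> g T. \<sigma> permutes {..<n} \<and> \<sigma> k' = k \<and> g \<in> carrier G \<and> (k = n \<longrightarrow> T = {}) \<and>
     (\<forall>j<n. b' j = g \<otimes> partial_conj k T b (\<sigma> j) \<otimes> inv g))"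

lemma partial_conj_closed:
  "basis b \<Longrightarrow> k < n \<or> T = {} \<Longrightarrow> j < n \<Longrightarrow> partial_conj k T b j \<in> carrier G"
  by (auto simp: partial_conj_def)

text \<open>A member with unchanged twist keeps its loop, the loop around the centre does not see
  its twist, and the remaining case is \<open>loop_conj_centre\<close>.\<close>

lemma loop_partial_conj:
  assumes M: "is_marked_gog n M" and b: "basis b" and c: "star n k (gog M) v e" "is_path (gog M) (base M) p (v k)"
    "\<forall>j<n. \<kappa> j \<in> carrier (vgroup (gog M) (v k))"
    "\<forall>j<n. marking M (b j) = loop k (gog M) v e p \<kappa> j"
    and \<kappa>': "\<forall>j<n. \<kappa>' j \<in> carrier (vgroup (gog M) (v k))" and l: "l < n"
  shows "loop k (gog M) v e p \<kappa>' l = marking M (partial_conj k {j. j < n \<and> \<kappa>' j \<noteq> \<kappa> j} b l)"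
proof -
  interpret S: star_of_groups "gog M" "path_group (gog M)" n k v e by (rule star_of_groups_marked[OF M c(1)])
  have hM: "marking M \<in> hom G (path_group (gog M))"
    using M S.iso_fundamentalD(1)[of "marking M" G "base M"] by (simp add: is_marked_gog_def G_def)
  consider "\<kappa>' l = \<kappa> l" | "l = k" | "\<kappa>' l \<noteq> \<kappa> l" "l \<noteq> k" by blast
  then show ?thesis
  proof cases
    case 1
    then show ?thesis using c(4) l by (simp add: partial_conj_def loop_def arm_def)
  next
    case 2
    then show ?thesis using c(4) l S.loop_centre_independent[OF c(2,3) _ \<kappa>'] by (simp add: partial_conj_def)
  next
    case 3
    have k: "k < n"
    proof (rule ccontr)
      assume "\<not> k < n"
      then have "k = n" using S.k_le by simp
      then have "\<kappa>' l = \<kappa> l" using S.vgroup_centre c(3) \<kappa>' l by (auto simp: trivial_group_def)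
      then show False using 3 by simp
    qed
    have "loop k (gog M) v e p \<kappa>' l = marking M (b k) \<otimes>\<^bsub>path_group (gog M)\<^esub> marking M (b l) \<otimes>\<^bsub>path_group (gog M)\<^esub> marking M (b k)"
      using S.loop_conj_centre[OF c(2,3) l 3(2) k, of "\<kappa>' l" \<kappa>'] 3(1) \<kappa>' l c(4) k by simp
    then show ?thesis
      using 3 l k b hom_mult[OF hM] by (simp add: partial_conj_def)
  qed
qed

lemma marks_star_equiv:
  assumes M: "is_marked_gog n M" and b: "marks n k M b" and eq: "star_equiv k b k' b'"
  shows "marks n k' M b'"
proof -
  have bb: "basis b" by (rule marks_basis[OF M b])
  obtain v e p \<kappa> where c: "star n k (gog M) v e" "is_path (gog M) (base M) p (v k)"
    "\<forall>j<n. \<kappa> j \<in> carrier (vgroup (gog M) (v k))"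
    "\<forall>j<n. marking M (b j) = loop k (gog M) v e p \<kappa> j"
    using b unfolding marks_def by blast
  interpret S: star_of_groups "gog M" "path_group (gog M)" n k v e by (rule star_of_groups_marked[OF M c(1)])
  obtain \<sigma> g T where s: "\<sigma> permutes {..<n}" "\<sigma> k' = k" "g \<in> carrier G" "k = n \<longrightarrow> T = {}"
    "\<And>j. j < n \<Longrightarrow> b' j = g \<otimes> partial_conj k T b (\<sigma> j) \<otimes> inv g"
    using eq unfolding star_equiv_def by blast
  have lt: "\<sigma> j < n" if "j < n" for j using permutes_in_image[OF s(1), of j] that by simp
  \<comment> \<open>The twists change by the flip exactly at the members that are to be conjugated
    by \<open>b k\<close>.\<close>
  define \<kappa>2 where "\<kappa>2 j = (if j \<in> T - {k} \<and> j < n then flip (vgroup (gog M) (v k)) \<otimes>\<^bsub>vgroup (gog M) (v k)\<^esub> \<kappa> j else \<kappa> j)" for j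
  have kn: "k < n" if "j \<in> T" for j using s(4) that S.k_le by (cases "k = n") auto
  have \<kappa>2: "\<forall>j<n. \<kappa>2 j \<in> carrier (vgroup (gog M) (v k))"
    using c(3) kn S.vgroup_monoid[of "v k"] by (auto simp: \<kappa>2_def intro!: monoid.m_closed)
  have ne: "\<kappa>2 j \<noteq> \<kappa> j \<longleftrightarrow> j \<in> T - {k}" if "j < n" for j
  proof -
    have "flip (vgroup (gog M) (v k)) \<otimes>\<^bsub>vgroup (gog M) (v k)\<^esub> \<kappa> j \<noteq> \<kappa> j" if k: "k < n"
    proof -
      interpret K: group "vgroup (gog M) (v k)" by (simp add: S.vgroup_group)
      have "flip (vgroup (gog M) (v k)) \<noteq> \<one>\<^bsub>vgroup (gog M) (v k)\<^esub>"
        using flip(2)[OF K.group_axioms S.vgroup_F[OF k]] .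
      then show ?thesis using c(3) \<open>j < n\<close> k S.flip_closed[OF k] by simp
    qed
    then show ?thesis using that kn by (auto simp: \<kappa>2_def)
  qed
  have \<mu>: "marking M \<in> iso G (fundamental_group (gog M) (base M))"
    using M by (simp add: is_marked_gog_def G_def)
  have hM: "marking M \<in> hom G (path_group (gog M))" by (rule S.iso_fundamentalD(1)[OF \<mu>])
  obtain t where t: "is_path (gog M) (base M) t (base M)" "marking M g = path_class (gog M) t"
    using S.iso_fundamentalD(3)[OF \<mu>] s(3) by blast
  interpret h: group_hom G "path_group (gog M)" "marking M"
    using hM is_group S.is_group by (simp add: group_hom_def group_hom_axioms_def)
  have b': "b' j \<in> carrier G \<and> marking M (b' j) = loop k' (gog M) (v \<circ> \<sigma>) (e \<circ> \<sigma>) (t @ p) (\<kappa>2 \<circ> \<sigma>) j" if j: "j < n" for j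
  proof -
    have pc: "partial_conj k T b (\<sigma> j) \<in> carrier G"
      using partial_conj_closed[OF bb] s(4) S.k_le lt[OF j] by (metis le_neq_implies_less)
    have "loop k' (gog M) (v \<circ> \<sigma>) (e \<circ> \<sigma>) (t @ p) (\<kappa>2 \<circ> \<sigma>) j = loop k (gog M) v e (t @ p) \<kappa>2 (\<sigma> j)"
      by (rule S.loop_permute[OF s(1,2)]) simp
    also have "\<dots> = path_class (gog M) t \<otimes>\<^bsub>path_group (gog M)\<^esub> loop k (gog M) v e p \<kappa>2 (\<sigma> j)
        \<otimes>\<^bsub>path_group (gog M)\<^esub> inv\<^bsub>path_group (gog M)\<^esub> path_class (gog M) t"
      by (rule S.loop_prepend[OF c(2) \<kappa>2 t(1) lt[OF j]])
    also have "loop k (gog M) v e p \<kappa>2 (\<sigma> j) = marking M (partial_conj k {j. j < n \<and> \<kappa>2 j \<noteq> \<kappa> j} b (\<sigma> j))"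
      by (rule loop_partial_conj[OF M bb c \<kappa>2 lt[OF j]])
    also have "partial_conj k {j. j < n \<and> \<kappa>2 j \<noteq> \<kappa> j} b (\<sigma> j) = partial_conj k T b (\<sigma> j)"
      using ne[OF lt[OF j]] lt[OF j] by (auto simp: partial_conj_def)
    finally show ?thesis using s(3) s(5)[OF j] pc t(2) unfolding s(5)[OF j] by (metis h.hom_inv h.hom_mult inv_closed m_closed)
  qed
  have "is_path (gog M) (base M) (t @ p) ((v \<circ> \<sigma>) k')" using S.is_path_appendI[OF t(1) c(2)] s(2) by simp
  moreover have "\<forall>j<n. (\<kappa>2 \<circ> \<sigma>) j \<in> carrier (vgroup (gog M) ((v \<circ> \<sigma>) k'))" using \<kappa>2 lt s(2) by simp
  ultimately show ?thesis
    unfolding marks_def using S.star_permute[OF s(1,2)] b' unfolding G_def by blast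
qed

text \<open>The permutation comes from comparing the numberings, \<open>g\<close> from comparing the
  paths to the centre, and \<open>T\<close> from comparing the twists.\<close>

lemma marks_unique:
  assumes n: "n \<ge> 4" and M: "is_marked_gog n M" and b: "marks n k M b" and b': "marks n k' M b'"
  shows "star_equiv k b k' b'"
proof -
  have bb: "basis b" by (rule marks_basis[OF M b])
  obtain v e p \<kappa> where c: "star n k (gog M) v e" "is_path (gog M) (base M) p (v k)"
    "\<forall>j<n. \<kappa> j \<in> carrier (vgroup (gog M) (v k))"
    "\<forall>j<n. marking M (b j) = loop k (gog M) v e p \<kappa> j"
    using b unfolding marks_def by blast
  obtain v' e' p' \<kappa>' where c': "star n k' (gog M) v' e'" "is_path (gog M) (base M) p' (v' k')"
    "\<forall>j<n. \<kappa>' j \<in> carrier (vgroup (gog M) (v' k'))"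
    "\<forall>j<n. b' j \<in> carrier G \<and> marking M (b' j) = loop k' (gog M) v' e' p' \<kappa>' j"
    using b' unfolding marks_def G_def by blast
  interpret S: star_of_groups "gog M" "path_group (gog M)" n k v e by (rule star_of_groups_marked[OF M c(1)])
  obtain \<sigma> where \<sigma>: "\<sigma> permutes {..<n}" "\<sigma> k' = k" "\<And>j. j < n \<or> j = k' \<Longrightarrow> v' j = v (\<sigma> j)"
    "\<And>j. j < n \<Longrightarrow> j \<noteq> k' \<Longrightarrow> e' j = e (\<sigma> j)"
    using S.star_unique[OF c'(1) n] by blast
  have lt: "\<sigma> j < n" if "j < n" for j using permutes_in_image[OF \<sigma>(1), of j] that by simp
  have lt': "inv_into UNIV \<sigma> j < n" if "j < n" for j
    using permutes_in_image[OF permutes_inv[OF \<sigma>(1)], of j] that by simp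
  have vk: "v' k' = v k" using \<sigma>(2,3) by simp
  define \<kappa>2 where "\<kappa>2 = \<kappa>' \<circ> inv_into UNIV \<sigma>"
  have \<kappa>2: "\<forall>j<n. \<kappa>2 j \<in> carrier (vgroup (gog M) (v k))" using c'(3) lt' vk by (simp add: \<kappa>2_def)
  obtain q where q: "is_path (gog M) (v k) q (base M)" "path_class (gog M) q = inv\<^bsub>path_group (gog M)\<^esub> path_class (gog M) p"
    using S.is_path_reverse[OF c(2)] by blast
  have t: "is_path (gog M) (base M) (p' @ q) (base M)" using S.is_path_appendI[OF c'(2)] q(1) vk by simp
  have \<mu>: "marking M \<in> iso G (fundamental_group (gog M) (base M))"
    using M by (simp add: is_marked_gog_def G_def)
  have hM: "marking M \<in> hom G (path_group (gog M))" by (rule S.iso_fundamentalD(1)[OF \<mu>])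
  have "path_class (gog M) (p' @ q) \<in> marking M ` carrier G" unfolding S.iso_fundamentalD(3)[OF \<mu>] using t by blast
  then obtain g where g: "g \<in> carrier G" "marking M g = path_class (gog M) (p' @ q)" by force
  interpret h: group_hom G "path_group (gog M)" "marking M"
    using hM is_group S.is_group by (simp add: group_hom_def group_hom_axioms_def)
  define T where "T = {j. j < n \<and> \<kappa>2 j \<noteq> \<kappa> j}"
  have T: "k = n \<longrightarrow> T = {}"
    using S.vgroup_centre c(3) \<kappa>2 by (auto simp: T_def trivial_group_def)
  have lets: "p \<in> lists S.letters" "p' \<in> lists S.letters" "q \<in> lists S.letters"
    using S.is_path_letters c(2) c'(2) q(1) by blast+
  have cls: "path_class (gog M) ((p' @ q) @ p) = path_class (gog M) p'"
    using lets by (simp add: S.path_class_append q(2) S.m_assoc)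
  have "b' j = g \<otimes> partial_conj k T b (\<sigma> j) \<otimes> inv g" if j: "j < n" for j
  proof -
    have pc: "partial_conj k T b (\<sigma> j) \<in> carrier G"
      using partial_conj_closed[OF bb] T S.k_le lt[OF j] by (metis le_neq_implies_less)
    have "marking M (b' j) = loop k' (gog M) v' e' p' \<kappa>' j" using c'(4) j by simp
    also have "\<dots> = loop k' (gog M) (v \<circ> \<sigma>) (e \<circ> \<sigma>) ((p' @ q) @ p) \<kappa>' j"
      using \<sigma>(3,4) j unfolding loop_def arm_def cls by simp
    also have "\<dots> = loop k (gog M) v e ((p' @ q) @ p) \<kappa>2 (\<sigma> j)"
      by (rule S.loop_permute[OF \<sigma>(1,2)]) (simp add: \<kappa>2_def permutes_inverses[OF \<sigma>(1)])
    also have "\<dots> = path_class (gog M) (p' @ q) \<otimes>\<^bsub>path_group (gog M)\<^esub> loop k (gog M) v e p \<kappa>2 (\<sigma> j)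
        \<otimes>\<^bsub>path_group (gog M)\<^esub> inv\<^bsub>path_group (gog M)\<^esub> path_class (gog M) (p' @ q)"
      by (rule S.loop_prepend[OF c(2) \<kappa>2 t lt[OF j]])
    also have "loop k (gog M) v e p \<kappa>2 (\<sigma> j) = marking M (partial_conj k T b (\<sigma> j))"
      unfolding T_def by (rule loop_partial_conj[OF M bb c \<kappa>2 lt[OF j]])
    finally have "marking M (b' j) = marking M (g \<otimes> partial_conj k T b (\<sigma> j) \<otimes> inv g)"
      using g pc by simp
    then show ?thesis
      using S.iso_fundamentalD(2)[OF \<mu>] c'(4) j g pc by (meson inj_onD inv_closed m_closed)
  qed
  then show ?thesis unfolding star_equiv_def using \<sigma>(1,2) g(1) T by blast
qed

end

section \<open>Standard stars\<close>

definition nat_F :: "nat monoid" where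
  "nat_F = \<lparr>carrier = {0, 1}, monoid.mult = (\<lambda>a b. (a + b) mod 2), one = 0\<rparr>"

lemma nat_F_group: "group nat_F"
  by (rule groupI) (auto simp: nat_F_def)

lemma nat_F_iso: "nat_F \<cong> F"
proof -
  have "int \<in> iso nat_F F"
    by (auto simp: iso_def hom_def nat_F_def F_carrier bij_betw_def)
  then show ?thesis by (auto simp: is_iso_def)
qed

lemma trivial_not_F: "trivial_group A \<Longrightarrow> \<not> A \<cong> F"
  using flip[of A] by (auto simp: trivial_group_def)

text \<open>Arc \<open>2 * j\<close> leads from the centre to \<open>j\<close>, and
  \<open>2 * j + 1\<close> is its reverse, so parity gives the direction and \<open>div 2\<close>
  the leaf.\<close>

definition std_arcs :: "nat \<Rightarrow> nat \<Rightarrow> nat set" where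
  "std_arcs n k = (\<Union>j\<in>{..<n} - {k}. {2 * j, 2 * j + 1})"

definition std_rev :: "nat \<Rightarrow> nat \<Rightarrow> nat \<Rightarrow> nat" where
  "std_rev n k a = (if a \<in> std_arcs n k then if even a then a + 1 else a - 1 else a)"

definition std_star :: "nat \<Rightarrow> nat \<Rightarrow> nat_gog" where
  "std_star n k = \<lparr>graph = \<lparr>verts = insert k {..<n}, arcs = std_arcs n k,
      tail = (\<lambda>a. if even a then k else a div 2), head = (\<lambda>a. if even a then a div 2 else k)\<rparr>,
    rev_arc = std_rev n k,
    vgroup = (\<lambda>j. if j < n then nat_F else singleton_group 0),
    egroup = (\<lambda>_. singleton_group 0), emb = (\<lambda>_ _. 0)\<rparr>"

lemma std_star_sel [simp]:
  "verts (graph (std_star n k)) = insert k {..<n}" "arcs (graph (std_star n k)) = std_arcs n k"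
  "tail (graph (std_star n k)) a = (if even a then k else a div 2)"
  "head (graph (std_star n k)) a = (if even a then a div 2 else k)"
  "rev_arc (std_star n k) = std_rev n k"
  "vgroup (std_star n k) j = (if j < n then nat_F else singleton_group 0)"
  "egroup (std_star n k) a = singleton_group 0" "emb (std_star n k) a g = 0"
  by (simp_all add: std_star_def)

lemma std_arcs_iff: "a \<in> std_arcs n k \<longleftrightarrow> a div 2 < n \<and> a div 2 \<noteq> k"
proof
  assume "a div 2 < n \<and> a div 2 \<noteq> k"
  moreover have "a = 2 * (a div 2) \<or> a = 2 * (a div 2) + 1" by presburger
  ultimately show "a \<in> std_arcs n k" unfolding std_arcs_def by blast
qed (auto simp: std_arcs_def)

lemma std_rev_div [simp]: "std_rev n k a div 2 = a div 2"
  by (cases "even a") (auto simp: std_rev_def elim!: oddE)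

lemma std_rev_arcs [simp]: "std_rev n k a \<in> std_arcs n k \<longleftrightarrow> a \<in> std_arcs n k"
  by (simp add: std_arcs_iff)

lemma even_std_rev: "a \<in> std_arcs n k \<Longrightarrow> even (std_rev n k a) \<longleftrightarrow> odd a"
  by (auto simp: std_rev_def)

lemma std_rev_even: "2 * j \<in> std_arcs n k \<Longrightarrow> std_rev n k (2 * j) = Suc (2 * j)"
  by (simp add: std_rev_def)

lemma arc_eqI: "a div 2 = b div 2 \<Longrightarrow> even a \<longleftrightarrow> even b \<Longrightarrow> a = (b :: nat)"
  by presburger

context
  fixes n k :: nat
  assumes k_le: "k \<le> n"
begin

lemma std_bidirected: "bidirected_digraph (graph (std_star n k)) (std_rev n k)"
proof
  show "a \<in> arcs (graph (std_star n k)) \<longleftrightarrow> std_rev n k a \<noteq> a" for a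
    by (auto simp: std_rev_def elim!: oddE)
  show "std_rev n k (std_rev n k a) = a" if "a \<in> arcs (graph (std_star n k))" for a
    by (rule arc_eqI) (use that in \<open>simp_all add: even_std_rev\<close>)
qed (auto simp: std_arcs_iff even_std_rev)

interpretation std: bidirected_digraph "graph (std_star n k)" "std_rev n k"
  by (rule std_bidirected)

lemma std_reachable:
  assumes "A \<subseteq> std_arcs n k" "2 * j \<in> A" "Suc (2 * j) \<in> A"
  shows "k \<rightarrow>\<^sup>*\<^bsub>(graph (std_star n k))\<lparr>arcs := A\<rparr>\<^esub> j" "j \<rightarrow>\<^sup>*\<^bsub>(graph (std_star n k))\<lparr>arcs := A\<rparr>\<^esub> k"
proof -
  have j: "j < n" "j \<noteq> k" using assms by (auto simp: std_arcs_iff)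
  let ?G = "(graph (std_star n k))\<lparr>arcs := A\<rparr>"
  have "(k, j) = arc_to_ends ?G (2 * j)" "(j, k) = arc_to_ends ?G (Suc (2 * j))"
    by (simp_all add: arc_to_ends_def std_star_def)
  then have "(k, j) \<in> arcs_ends ?G" "(j, k) \<in> arcs_ends ?G"
    unfolding arcs_ends_def using assms by (simp_all add: image_iff) blast+
  then show "k \<rightarrow>\<^sup>*\<^bsub>(graph (std_star n k))\<lparr>arcs := A\<rparr>\<^esub> j" "j \<rightarrow>\<^sup>*\<^bsub>(graph (std_star n k))\<lparr>arcs := A\<rparr>\<^esub> k"
    unfolding reachable_def using j
    by (auto intro!: rtrancl_on_into_rtrancl_on[OF rtrancl_on_refl] simp: std_star_def[of n k])
qed

lemma std_connected: "connected (graph (std_star n k))"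
proof -
  have eq: "(graph (std_star n k))\<lparr>arcs := std_arcs n k\<rparr> = graph (std_star n k)"
    by (simp add: std_star_def)
  have k: "k \<rightarrow>\<^sup>*\<^bsub>graph (std_star n k)\<^esub> u \<and> u \<rightarrow>\<^sup>*\<^bsub>graph (std_star n k)\<^esub> k" if "u \<in> insert k {..<n}" for u
  proof (cases "u = k")
    case False
    then have "2 * u \<in> std_arcs n k" "Suc (2 * u) \<in> std_arcs n k" using that by (auto simp: std_arcs_iff)
    then show ?thesis using std_reachable[of "std_arcs n k" u] unfolding eq by simp
  qed (simp add: std.reachable_refl)
  have "u \<rightarrow>\<^sup>*\<^bsub>graph (std_star n k)\<^esub> w" if "u \<in> insert k {..<n}" "w \<in> insert k {..<n}" for u w
    using k[OF that(1)] k[OF that(2)] std.reachable_trans by blast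
  then show ?thesis
    unfolding connected_def strongly_connected_def using std.reachable_mk_symmetricI by simp
qed

text \<open>The arcs of a walk alternately leave and enter the centre. So a closed walk with three
  or more arcs repeats the centre among the vertices after the first one.\<close>

lemma std_forest:
  assumes "A \<subseteq> std_arcs n k"
  shows "serre_forest ((graph (std_star n k))\<lparr>arcs := A\<rparr>) (std_rev n k)"
proof -
  define H where "H = (graph (std_star n k))\<lparr>arcs := A\<rparr>"
  have sel: "tail H a = (if even a then k else a div 2)" "head H a = (if even a then a div 2 else k)" "arcs H = A" for a
    by (simp_all add: H_def std_star_def)
  have ne: "a div 2 \<noteq> k" if "a \<in> A" for a using that assms by (auto simp: std_arcs_iff)
  show ?thesis
    unfolding serre_forest_def H_def[symmetric]
  proof (intro allI impI)
    fix p assume "pre_digraph.cycle H p"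
    then obtain u where p: "pre_digraph.awalk H u p u" "distinct (tl (pre_digraph.awalk_verts H u p))" "p \<noteq> []"
      by (auto simp: pre_digraph.cycle_def)
    then have cas: "pre_digraph.cas H u p u" and A: "set p \<subseteq> A" by (auto simp: pre_digraph.awalk_def sel)
    obtain a q where a: "p = a # q" using p(3) by (cases p) auto
    have cas_Cons: "pre_digraph.cas H x (b # r) y \<longleftrightarrow> tail H b = x \<and> pre_digraph.cas H (head H b) r y" for x b r y
      by (simp add: pre_digraph.cas.simps)
    have verts_Cons: "pre_digraph.awalk_verts H x (b # r) = tail H b # pre_digraph.awalk_verts H (head H b) r" for x b r
      by (simp add: pre_digraph.awalk_verts.simps)
    have verts_Nil: "pre_digraph.awalk_verts H x [] = [x]" for x
      by (simp add: pre_digraph.awalk_verts.simps)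
    have last: "y \<in> set (pre_digraph.awalk_verts H x r)" if "pre_digraph.cas H x r y" for x r y
      using that by (induction r arbitrary: x) (auto simp: cas_Cons verts_Cons verts_Nil pre_digraph.cas.simps)
    show "\<exists>e. p = [e, std_rev n k e]"
    proof (cases q)
      case Nil
      then show ?thesis using cas ne A a by (auto simp: cas_Cons pre_digraph.cas.simps sel split: if_splits)
    next
      case (Cons b r)
      have ab: "a \<in> A" "b \<in> A" using A a Cons by auto
      have cs: "tail H a = u" "tail H b = head H a" "pre_digraph.cas H (head H b) r u"
        using cas a Cons by (simp_all add: cas_Cons)
      have dist: "distinct (head H a # pre_digraph.awalk_verts H (head H b) r)"
        using p(2) a Cons cs by (simp add: verts_Cons)
      have parity: "even a \<longleftrightarrow> odd b" using cs(2) ne[OF ab(1)] ne[OF ab(2)] by (auto simp: sel split: if_splits)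
      show ?thesis
      proof (cases r)
        case Nil
        then have "head H b = u" using cs by (simp add: pre_digraph.cas.simps)
        then have "a div 2 = b div 2" using cs parity by (auto simp: sel split: if_splits)
        then have "b = std_rev n k a"
          using parity ab assms by - (rule arc_eqI, auto simp: even_std_rev)
        then show ?thesis using a Cons Nil by simp
      next
        case r: (Cons c s)
        have c: "c \<in> A" using A a Cons r by auto
        have cs': "tail H c = head H b" "pre_digraph.cas H (head H c) s u"
          using cs(3) r by (simp_all add: cas_Cons)
        have dist': "head H a \<noteq> head H c" "head H b \<noteq> u"
        proof -
          have "head H c \<in> set (pre_digraph.awalk_verts H (head H c) s)"
            by (cases s) (use cs'(2) in \<open>auto simp: verts_Nil verts_Cons cas_Cons\<close>)
          then show "head H a \<noteq> head H c" using dist r by (auto simp: verts_Cons)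
          have "distinct (tail H c # pre_digraph.awalk_verts H (head H c) s)"
            using dist r by (simp add: verts_Cons)
          then show "head H b \<noteq> u" using last[OF cs'(2)] cs'(1) by auto
        qed
        have "even c \<longleftrightarrow> even a" using cs'(1) parity ne[OF ab(2)] ne[OF c] by (auto simp: sel split: if_splits)
        then show ?thesis using dist' cs parity by (auto simp: sel split: if_splits)
      qed
    qed
  qed
qed

lemma std_tree: "serre_tree (graph (std_star n k)) (std_rev n k)"
proof -
  have "(graph (std_star n k))\<lparr>arcs := std_arcs n k\<rparr> = graph (std_star n k)"
    by (simp add: std_star_def)
  then show ?thesis
    using std_forest[of "std_arcs n k", OF order.refl] std_connected std_bidirected
    unfolding serre_tree_def by metis
qed

lemma std_gog: "is_graph_of_groups (std_star n k)"
  unfolding is_graph_of_groups_def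
  using std_bidirected std_connected
  by (auto simp: nat_F_group mon_def hom_def) (auto simp: nat_F_def singleton_group_def)

lemma std_is_star: "star n k (std_star n k) id (\<lambda>j. 2 * j)"
proof -
  have "std_arcs n k = (\<Union>j\<in>{..<n} - {k}. {2 * j, std_rev n k (2 * j)})"
    unfolding std_arcs_def[of n k] by (rule SUP_cong) (simp_all add: std_rev_even std_arcs_iff)
  moreover have "2 * j \<in> std_arcs n k" if "j \<in> {..<n} - {k}" for j using that by (auto simp: std_arcs_iff)
  ultimately show ?thesis unfolding star_def using k_le by (simp add: nat_F_iso)
qed

lemma std_marked:
  assumes n: "n \<ge> 3" and \<mu>: "\<mu> \<in> iso (W n) (fundamental_group (std_star n k) k)"
  shows "is_marked_gog n \<lparr>gog = std_star n k, base = k, marking = \<mu>\<rparr>"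
proof -
  have fin: "fin_digraph (graph (std_star n k))"
    by unfold_locales (auto simp: std_arcs_def)
  have F_verts: "{v \<in> verts (graph (std_star n k)). vgroup (std_star n k) v \<cong> F} = {..<n}"
    using k_le by (auto simp: nat_F_iso trivial_not_F)
  have deg: "out_degree (graph (std_star n k)) v \<ge> 3" if v: "v \<in> insert k {..<n}" "\<not> v < n" for v
  proof -
    have "v = n" "k = n" using that k_le by auto
    have "(\<lambda>j. 2 * j) ` {..<n} \<subseteq> out_arcs (graph (std_star n k)) v"
      using \<open>v = n\<close> \<open>k = n\<close> by (auto simp: out_arcs_def std_arcs_iff)
    moreover have "finite (out_arcs (graph (std_star n k)) v)"
      using fin_digraph.finite_out_arcs[OF fin] .
    ultimately have "card ((\<lambda>j. 2 * j :: nat) ` {..<n}) \<le> out_degree (graph (std_star n k)) v"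
      unfolding out_degree_def by (rule card_mono[rotated])
    then show ?thesis using n by (simp add: card_image inj_on_def)
  qed
  have "card {v. (v = k \<or> v < n) \<and> (if v < n then nat_F else singleton_group 0) \<cong> F} = n"
    using arg_cong[OF F_verts, of card] by simp
  then show ?thesis
    unfolding is_marked_gog_def
    using std_gog fin std_tree deg \<mu> k_le by (auto simp: nat_F_iso trivial_not_F)
qed

end

section \<open>The vertices of L\<close>

text \<open>A loop would be a cycle with a single arc, which is not of the form
  \<open>[e, rev_arc X e]\<close>.\<close>

lemma (in trivially_edged) no_loops:
  assumes "serre_forest (graph X) (rev_arc X)" "a \<in> arcs (graph X)"
  shows "tail (graph X) a \<noteq> head (graph X) a"
proof
  assume "tail (graph X) a = head (graph X) a"
  then have "cycle [a]" using assms(2) by (auto simp: cycle_def awalk_def)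
  then show False using assms(1) by (auto simp: serre_forest_def)
qed

text \<open>With every arc its reverse is present, so closure under heads gives closure under
  reachability in the symmetrized graph.\<close>

lemma (in trivially_edged) closed_set_verts:
  assumes "connected (graph X)" "S \<subseteq> verts (graph X)" "S \<noteq> {}"
    and "\<And>a. a \<in> arcs (graph X) \<Longrightarrow> tail (graph X) a \<in> S \<Longrightarrow> head (graph X) a \<in> S"
  shows "S = verts (graph X)"
proof -
  have "w \<in> S" if "u \<rightarrow>\<^sup>*\<^bsub>mk_symmetric (graph X)\<^esub> w" "u \<in> S" for u w
    using that unfolding reachable_def
  proof (induction rule: rtrancl_on.induct)
    case (rtrancl_on_into_rtrancl_on a b c)
    then obtain e where "e \<in> arcs (graph X)" "(b, c) = (tail (graph X) e, head (graph X) e) \<or>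
        (c, b) = (tail (graph X) e, head (graph X) e)"
      by (auto simp: parcs_mk_symmetric)
    then show ?case
      using rtrancl_on_into_rtrancl_on assms(4)[of e] assms(4)[of "rev_arc X e"] by auto
  qed
  moreover obtain u where "u \<in> S" using assms by blast
  moreover have "u \<rightarrow>\<^sup>*\<^bsub>mk_symmetric (graph X)\<^esub> w" if "w \<in> verts (graph X)" for w
    using assms(1,2) that \<open>u \<in> S\<close> by (auto simp: connected_def strongly_connected_def)
  ultimately show ?thesis using assms(2) by blast
qed

text \<open>As all vertices but \<open>v k\<close> are leaves, it suffices that the arc of a leaf
  ends at \<open>v k\<close> and that \<open>v k\<close> carries no loop.\<close>

lemma (in trivially_edged) star_from_leaves:
  assumes conn: "connected (graph X)" and forest: "serre_forest (graph X) (rev_arc X)"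
    and k: "k \<le> n" and v: "inj_on v (insert k {..<n})" "verts (graph X) = v ` insert k {..<n}"
    and F: "\<And>j. j < n \<Longrightarrow> vgroup X (v j) \<cong> F" and triv_k: "k = n \<Longrightarrow> trivial_group (vgroup X (v n))"
    and leaf: "\<And>j. j < n \<Longrightarrow> j \<noteq> k \<Longrightarrow> out_degree (graph X) (v j) = 1"
  obtains e where "star n k X v e"
proof -
  have "\<exists>a. out_arcs (graph X) (v j) = {a}" if "j < n" "j \<noteq> k" for j
    using leaf[OF that] by (auto simp: out_degree_def card_1_singleton_iff)
  then obtain a where a: "\<And>j. j < n \<Longrightarrow> j \<noteq> k \<Longrightarrow> out_arcs (graph X) (v j) = {a j}" by metis
  have a_arc: "a j \<in> arcs (graph X)" "tail (graph X) (a j) = v j" if "j < n" "j \<noteq> k" for j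
    using a[OF that] by (auto simp: out_arcs_def)
  have a_unique: "b = a j" if "j < n" "j \<noteq> k" "b \<in> arcs (graph X)" "tail (graph X) b = v j" for j b
    using a[OF that(1,2)] that(3,4) by (auto simp: out_arcs_def)
  have head: "head (graph X) (a j) = v k" if j: "j < n" "j \<noteq> k" for j
  proof (rule ccontr)
    assume ne: "head (graph X) (a j) \<noteq> v k"
    have "head (graph X) (a j) \<in> v ` insert k {..<n}" using a_arc[OF j] v(2) by (metis head_in_verts)
    then obtain i where i: "i < n" "i \<noteq> k" "head (graph X) (a j) = v i" using ne by auto
    have ra: "rev_arc X (a j) = a i" using a_unique[OF i(1,2)] a_arc[OF j] i(3) by simp
    \<comment> \<open>Two leaves joined by an arc are closed under arcs, so by connectedness they
      would leave no room for \<open>v k\<close>.\<close>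
    have "{v i, v j} = verts (graph X)"
    proof (rule closed_set_verts[OF conn])
      show "{v i, v j} \<subseteq> verts (graph X)" using v(2) i j by auto
      fix b assume b: "b \<in> arcs (graph X)" "tail (graph X) b \<in> {v i, v j}"
      then have "b = a i \<or> b = a j" using a_unique i j by blast
      then show "head (graph X) b \<in> {v i, v j}" using i a_arc[OF j] ra[symmetric] by auto
    qed simp
    then have "v k \<in> {v i, v j}" using v(2) by auto
    then show False using v(1) i j by (auto simp: inj_on_def)
  qed
  have e: "rev_arc X (a j) \<in> arcs (graph X)" "tail (graph X) (rev_arc X (a j)) = v k"
    "head (graph X) (rev_arc X (a j)) = v j" if "j < n" "j \<noteq> k" for j
    using a_arc[OF that] head[OF that] by simp_all
  have "b \<in> (\<Union>j\<in>{..<n} - {k}. {rev_arc X (a j), rev_arc X (rev_arc X (a j))})" if b: "b \<in> arcs (graph X)" for b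
  proof -
    have tl: "tail (graph X) b \<in> v ` insert k {..<n}" "head (graph X) b \<in> v ` insert k {..<n}"
      using b v(2) tail_in_verts head_in_verts by metis+
    show ?thesis
    proof (cases "tail (graph X) b = v k")
      case True
      then have "head (graph X) b \<noteq> v k" using no_loops[OF forest b] by simp
      then obtain j where j: "j < n" "j \<noteq> k" "head (graph X) b = v j"
        using tl(2) by auto
      then have "rev_arc X b = a j" using a_unique[OF j(1,2), of "rev_arc X b"] b by simp
      then have "b = rev_arc X (a j)" by (metis arev_arev)
      then show ?thesis using j by blast
    next
      case False
      then obtain j where j: "j < n" "j \<noteq> k" "tail (graph X) b = v j" using tl(1) by auto
      then have "b = a j" using a_unique b by blast
      then show ?thesis using j by auto
    qed
  qed
  then have "arcs (graph X) = (\<Union>j\<in>{..<n} - {k}. {rev_arc X (a j), rev_arc X (rev_arc X (a j))})"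
    using e(1) a_arc(1) by (auto simp del: arev_in_arcs)
  then have "star n k X v (rev_arc X \<circ> a)"
    unfolding star_def using k v F triv_k e by auto
  then show ?thesis by (rule that)
qed

context star_of_groups
begin

lemma path_to_centre:
  assumes "u \<in> verts (graph X)"
  obtains p where "is_path X u p (v k)"
proof -
  obtain j where j: "u = v j" "j < n \<or> j = k" using assms by (auto simp: verts_eq)
  show ?thesis
  proof (cases "j = k")
    case True
    then show ?thesis using that[of "[]"] j assms by simp
  next
    case False
    then show ?thesis using that[of "[Edge (rev_arc X (e j))]"] j assms e_arc tail_e head_e by simp
  qed
qed

lemma out_degree_leaf: "j < n \<Longrightarrow> j \<noteq> k \<Longrightarrow> out_degree (graph X) (v j) = 1"
proof -
  assume j: "j < n" "j \<noteq> k"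
  have "out_arcs (graph X) (v j) = {rev_arc X (e j)}"
    using arc_from_leaf[OF _ j] e_arc[OF j] head_e[OF j] by (auto simp: out_arcs_def)
  then show ?thesis by (simp add: out_degree_def)
qed

lemma out_degree_centre: "out_degree (graph X) (v k) = (if k = n then n else n - 1)"
proof -
  have "out_arcs (graph X) (v k) = e ` ({..<n} - {k})"
    using arc_from_centre e_arc tail_e by (auto simp: out_arcs_def)
  moreover have "inj_on e ({..<n} - {k})"
    using head_e v_eq_iff by (metis DiffD1 DiffD2 inj_onI insertCI lessThan_iff)
  ultimately have "out_degree (graph X) (v k) = card ({..<n} - {k})"
    by (simp add: out_degree_def card_image)
  then show ?thesis using k_le by (simp add: card_Diff_singleton_if)
qed

lemma card_leaves: "n \<ge> 3 \<Longrightarrow> card (leaves (graph X)) = (if k = n then n else n - 1)"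
proof -
  assume n: "n \<ge> 3"
  have "leaves (graph X) = v ` ({..<n} - {k})"
    using n out_degree_leaf out_degree_centre by (auto simp: leaves_def verts_eq split: if_splits)
  moreover have "inj_on v ({..<n} - {k})" using v_inj by (auto simp: inj_on_def)
  ultimately show ?thesis using k_le by (simp add: card_image card_Diff_singleton_if)
qed

end

text \<open>Vertices with trivial group have degree at least 3, so leaves carry \<open>F\<close>. By
  counting, the \<open>n\<close> leaves are all the vertices with group \<open>F\<close>, and the
  remaining vertex is the centre.\<close>

lemma marked_star_zero:
  assumes M: "is_marked_gog n M" and n: "n \<ge> 3"
    and cv: "card (verts (ugraph M)) = n + 1" and cl: "card (leaves (ugraph M)) = n"
  obtains v e where "star n n (gog M) v e"
proof -
  interpret X: trivially_edged "gog M" "path_group (gog M)" by (rule trivially_edged_marked[OF M])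
  have fin: "finite (verts (ugraph M))" using M fin_digraph.finite_verts by (auto simp: is_marked_gog_def)
  have leafF: "vgroup (gog M) w \<cong> F" if "w \<in> leaves (ugraph M)" for w
    using M that by (force simp: is_marked_gog_def leaves_def)
  have sub: "leaves (ugraph M) \<subseteq> {w \<in> verts (ugraph M). vgroup (gog M) w \<cong> F}"
    using leafF by (auto simp: leaves_def)
  have eq: "leaves (ugraph M) = {w \<in> verts (ugraph M). vgroup (gog M) w \<cong> F}"
    by (rule card_subset_eq[OF _ sub]) (use fin M cl in \<open>auto simp: is_marked_gog_def\<close>)
  have "card (verts (ugraph M) - leaves (ugraph M)) = 1"
    using cv cl fin by (subst card_Diff_subset) (auto simp: leaves_def)
  then obtain c where c: "verts (ugraph M) - leaves (ugraph M) = {c}" by (auto simp: card_1_singleton_iff)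
  have c': "c \<in> verts (ugraph M)" "c \<notin> leaves (ugraph M)" "verts (ugraph M) = insert c (leaves (ugraph M))"
    using c by (auto simp: leaves_def)
  have finl: "finite (leaves (ugraph M))" using fin by (simp add: leaves_def)
  obtain w where w: "bij_betw w {..<n} (leaves (ugraph M))"
    using ex_bij_betw_nat_finite[OF finl] cl by (auto simp: atLeast0LessThan)
  define v where "v = w(n := c)"
  have img: "v ` {..<n} = leaves (ugraph M)" using w by (auto simp: v_def bij_betw_def)
  show ?thesis
  proof (rule X.star_from_leaves[of n n v])
    show "inj_on v (insert n {..<n})"
      using w c'(2) by (auto simp: v_def bij_betw_def inj_on_def)
    have "v n = c" by (simp add: v_def)
    then show "verts (ugraph M) = v ` insert n {..<n}" using img c'(3) by simp
    show "vgroup (gog M) (v j) \<cong> F" if "j < n" for j using leafF img that by blast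
    show "trivial_group (vgroup (gog M) (v n))"
    proof -
      have "\<not> vgroup (gog M) c \<cong> F" using c' eq by blast
      then show ?thesis using M c'(1) \<open>v n = c\<close> by (simp add: is_marked_gog_def)
    qed
    show "out_degree (ugraph M) (v j) = 1" if "j < n" for j
      using img that by (auto simp: leaves_def)
  qed (use M that in \<open>auto simp: is_marked_gog_def serre_tree_def\<close>)
qed

text \<open>By counting, all \<open>n\<close> vertices carry \<open>F\<close>, and exactly one of
  them is no leaf. It receives the number 0, an arbitrary choice.\<close>

lemma marked_star_F:
  assumes M: "is_marked_gog n M" and n: "n \<ge> 3"
    and cv: "card (verts (ugraph M)) = n" and cl: "card (leaves (ugraph M)) = n - 1"
  obtains v e where "star n 0 (gog M) v e"
proof -
  interpret X: trivially_edged "gog M" "path_group (gog M)" by (rule trivially_edged_marked[OF M])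
  have fin: "finite (verts (ugraph M))" using M fin_digraph.finite_verts by (auto simp: is_marked_gog_def)
  have eq: "{w \<in> verts (ugraph M). vgroup (gog M) w \<cong> F} = verts (ugraph M)"
    by (rule card_subset_eq) (use fin M cv in \<open>auto simp: is_marked_gog_def\<close>)
  have "card (verts (ugraph M) - leaves (ugraph M)) = 1"
    using cv cl fin n by (subst card_Diff_subset) (auto simp: leaves_def)
  then obtain c where c: "verts (ugraph M) - leaves (ugraph M) = {c}" by (auto simp: card_1_singleton_iff)
  have c': "c \<in> verts (ugraph M)" "c \<notin> leaves (ugraph M)" "verts (ugraph M) = insert c (leaves (ugraph M))"
    using c by (auto simp: leaves_def)
  have finl: "finite (leaves (ugraph M))" using fin by (simp add: leaves_def)
  obtain w where w: "bij_betw w {1..n - 1} (leaves (ugraph M))"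
    using finite_same_card_bij[of "{1..n - 1}" "leaves (ugraph M)"] finl cl by auto
  define v where "v = w(0 := c)"
  have img: "v ` {1..n - 1} = leaves (ugraph M)" using w by (auto simp: v_def bij_betw_def)
  have v_zero: "v 0 = c" by (simp add: v_def)
  have set: "insert 0 {..<n} = insert 0 {1..n - 1}" using n by auto
  have lf: "v j \<in> leaves (ugraph M)" if "j < n" "j \<noteq> 0" for j
    using img that by auto
  show ?thesis
  proof (rule X.star_from_leaves[of 0 n v])
    show "inj_on v (insert 0 {..<n})"
      unfolding set using w c'(2) by (auto simp: v_def bij_betw_def inj_on_def)
    show vv: "verts (ugraph M) = v ` insert 0 {..<n}" unfolding set using img c'(3) by (simp add: v_zero)
    show "vgroup (gog M) (v j) \<cong> F" if "j < n" for j
    proof -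
      have "v j \<in> verts (ugraph M)" unfolding vv using that by simp
      then show ?thesis using eq by auto
    qed
    show "out_degree (ugraph M) (v j) = 1" if "j < n" "j \<noteq> 0" for j
      using lf[OF that] by (simp add: leaves_def)
  qed (use M n that in \<open>auto simp: is_marked_gog_def serre_tree_def\<close>)
qed

lemma gog_iso_cards:
  assumes "trivially_edged X" "trivially_edged Y" and f: "gog_iso X Y f"
  shows "card (verts (graph X)) = card (verts (graph Y))" "card (leaves (graph X)) = card (leaves (graph Y))"
proof -
  interpret X: trivially_edged X "path_group X" by fact
  interpret Y: trivially_edged Y "path_group Y" by fact
  have bv: "bij_betw (on_verts f) (verts (graph X)) (verts (graph Y))"
    and ba: "bij_betw (on_arcs f) (arcs (graph X)) (arcs (graph Y))"
    and tl: "\<And>a. a \<in> arcs (graph X) \<Longrightarrow> tail (graph Y) (on_arcs f a) = on_verts f (tail (graph X) a)"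
    using f by (auto simp: gog_iso_def)
  show "card (verts (graph X)) = card (verts (graph Y))" using bv by (rule bij_betw_same_card)
  have deg: "out_degree (graph X) w = out_degree (graph Y) (on_verts f w)" if w: "w \<in> verts (graph X)" for w
  proof -
    have "bij_betw (on_arcs f) (out_arcs (graph X) w) (out_arcs (graph Y) (on_verts f w))"
      unfolding bij_betw_def
    proof
      show "inj_on (on_arcs f) (out_arcs (graph X) w)"
        using ba by (auto simp: bij_betw_def out_arcs_def inj_on_def)
      show "on_arcs f ` out_arcs (graph X) w = out_arcs (graph Y) (on_verts f w)"
      proof (intro equalityI subsetI)
        fix a assume "a \<in> on_arcs f ` out_arcs (graph X) w"
        then show "a \<in> out_arcs (graph Y) (on_verts f w)" using ba tl by (auto simp: bij_betw_def out_arcs_def)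
      next
        fix a assume a: "a \<in> out_arcs (graph Y) (on_verts f w)"
        then obtain a' where a': "a' \<in> arcs (graph X)" "a = on_arcs f a'" using ba by (auto simp: bij_betw_def out_arcs_def)
        then have "on_verts f (tail (graph X) a') = on_verts f w" using a tl by (auto simp: out_arcs_def)
        then have "tail (graph X) a' = w" using bv w a' by (auto simp: bij_betw_def inj_on_def)
        then show "a \<in> on_arcs f ` out_arcs (graph X) w" using a' by (auto simp: out_arcs_def)
      qed
    qed
    then show ?thesis by (simp add: out_degree_def bij_betw_same_card)
  qed
  have "bij_betw (on_verts f) (leaves (graph X)) (leaves (graph Y))"
    unfolding bij_betw_def
  proof
    show "inj_on (on_verts f) (leaves (graph X))" using bv by (auto simp: bij_betw_def leaves_def inj_on_def)
    have "on_verts f ` leaves (graph X) = {w \<in> on_verts f ` verts (graph X). out_degree (graph Y) w = 1}"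
      using deg by (auto simp: leaves_def)
    then show "on_verts f ` leaves (graph X) = leaves (graph Y)"
      using bv by (simp add: bij_betw_def leaves_def)
  qed
  then show "card (leaves (graph X)) = card (leaves (graph Y))" by (rule bij_betw_same_card)
qed

context universal_coxeter
begin

lemma star_marks:
  assumes M: "is_marked_gog n M" and s: "star n k (gog M) v e"
  obtains b where "marks n k M b"
proof -
  interpret S: star_of_groups "gog M" "path_group (gog M)" n k v e by (rule star_of_groups_marked[OF M s])
  have \<mu>: "marking M \<in> iso G (fundamental_group (gog M) (base M))" and base: "base M \<in> verts (ugraph M)"
    using M by (auto simp: is_marked_gog_def G_def)
  obtain p where p: "is_path (gog M) (base M) p (v k)" using S.path_to_centre[OF base] by blast
  let ?\<kappa> = "\<lambda>_. \<one>\<^bsub>vgroup (gog M) (v k)\<^esub>"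
  have \<kappa>: "\<forall>j<n. ?\<kappa> j \<in> carrier (vgroup (gog M) (v k))"
    using S.vgroup_monoid[of "v k"] by (simp add: monoid.one_closed)
  have "\<exists>w. w \<in> carrier G \<and> marking M w = loop k (gog M) v e p ?\<kappa> j" if "j < n" for j
  proof -
    have "loop k (gog M) v e p ?\<kappa> j \<in> marking M ` carrier G"
      using S.loop_fundamental[OF p \<kappa> that] \<mu> by (simp add: iso_def bij_betw_def)
    then show ?thesis by force
  qed
  then obtain b where "\<And>j. j < n \<Longrightarrow> b j \<in> carrier G \<and> marking M (b j) = loop k (gog M) v e p ?\<kappa> j"
    by metis
  then have "\<forall>j<n. b j \<in> carrier (W n) \<and> marking M (b j) = loop k (gog M) v e p ?\<kappa> j"
    unfolding G_def by blast
  then have "marks n k M b"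
    unfolding marks_def using s p \<kappa> by (intro exI conjI)
  then show ?thesis by (rule that)
qed

definition std_marking :: "nat \<Rightarrow> (nat \<Rightarrow> W_elt) \<Rightarrow> marked_gog \<Rightarrow> bool" where
  "std_marking k b M \<longleftrightarrow> is_marked_gog n M \<and> gog M = std_star n k \<and> base M = k \<and>
    (\<forall>j<n. marking M (b j) = loop k (std_star n k) id (\<lambda>j. 2 * j) [] (\<lambda>_. 0) j)"

lemma std_marking_exists:
  assumes n: "n \<ge> 3" and k: "k \<le> n" and b: "basis b"
  obtains M where "std_marking k b M"
proof -
  interpret S: star_of_groups "std_star n k" "path_group (std_star n k)" n k id "\<lambda>j. 2 * j"
    by unfold_locales (use std_gog[OF k] std_is_star[OF k] in auto)
  obtain \<eta> where \<eta>: "\<eta> \<in> iso (W n) (fundamental_group (std_star n k) k)"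
    "\<And>j. j < n \<Longrightarrow> \<eta> (gen n j) = loop k (std_star n k) id (\<lambda>j. 2 * j) [] (\<lambda>_. 0) j"
    by (rule S.marking_exists[of k "[]" "\<lambda>_. 0"]) (auto simp: nat_F_def singleton_group_def)
  obtain \<psi> where \<psi>: "\<psi> \<in> iso G G" "\<And>j. j < n \<Longrightarrow> \<psi> (b j) = x j" using basis_pull_back[OF b] by blast
  have "\<eta> \<circ> \<psi> \<in> iso (W n) (fundamental_group (std_star n k) k)"
    using iso_set_trans[OF \<psi>(1)] \<eta>(1) unfolding G_def by blast
  then have "is_marked_gog n \<lparr>gog = std_star n k, base = k, marking = \<eta> \<circ> \<psi>\<rparr>"
    by (rule std_marked[OF k n])
  then have "std_marking k b \<lparr>gog = std_star n k, base = k, marking = \<eta> \<circ> \<psi>\<rparr>"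
    using \<psi>(2) \<eta>(2) by (simp add: std_marking_def)
  then show ?thesis by (rule that)
qed

lemma std_marking_marks:
  assumes "k \<le> n" "basis b" "std_marking k b M"
  shows "marks n k M b"
proof -
  have "(0::nat) \<in> carrier (vgroup (std_star n k) (id k))"
    by (auto simp: nat_F_def singleton_group_def)
  moreover have "is_path (std_star n k) k [] (id k)" by simp
  moreover have "b j \<in> carrier (W n)" if "j < n" for j using basis_closed[OF assms(2) that] by (simp add: G_def)
  ultimately show ?thesis
    unfolding marks_def using assms(3) std_is_star[OF assms(1)] unfolding std_marking_def
    by (intro exI[of _ id] exI[of _ "\<lambda>j. 2 * j"] exI[of _ "[]"] exI[of _ "\<lambda>_. 0"]) simp
qed

lemma star_class_nonempty:
  assumes "n \<ge> 3" "k \<le> n" "basis b"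
  obtains M where "is_marked_gog n M" "marks n k M b"
  using std_marking_exists[OF assms] std_marking_marks[OF assms(2,3)]
  by (metis std_marking_def)

lemma star_class_eq_iff:
  assumes n: "n \<ge> 4" and k: "k \<le> n" and b: "basis b"
  shows "star_class k b = star_class k' b' \<longleftrightarrow> star_equiv k b k' b'"
proof -
  obtain M where M: "is_marked_gog n M" "marks n k M b" using star_class_nonempty[of k b] assms by auto
  show ?thesis
  proof
    assume "star_class k b = star_class k' b'"
    then have "marks n k' M b'" using M by (auto simp: star_class_def)
    then show "star_equiv k b k' b'" by (rule marks_unique[OF n M])
  next
    assume "star_equiv k b k' b'"
    then show "star_class k b = star_class k' b'"
      using star_class_eqI[OF M] marks_star_equiv[OF M] by blast
  qed
qed

text \<open>In the definition of stars the counts hold for some representative \<open>M\<close>,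
  while the class is generated by another one, \<open>N\<close>. Isomorphisms preserve the
  counts.\<close>

lemma spine_vert_star_class:
  assumes "y \<in> spine_verts n" and M: "M \<in> y"
    and star: "\<And>N. is_marked_gog n N \<Longrightarrow> card (verts (ugraph N)) = card (verts (ugraph M)) \<Longrightarrow>
      card (leaves (ugraph N)) = card (leaves (ugraph M)) \<Longrightarrow> \<exists>v e. star n k (gog N) v e"
  obtains b where "basis b" "y = star_class k b"
proof -
  obtain N where N: "is_marked_gog n N" "y = marked_rel n `` {N}"
    using assms(1) by (auto simp: spine_verts_def quotient_def)
  then have "is_marked_gog n M" "marked_equiv n N M" using M by (auto simp: marked_rel_def)
  then obtain f where f: "gog_iso (gog N) (gog M) f" by (auto simp: marked_equiv_def)
  have "card (verts (ugraph N)) = card (verts (ugraph M))" "card (leaves (ugraph N)) = card (leaves (ugraph M))"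
    using gog_iso_cards[OF _ _ f] trivially_edged_marked N(1) \<open>is_marked_gog n M\<close> by blast+
  then obtain v e where "star n k (gog N) v e" using star[OF N(1)] by blast
  then obtain b where "marks n k N b" using star_marks[OF N(1)] by blast
  then show ?thesis using that marked_rel_star_class[OF N(1)] marks_basis[OF N(1)] N(2) by blast
qed

lemma star_class_cards:
  assumes "n \<ge> 3" "M \<in> star_class k b"
  shows "card (verts (ugraph M)) = (if k = n then Suc n else n)"
    "card (leaves (ugraph M)) = (if k = n then n else n - 1)"
proof -
  obtain v e where "is_marked_gog n M" "star n k (gog M) v e"
    using assms(2) by (auto simp: star_class_def marks_def)
  then interpret S: star_of_groups "gog M" "path_group (gog M)" n k v e by (intro star_of_groups_marked)
  show "card (verts (ugraph M)) = (if k = n then Suc n else n)"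
    "card (leaves (ugraph M)) = (if k = n then n else n - 1)"
    using S.card_verts S.card_leaves assms(1) by auto
qed

lemma star_class_spine_vert:
  assumes "n \<ge> 3" "k \<le> n" "basis b"
  shows "star_class k b \<in> spine_verts n"
proof -
  obtain M where M: "is_marked_gog n M" "marks n k M b" using star_class_nonempty assms by blast
  then have "star_class k b = marked_rel n `` {M}" by (simp add: marked_rel_star_class)
  then show ?thesis using M(1) by (auto simp: spine_verts_def intro: quotientI)
qed

lemma zero_stars_eq:
  assumes n: "n \<ge> 3"
  shows "zero_stars n = {star_class n b | b. basis b}"
proof (intro equalityI subsetI)
  fix y assume "y \<in> zero_stars n"
  then obtain M where M: "y \<in> spine_verts n" "M \<in> y" "card (verts (ugraph M)) = n + 1" "card (leaves (ugraph M)) = n"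
    by (auto simp: zero_stars_def)
  obtain b where "basis b" "y = star_class n b"
  proof (rule spine_vert_star_class[OF M(1,2), of n])
    fix N assume N: "is_marked_gog n N" "card (verts (ugraph N)) = card (verts (ugraph M))"
      "card (leaves (ugraph N)) = card (leaves (ugraph M))"
    show "\<exists>v e. star n n (gog N) v e"
      by (rule marked_star_zero[OF N(1) n]) (use N M in auto)
  qed
  then show "y \<in> {star_class n b | b. basis b}" by blast
next
  fix y assume "y \<in> {star_class n b | b. basis b}"
  then obtain b where b: "basis b" "y = star_class n b" by blast
  obtain M where "M \<in> y" using star_class_nonempty[OF n order.refl b(1)] b(2) by (auto simp: star_class_def)
  then show "y \<in> zero_stars n"
    using star_class_spine_vert[OF n order.refl b(1)] star_class_cards[OF n, of M n b] b(2)
    by (auto simp: zero_stars_def)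
qed

lemma F_stars_eq:
  assumes n: "n \<ge> 3"
  shows "F_stars n = {star_class k b | k b. k < n \<and> basis b}"
proof (intro equalityI subsetI)
  fix y assume "y \<in> F_stars n"
  then obtain M where M: "y \<in> spine_verts n" "M \<in> y" "card (verts (ugraph M)) = n" "card (leaves (ugraph M)) = n - 1"
    by (auto simp: F_stars_def)
  obtain b where "basis b" "y = star_class 0 b"
  proof (rule spine_vert_star_class[OF M(1,2), of 0])
    fix N assume N: "is_marked_gog n N" "card (verts (ugraph N)) = card (verts (ugraph M))"
      "card (leaves (ugraph N)) = card (leaves (ugraph M))"
    show "\<exists>v e. star n 0 (gog N) v e"
      by (rule marked_star_F[OF N(1) n]) (use N M in auto)
  qed
  moreover have "0 < n" using n by simp
  ultimately show "y \<in> {star_class k b | k b. k < n \<and> basis b}" by blast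
next
  fix y assume "y \<in> {star_class k b | k b. k < n \<and> basis b}"
  then obtain k b where b: "k < n" "basis b" "y = star_class k b" by blast
  obtain M where "M \<in> y" using star_class_nonempty[OF n _ b(2), of k] b by (auto simp: star_class_def)
  then show "y \<in> F_stars n"
    using star_class_spine_vert[OF n _ b(2), of k] star_class_cards[OF n, of M k b] b
    by (auto simp: F_stars_def)
qed

end

section \<open>Collapses of stars\<close>

context universal_coxeter
begin

text \<open>Counting vertices shows that the collapse merges one leaf \<open>v i\<close> with the
  centre, so it contracts exactly the edge \<open>e i\<close>. The loops of \<open>M\<close> then
  map to loops of \<open>N\<close> with centre \<open>c (v i)\<close>, and the same \<open>b\<close>
  is read off.\<close>

lemma collapse_forward:
  assumes n: "n \<ge> 4" and col: "collapses_to n M N" and bM: "marks n n M b" and N: "card (verts (ugraph N)) = n"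
  shows "\<exists>i<n. marks n i N b"
proof -
  let ?X = "gog M" and ?Y = "gog N"
  have M: "is_marked_gog n M" and N': "is_marked_gog n N" using col by (auto simp: collapses_to_def)
  obtain A c d h where A: "A \<subseteq> arcs (ugraph M)" "rev_arc ?X ` A \<subseteq> A"
    and c: "c ` verts (ugraph M) = verts (ugraph N)"
      "\<forall>u\<in>verts (ugraph M). \<forall>v\<in>verts (ugraph M). c u = c v \<longleftrightarrow> u \<rightarrow>\<^sup>*\<^bsub>(ugraph M)\<lparr>arcs := A\<rparr>\<^esub> v"
    and d: "bij_betw d (arcs (ugraph M) - A) (arcs (ugraph N))"
      "\<forall>e\<in>arcs (ugraph M) - A. tail (ugraph N) (d e) = c (tail (ugraph M) e) \<and>
        head (ugraph N) (d e) = c (head (ugraph M) e) \<and> rev_arc ?Y (d e) = d (rev_arc ?X e)"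
    and h: "\<forall>w\<in>verts (ugraph N).
           let C = {v \<in> verts (ugraph M). c v = w} in
           \<exists>\<theta> \<in> iso (free_product C (vgroup ?X)) (vgroup ?Y w).
             \<forall>v\<in>C. \<forall>g\<in>carrier (vgroup ?X v). h v g = \<theta> (free_product_class C (vgroup ?X) [(v, g)])"
    and base: "base N = c (base M)"
    and mark: "\<forall>w\<in>carrier (W n). marking N w = induced_map ?Y (collapse_letter A c d h) (marking M w)"
    using col unfolding collapses_to_def by (elim conjE exE) (rule that, assumption+)
  obtain v e p \<kappa> where star: "star n n ?X v e" and p: "is_path ?X (base M) p (v n)"
    and \<kappa>: "\<forall>j<n. \<kappa> j \<in> carrier (vgroup ?X (v n))"
    and b: "\<forall>j<n. b j \<in> carrier G \<and> marking M (b j) = loop n ?X v e p \<kappa> j"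
    using bM unfolding marks_def G_def by blast
  interpret X: star_of_groups ?X "path_group ?X" n n v e by (rule star_of_groups_marked[OF M star])
  interpret Y: trivially_edged ?Y "path_group ?Y" by (rule trivially_edged_marked[OF N'])
  have c_vert: "c w \<in> verts (ugraph N)" if "w \<in> verts (ugraph M)" for w using c(1) that by auto
  \<comment> \<open>The map of a vertex group factors through the free product over its component.
    Factors embed into it, so \<open>h w\<close> is injective and sends flips to flips.\<close>
  have h_hom: "h w \<in> hom (vgroup ?X w) (vgroup ?Y (c w))"
    and h_one: "\<And>g. g \<in> carrier (vgroup ?X w) \<Longrightarrow> h w g = \<one>\<^bsub>vgroup ?Y (c w)\<^esub> \<Longrightarrow> g = \<one>\<^bsub>vgroup ?X w\<^esub>"
    if w: "w \<in> verts (ugraph M)" for w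
  proof -
    let ?C = "{v \<in> verts (ugraph M). c v = c w}"
    obtain \<theta> where \<theta>: "\<theta> \<in> iso (free_product ?C (vgroup ?X)) (vgroup ?Y (c w))"
      "\<forall>v\<in>?C. \<forall>g\<in>carrier (vgroup ?X v). h v g = \<theta> (free_product_class ?C (vgroup ?X) [(v, g)])"
      using bspec[OF h c_vert[OF w]] unfolding Let_def by blast
    have wC: "w \<in> ?C" using w by simp
    have grp: "group (vgroup ?X u)" if "u \<in> ?C" for u using that X.vgroup_group by simp
    have inj: "(\<lambda>g. free_product_class ?C (vgroup ?X) [(w, g)]) \<in> hom (vgroup ?X w) (free_product ?C (vgroup ?X))"
      by (rule free_product_inj_hom[where i = w and G = "vgroup ?X", OF grp[OF wC] wC])
    have hw: "h w g = (\<theta> \<circ> (\<lambda>g. free_product_class ?C (vgroup ?X) [(w, g)])) g" if "g \<in> carrier (vgroup ?X w)" for g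
      using \<theta>(2) wC that by simp
    show "h w \<in> hom (vgroup ?X w) (vgroup ?Y (c w))"
      using group.hom_eq[OF X.vgroup_group[OF w] Group.hom_compose[OF inj iso_imp_homomorphism[OF \<theta>(1)]], of "h w"] hw by blast
    fix g assume g: "g \<in> carrier (vgroup ?X w)" "h w g = \<one>\<^bsub>vgroup ?Y (c w)\<^esub>"
    have fg: "group (free_product ?C (vgroup ?X))" by (rule free_product_group[OF grp])
    have "\<theta> (free_product_class ?C (vgroup ?X) [(w, g)]) = \<theta> \<one>\<^bsub>free_product ?C (vgroup ?X)\<^esub>"
      using hw[OF g(1)] g(2) hom_one[OF iso_imp_homomorphism[OF \<theta>(1)] fg Y.vgroup_group[OF c_vert[OF w]]] by simp
    then have "free_product_class ?C (vgroup ?X) [(w, g)] = \<one>\<^bsub>free_product ?C (vgroup ?X)\<^esub>"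
      using \<theta>(1) hom_in_carrier[OF inj g(1)] monoid.one_closed[OF group.is_monoid[OF fg]]
      by (auto simp: iso_def bij_betw_def dest: inj_onD)
    then show "g = \<one>\<^bsub>vgroup ?X w\<^esub>"
      using free_product_class_neq_one[of ?C "vgroup ?X" w g, OF grp wC g(1)] by blast
  qed
  have A_reach: "c (tail (ugraph M) a) = c (head (ugraph M) a)" if "a \<in> A" for a
  proof -
    let ?H = "(ugraph M)\<lparr>arcs := A\<rparr>"
    have a: "a \<in> arcs (ugraph M)" using that A by auto
    have "(tail (ugraph M) a, head (ugraph M) a) \<in> arcs_ends ?H"
      using that by (force simp: arcs_ends_def arc_to_ends_def image_iff)
    then have "tail (ugraph M) a \<rightarrow>\<^sup>*\<^bsub>?H\<^esub> head (ugraph M) a"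
      unfolding reachable_def using X.tail_in_verts[OF a] X.head_in_verts[OF a]
      by (auto intro!: rtrancl_on_into_rtrancl_on[OF rtrancl_on_refl])
    then show ?thesis using c(2) X.tail_in_verts[OF a] X.head_in_verts[OF a] by blast
  qed
  interpret sub: path_substitution ?X "path_group ?X" ?Y "path_group ?Y" "collapse_letter A c d h" c
  proof
    show "is_path ?Y (c w) (collapse_letter A c d h (Vert w g)) (c w)"
      if "w \<in> verts (ugraph M)" "g \<in> carrier (vgroup ?X w)" for w g
      using that c_vert hom_in_carrier[OF h_hom] by simp
    show "is_path ?Y (c (tail (ugraph M) a)) (collapse_letter A c d h (Edge a)) (c (head (ugraph M) a))"
      if a: "a \<in> arcs (ugraph M)" for a
    proof (cases "a \<in> A")
      case True
      then show ?thesis using A_reach a c_vert by simp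
    next
      case False
      then have "d a \<in> arcs (ugraph N)" using d(1) a by (auto simp: bij_betw_def)
      then show ?thesis using False a d(2) c_vert by simp
    qed
    show "(\<lambda>g. path_class ?Y (collapse_letter A c d h (Vert w g))) \<in> hom (vgroup ?X w) (path_group ?Y)"
      if w: "w \<in> verts (ugraph M)" for w
      using Group.hom_compose[OF h_hom[OF w] Y.vert_class_hom[OF c_vert[OF w]]] by (simp add: o_def)
    show "path_class ?Y (collapse_letter A c d h (Edge a)) \<otimes>\<^bsub>path_group ?Y\<^esub>
        path_class ?Y (collapse_letter A c d h (Edge (rev_arc ?X a))) = \<one>\<^bsub>path_group ?Y\<^esub>"
      if a: "a \<in> arcs (ugraph M)" for a
    proof (cases "a \<in> A")
      case True
      then have "rev_arc ?X a \<in> A" using A by auto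
      then show ?thesis using True by simp
    next
      case False
      then have "rev_arc ?X a \<notin> A" using A(2) by (metis X.arev_arev image_subset_iff)
      moreover have "d a \<in> arcs (ugraph N)" using d(1) a False by (auto simp: bij_betw_def)
      moreover have "d (rev_arc ?X a) = rev_arc ?Y (d a)" using d(2) a False by auto
      ultimately show ?thesis using False Y.edge_class_rev by simp
    qed
  qed (use c_vert in auto)
  have cvn: "card (verts (ugraph M)) = Suc n" using X.card_verts by simp
  have A_cases: "\<exists>j<n. e j \<in> A \<and> rev_arc ?X (e j) \<in> A \<and> a \<in> {e j, rev_arc ?X (e j)}" if "a \<in> A" for a
  proof -
    have "a \<in> arcs (ugraph M)" using that A by auto
    then obtain j where j: "j < n" "a = e j \<or> a = rev_arc ?X (e j)" using X.arcs_eq by auto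
    then show ?thesis using that A(2) by (metis X.arev_arev image_subset_iff insert_iff)
  qed
  obtain i where i: "i < n" "e i \<in> A" "rev_arc ?X (e i) \<in> A"
  proof -
    \<comment> \<open>An empty forest would keep all \<open>n + 1\<close> vertices.\<close>
    have "A \<noteq> {}"
    proof
      assume "A = {}"
      have "u = w" if "u \<rightarrow>\<^sup>*\<^bsub>(ugraph M)\<lparr>arcs := {}\<rparr>\<^esub> w" for u w
        using that unfolding reachable_def by (auto elim!: rtrancl_on.cases simp: arcs_ends_def)
      then have "inj_on c (verts (ugraph M))" using c(2) \<open>A = {}\<close> by (meson inj_onI)
      then have "card (verts (ugraph N)) = Suc n" using c(1) card_image cvn by metis
      then show False using N by simp
    qed
    then obtain a where "a \<in> A" by blast
    then show ?thesis using A_cases that by blast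
  qed
  have ci: "c (v i) = c (v n)" using A_reach[OF i(2)] X.tail_e[of i] X.head_e[of i] i(1) by simp
  have img: "c ` (v ` {..<n}) = verts (ugraph N)"
  proof -
    have "c (v n) \<in> c ` v ` {..<n}" unfolding ci[symmetric] using i(1) by blast
    then show ?thesis unfolding c(1)[symmetric] X.verts_eq by auto
  qed
  have "card (c ` v ` {..<n}) = n" using img N by simp
  then have inj: "inj_on (c \<circ> v) {..<n}"
    unfolding image_comp by (intro eq_card_imp_inj_on) auto
  \<comment> \<open>A second contracted edge would identify two leaves, but the \<open>n\<close>
    leaves have \<open>n\<close> distinct images.\<close>
  have A_only: "j = i" if "j < n" "e j \<in> A" for j
  proof -
    have "c (v j) = c (v n)" using A_reach[OF that(2)] X.tail_e[of j] X.head_e[of j] that(1) by simp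
    then show ?thesis using ci inj that(1) i(1) by (auto simp: inj_on_def)
  qed
  have not_A: "e j \<notin> A" "rev_arc ?X (e j) \<notin> A" if "j < n" "j \<noteq> i" for j
  proof -
    show "e j \<notin> A" using A_only that by blast
    then show "rev_arc ?X (e j) \<notin> A" using A(2) by (metis X.arev_arev image_subset_iff)
  qed
  have A_eq: "A = {e i, rev_arc ?X (e i)}" using A_cases A_only i by blast
  have ins: "insert i {..<n} = {..<n}" using i(1) by auto
  have F_all: "vgroup ?Y w \<cong> F" if "w \<in> verts (ugraph N)" for w
  proof -
    have fin: "finite (verts (ugraph N))" using N n by (metis card.infinite not_numeral_le_zero)
    have "{w \<in> verts (ugraph N). vgroup ?Y w \<cong> F} = verts (ugraph N)"
      by (rule card_subset_eq) (use fin N' N in \<open>auto simp: is_marked_gog_def\<close>)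
    then show ?thesis using that by blast
  qed
  have ej: "e j \<in> arcs (ugraph M) - A" "rev_arc ?X (e j) \<in> arcs (ugraph M) - A" "tail (ugraph M) (e j) = v n" "head (ugraph M) (e j) = v j"
    if "j < n" "j \<noteq> i" for j
    using that not_A X.e_arc[of j] X.tail_e[of j] X.head_e[of j] by auto
  have dj: "d (e j) \<in> arcs (ugraph N)" "d (rev_arc ?X (e j)) = rev_arc ?Y (d (e j))"
    "tail (ugraph N) (d (e j)) = c (v n)" "head (ugraph N) (d (e j)) = c (v j)" if "j < n" "j \<noteq> i" for j
    using ej[OF that] d by (auto simp: bij_betw_def)
  have "arcs (ugraph M) - A = (\<Union>j\<in>{..<n} - {i}. {e j, rev_arc ?X (e j)})"
    using ej(1,2) X.arcs_eq A_eq by auto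
  then have "arcs (ugraph N) = d ` (\<Union>j\<in>{..<n} - {i}. {e j, rev_arc ?X (e j)})"
    using d(1) by (simp add: bij_betw_def)
  also have "\<dots> = (\<Union>j\<in>{..<n} - {i}. {d (e j), d (rev_arc ?X (e j))})"
    by (simp only: image_UN image_insert image_empty)
  also have "\<dots> = (\<Union>j\<in>{..<n} - {i}. {(d \<circ> e) j, rev_arc ?Y ((d \<circ> e) j)})"
    by (rule SUP_cong) (simp_all add: dj(2))
  finally have arcs_N: "arcs (ugraph N) = (\<Union>j\<in>{..<n} - {i}. {(d \<circ> e) j, rev_arc ?Y ((d \<circ> e) j)})" .
  have "star n i ?Y (c \<circ> v) (d \<circ> e)"
    unfolding star_def
  proof (intro conjI allI ballI impI)
    show "inj_on (c \<circ> v) (insert i {..<n})" using inj by (simp add: ins)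
    show "verts (ugraph N) = (c \<circ> v) ` insert i {..<n}" using img by (simp add: ins image_comp)
    show "vgroup ?Y ((c \<circ> v) j) \<cong> F" if "j < n" for j using F_all img that by auto
  qed (use i arcs_N dj ci in auto)
  note starN = this
  interpret Z: star_of_groups ?Y "path_group ?Y" n i "c \<circ> v" "d \<circ> e" by (rule star_of_groups_marked[OF N' starN])
  let ?p = "concat (map (collapse_letter A c d h) p)"
  let ?\<kappa> = "\<lambda>_ :: nat. \<one>\<^bsub>vgroup ?Y ((c \<circ> v) i)\<^esub>"
  have pN: "is_path ?Y (base N) ?p ((c \<circ> v) i)" using sub.ind_path[OF p] base ci by simp
  have \<kappa>N: "\<forall>j<n. ?\<kappa> j \<in> carrier (vgroup ?Y ((c \<circ> v) i))"
    using Y.vgroup_monoid[of "(c \<circ> v) i"] Z.v_vert by (simp add: monoid.one_closed)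
  interpret ind: group_hom "path_group ?X" "path_group ?Y" sub.ind
    using sub.ind_hom X.is_group Y.is_group by (simp add: group_hom_def group_hom_axioms_def)
  have "marking N (b j) = loop i ?Y (c \<circ> v) (d \<circ> e) ?p ?\<kappa> j" if j: "j < n" for j
  proof -
    have lets: "p \<in> lists X.letters" using X.is_path_letters[OF p] .
    have k1: "\<kappa> j = \<one>\<^bsub>vgroup ?X (v n)\<^esub>" using \<kappa> j X.vgroup_centre by (auto simp: trivial_group_def)
    have cl: "arm n ?X v e p \<kappa> j \<in> carrier (path_group ?X)" using X.arm_closed[OF p \<kappa> j] .
    have arm: "sub.ind (arm n ?X v e p \<kappa> j) = arm i ?Y (c \<circ> v) (d \<circ> e) ?p ?\<kappa> j"
    proof (cases "j = i")
      case True
      have "\<kappa> i = \<one>\<^bsub>vgroup ?X (v n)\<^esub>" using k1 True by simp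
      then show ?thesis
        using True j lets i X.e_arc[of i] sub.ind_class[OF lets] Z.p_letters[OF pN \<kappa>N] Z.v_vert
        by (simp add: arm_def k1 sub.ind_edge)
    next
      case False
      then show ?thesis
        using j lets i X.e_arc[of j] not_A(1)[OF j False] sub.ind_class[OF lets] Z.p_letters[OF pN \<kappa>N] Z.v_vert dj(1)[OF j False]
        by (simp add: arm_def k1 sub.ind_edge)
    qed
    have "h (v j) (flip (vgroup ?X (v j))) = flip (vgroup ?Y ((c \<circ> v) j))"
    proof (rule flip_unique)
      show "h (v j) (flip (vgroup ?X (v j))) \<noteq> \<one>\<^bsub>vgroup ?Y ((c \<circ> v) j)\<^esub>"
        using h_one[of "v j" "flip (vgroup ?X (v j))"] flip(2)[OF X.vgroup_group X.vgroup_F] j by auto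
      show "h (v j) (flip (vgroup ?X (v j))) \<in> carrier (vgroup ?Y ((c \<circ> v) j))"
        using hom_in_carrier[OF h_hom[of "v j"]] j by simp
    qed (use j Z.vgroup_F Y.vgroup_group Z.v_vert in auto)
    then have "sub.ind (loop n ?X v e p \<kappa> j) = loop i ?Y (c \<circ> v) (d \<circ> e) ?p ?\<kappa> j"
      using cl j by (simp add: loop_def arm sub.ind_vert)
    then show ?thesis using mark[folded G_def] b j by simp
  qed
  then have "marks n i N b"
    unfolding marks_def using starN pN \<kappa>N b unfolding G_def[symmetric] by - (rule exI[of _ "c \<circ> v"], rule exI[of _ "d \<circ> e"], rule exI[of _ ?p], rule exI[of _ ?\<kappa>], simp)
  then show ?thesis using i(1) by blast
qed

text \<open>Between standard stars the collapse is literal: arcs keep their numbers, and the centre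
  \<open>n\<close> is merged into \<open>i\<close>. The markings are homomorphisms and need to be
  compared on \<open>b\<close> only, where both give standard loops.\<close>

lemma collapse_backward:
  assumes n: "n \<ge> 4" and i: "i < n" and b: "basis b"
  obtains M N where "M \<in> star_class n b" "N \<in> star_class i b" "collapses_to n M N"
proof -
  obtain M where M: "std_marking n b M" by (rule std_marking_exists[of n b]) (use n b in auto)
  obtain N where N: "std_marking i b N" by (rule std_marking_exists[of i b]) (use n i b in auto)
  have M': "is_marked_gog n M" "gog M = std_star n n" "base M = n"
    "\<And>j. j < n \<Longrightarrow> marking M (b j) = loop n (std_star n n) id (\<lambda>j. 2 * j) [] (\<lambda>_. 0) j"
    using M by (auto simp: std_marking_def)
  have N': "is_marked_gog n N" "gog N = std_star n i" "base N = i"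
    "\<And>j. j < n \<Longrightarrow> marking N (b j) = loop i (std_star n i) id (\<lambda>j. 2 * j) [] (\<lambda>_. 0) j"
    using N by (auto simp: std_marking_def)
  interpret X: star_of_groups "std_star n n" "path_group (std_star n n)" n n id "\<lambda>j. 2 * j"
    using star_of_groups_marked[OF M'(1)] std_is_star[of n n] M'(2) by simp
  interpret Y: star_of_groups "std_star n i" "path_group (std_star n i)" n i id "\<lambda>j. 2 * j"
    using star_of_groups_marked[OF N'(1)] std_is_star[of i n] N'(2) i by simp
  define A where "A = {2 * i, Suc (2 * i)}"
  define c where "c j = (if j = n then i else j)" for j :: nat
  \<comment> \<open>The trivial group at the old centre \<open>n\<close> goes to 0, the identity of
    \<open>nat_F\<close>.\<close>
  define h where "h j g = (if j = n then 0 else g)" for j g :: nat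
  have A_iff: "a \<in> A \<longleftrightarrow> a div 2 = i" for a unfolding A_def by auto
  have arcs: "a \<in> std_arcs n i \<longleftrightarrow> a \<in> std_arcs n n \<and> a \<notin> A" for a
    by (auto simp: std_arcs_iff A_iff)
  have A_sub: "A \<subseteq> std_arcs n n" using i by (auto simp: A_def std_arcs_iff)
  have revA: "std_rev n n ` A \<subseteq> A"
    using i by (auto simp: A_def std_rev_def std_arcs_iff)
  have rev: "std_rev n i a = std_rev n n a" if "a \<notin> A" for a
    using arcs[of a] that by (simp add: std_rev_def)
  have reach_iff: "c u = c w \<longleftrightarrow> u \<rightarrow>\<^sup>*\<^bsub>(graph (std_star n n))\<lparr>arcs := A\<rparr>\<^esub> w"
    if "u \<in> insert n {..<n}" "w \<in> insert n {..<n}" for u w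
  proof
    let ?H = "(graph (std_star n n))\<lparr>arcs := A\<rparr>"
    have vH: "verts ?H = insert n {..<n}" by simp
    have refl: "u \<rightarrow>\<^sup>*\<^bsub>?H\<^esub> u" if "u \<in> insert n {..<n}" for u
      using that unfolding reachable_def vH by (rule rtrancl_on_refl)
    have "n \<rightarrow>\<^sup>*\<^bsub>?H\<^esub> i" "i \<rightarrow>\<^sup>*\<^bsub>?H\<^esub> n" using std_reachable[of n n A i] A_sub by (simp_all add: A_def)
    then show "u \<rightarrow>\<^sup>*\<^bsub>?H\<^esub> w" if "c u = c w"
      using that refl[OF \<open>u \<in> _\<close>] by (auto simp: c_def split: if_splits)
    have "c u = c w" if "(u, w) \<in> rtrancl_on (verts ?H) (arcs_ends ?H)" for u w
      using that
    proof (induction rule: rtrancl_on.induct)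
      case (rtrancl_on_into_rtrancl_on a b d)
      then have "c b = c d" by (auto simp: arcs_ends_def arc_to_ends_def A_def c_def)
      then show ?case using rtrancl_on_into_rtrancl_on by simp
    qed simp
    then show "c u = c w" if "u \<rightarrow>\<^sup>*\<^bsub>?H\<^esub> w" using that unfolding reachable_def by blast
  qed
  have zero: "(0 :: nat) \<in> carrier nat_F" by (simp add: nat_F_def)
  have vg0: "\<one>\<^bsub>nat_F\<^esub> = (0::nat)" "\<one>\<^bsub>singleton_group (0::nat)\<^esub> = 0" "carrier (singleton_group (0::nat)) = {0}"
    by (simp_all add: nat_F_def singleton_group_def)
  interpret sub: path_substitution "std_star n n" "path_group (std_star n n)" "std_star n i" "path_group (std_star n i)"
    "collapse_letter A c id h" c
  proof
    show "is_path (std_star n i) (c w) (collapse_letter A c id h (Vert w g)) (c w)"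
      if "w \<in> verts (graph (std_star n n))" "g \<in> carrier (vgroup (std_star n n) w)" for w g
      using that i zero by (auto simp: c_def h_def)
    show "is_path (std_star n i) (c (tail (graph (std_star n n)) a)) (collapse_letter A c id h (Edge a)) (c (head (graph (std_star n n)) a))"
      if a: "a \<in> arcs (graph (std_star n n))" for a
    proof (cases "a \<in> A")
      case True
      then show ?thesis using i by (auto simp: A_def c_def)
    next
      case False
      then show ?thesis using a arcs[of a] i by (auto simp: c_def std_arcs_iff)
    qed
    show "(\<lambda>g. path_class (std_star n i) (collapse_letter A c id h (Vert w g))) \<in> hom (vgroup (std_star n n) w) (path_group (std_star n i))"
      if w: "w \<in> verts (graph (std_star n n))" for w
    proof (cases "w = n")
      case True
      have "vert_class (std_star n i) i 0 = \<one>\<^bsub>path_group (std_star n i)\<^esub>"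
        using Y.vert_class_one[of i] i vg0 by simp
      then have "path_class (std_star n i) (collapse_letter A c id h (Vert w g)) = \<one>\<^bsub>path_group (std_star n i)\<^esub>" for g
        using True by (simp add: c_def h_def)
      then show ?thesis by (intro homI) simp_all
    next
      case False
      then have "h w = (\<lambda>g. g)" "c w = w" "w < n" using w by (auto simp: h_def c_def)
      then show ?thesis using Y.vert_class_hom[of w] False by simp
    qed
    show "path_class (std_star n i) (collapse_letter A c id h (Edge a)) \<otimes>\<^bsub>path_group (std_star n i)\<^esub>
        path_class (std_star n i) (collapse_letter A c id h (Edge (rev_arc (std_star n n) a))) = \<one>\<^bsub>path_group (std_star n i)\<^esub>"
      if a: "a \<in> arcs (graph (std_star n n))" for a
    proof (cases "a \<in> A")
      case True
      then have "std_rev n n a \<in> A" using revA by auto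
      then show ?thesis using True by simp
    next
      case False
      have "std_rev n n a \<notin> A" using False A_iff by simp
      then show ?thesis using False a arcs[of a] Y.edge_class_rev[of a] rev[OF False] by simp
    qed
  qed (use i in \<open>auto simp: c_def\<close>)
  have hM: "marking M \<in> hom G (path_group (std_star n n))"
    using M'(1,2) X.iso_fundamentalD(1)[of "marking M" G "base M"] by (simp add: is_marked_gog_def G_def)
  have hN: "marking N \<in> hom G (path_group (std_star n i))"
    using N'(1,2) Y.iso_fundamentalD(1)[of "marking N" G "base N"] by (simp add: is_marked_gog_def G_def)
  interpret ind: group_hom "path_group (std_star n n)" "path_group (std_star n i)" sub.ind
    using sub.ind_hom X.is_group Y.is_group by (simp add: group_hom_def group_hom_axioms_def)
  have gen: "marking N (b j) = sub.ind (marking M (b j))" if j: "j < n" for j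
  proof -
    have pX: "is_path (std_star n n) n [] (id n)" by simp
    have \<kappa>X: "\<forall>j<n. (\<lambda>_. 0) j \<in> carrier (vgroup (std_star n n) (id n))" by (simp add: vg0)
    have cl: "arm n (std_star n n) id (\<lambda>j. 2 * j) [] (\<lambda>_. 0) j \<in> carrier (path_group (std_star n n))"
      using X.arm_closed[OF pX \<kappa>X j] .
    have v1: "vert_class (std_star n n) n 0 = \<one>\<^bsub>path_group (std_star n n)\<^esub>"
      "vert_class (std_star n i) i 0 = \<one>\<^bsub>path_group (std_star n i)\<^esub>"
      using X.vert_class_one[of n] Y.vert_class_one[of i] vg0 i by simp_all
    have arm: "sub.ind (arm n (std_star n n) id (\<lambda>j. 2 * j) [] (\<lambda>_. 0) j) = arm i (std_star n i) id (\<lambda>j. 2 * j) [] (\<lambda>_. 0) j"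
    proof (cases "j = i")
      case True
      then show ?thesis using v1 i j X.e_arc[of i] by (simp add: arm_def sub.ind_edge A_iff)
    next
      case False
      then have "2 * j \<notin> A" by (simp add: A_iff)
      then show ?thesis using False v1 j X.e_arc[of j] Y.e_arc[of j] by (simp add: arm_def sub.ind_edge)
    qed
    have "flip nat_F \<in> carrier nat_F" using flip(1)[OF nat_F_group nat_F_iso] .
    then show ?thesis
      unfolding M'(4)[OF j] N'(4)[OF j] using cl j
      by (simp add: loop_def arm sub.ind_vert h_def c_def)
  qed
  have mark: "marking N w = sub.ind (marking M w)" if "w \<in> carrier G" for w
    using basis_hom_ext[OF b Y.is_group hN Group.hom_compose[OF hM sub.ind_hom] _ that] gen by simp
  have theta: "\<exists>\<theta>\<in>iso (free_product {v \<in> insert n {..<n}. c v = w} (vgroup (std_star n n))) (vgroup (std_star n i) w).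
      \<forall>v\<in>{v \<in> insert n {..<n}. c v = w}. \<forall>g\<in>carrier (vgroup (std_star n n) v).
        h v g = \<theta> (free_product_class {v \<in> insert n {..<n}. c v = w} (vgroup (std_star n n)) [(v, g)])"
    if w: "w < n" for w
  proof -
    let ?C = "{v \<in> insert n {..<n}. c v = w}"
    have wC: "w \<in> ?C" using w by (simp add: c_def)
    have grp: "group (vgroup (std_star n n) u)" if "u \<in> ?C" for u using X.vgroup_group that by simp
    have triv: "trivial_group (vgroup (std_star n n) u)" if "u \<in> ?C" "u \<noteq> w" for u
      using that by (auto simp: c_def split: if_splits)
    obtain \<theta> where \<theta>: "\<theta> \<in> iso (free_product ?C (vgroup (std_star n n))) (vgroup (std_star n n) w)"
      "\<forall>u\<in>?C. \<forall>g\<in>carrier (vgroup (std_star n n) u).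
        \<theta> (free_product_class ?C (vgroup (std_star n n)) [(u, g)]) = (if u = w then g else \<one>\<^bsub>vgroup (std_star n n) w\<^esub>)"
      using free_product_iso_factor[of ?C "vgroup (std_star n n)" w, OF grp wC triv] by blast
    have "h u g = \<theta> (free_product_class ?C (vgroup (std_star n n)) [(u, g)])"
      if "u \<in> ?C" "g \<in> carrier (vgroup (std_star n n) u)" for u g
    proof -
      have "u = w \<or> u = n \<and> g = 0" using that w vg0 by (auto simp: c_def split: if_splits)
      moreover have "h u g = (if u = w then g else 0)" using calculation w by (auto simp: h_def)
      moreover have "\<one>\<^bsub>vgroup (std_star n n) w\<^esub> = 0" using w vg0 by simp
      moreover have "\<theta> (free_product_class ?C (vgroup (std_star n n)) [(u, g)]) = (if u = w then g else \<one>\<^bsub>vgroup (std_star n n) w\<^esub>)"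
        using \<theta>(2) that by blast
      ultimately show ?thesis by simp
    qed
    moreover have "vgroup (std_star n i) w = vgroup (std_star n n) w" using w by simp
    ultimately show ?thesis using \<theta>(1) by (intro bexI[of _ \<theta>]) simp_all
  qed
  have "collapses_to n M N"
    unfolding collapses_to_def M'(2,3) N'(2,3)
  proof (rule conjI[OF M'(1)], rule conjI[OF N'(1)], rule exI[of _ A], rule exI[of _ c], rule exI[of _ id],
      rule exI[of _ h], intro conjI ballI)
    show "A \<subseteq> arcs (graph (std_star n n))" using A_sub by simp
    show "rev_arc (std_star n n) ` A \<subseteq> A" using revA by simp
    show "serre_forest ((graph (std_star n n))\<lparr>arcs := A\<rparr>) (rev_arc (std_star n n))"
      using std_forest[of n n A] A_sub by simp
    show "c ` verts (graph (std_star n n)) = verts (graph (std_star n i))"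
      using i by (auto simp: c_def image_def)
    show "c u = c w \<longleftrightarrow> u \<rightarrow>\<^sup>*\<^bsub>(graph (std_star n n))\<lparr>arcs := A\<rparr>\<^esub> w"
      if "u \<in> verts (graph (std_star n n))" "w \<in> verts (graph (std_star n n))" for u w
      using reach_iff that by simp
    show "bij_betw id (arcs (graph (std_star n n)) - A) (arcs (graph (std_star n i)))"
      using arcs by (auto simp: bij_betw_def)
    fix a assume a: "a \<in> arcs (graph (std_star n n)) - A"
    show "tail (graph (std_star n i)) (id a) = c (tail (graph (std_star n n)) a)"
      "head (graph (std_star n i)) (id a) = c (head (graph (std_star n n)) a)"
      "rev_arc (std_star n i) (id a) = id (rev_arc (std_star n n) a)"
      using a rev[of a] by (auto simp: c_def std_arcs_iff)
  next
    fix w assume "w \<in> verts (graph (std_star n i))"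
    then have "w < n" using i by auto
    then show "let C = {v \<in> verts (graph (std_star n n)). c v = w} in
      \<exists>\<theta>\<in>iso (free_product C (vgroup (std_star n n))) (vgroup (std_star n i) w).
        \<forall>v\<in>C. \<forall>g\<in>carrier (vgroup (std_star n n) v). h v g = \<theta> (free_product_class C (vgroup (std_star n n)) [(v, g)])"
      using theta unfolding Let_def by simp
  next
    show "i = c n" by (simp add: c_def)
    show "marking N w = sub.ind (marking M w)" if "w \<in> carrier (W n)" for w using mark that by (simp add: G_def)
  qed
  moreover have "M \<in> star_class n b" "N \<in> star_class i b"
    using std_marking_marks M N M'(1) N'(1) b i by (auto simp: star_class_def)
  ultimately show ?thesis using that by blast
qed

end

section \<open>The graph L in terms of bases\<close>

context universal_coxeter
begin

lemma F_star_in_F: "n \<ge> 3 \<Longrightarrow> k < n \<Longrightarrow> basis b \<Longrightarrow> star_class k b \<in> F_stars n"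
  using F_stars_eq by blast

lemma zero_star_in_zero: "n \<ge> 3 \<Longrightarrow> basis b \<Longrightarrow> star_class n b \<in> zero_stars n"
  using zero_stars_eq by blast

text \<open>An adjacency could come from a collapse in either direction. Contraction does not
  increase the number of vertices, so it is always the {0}-star that collapses.\<close>

lemma edge_iff:
  assumes n: "n \<ge> 4" and b: "basis b" and b': "basis b'" and k: "k < n"
  shows "{star_class n b, star_class k b'} \<in> L_edges n \<longleftrightarrow> (\<exists>i<n. star_class k b' = star_class i b)"
proof -
  have n3: "n \<ge> 3" using n by simp
  have ne: "star_class n b \<noteq> star_class k b'"
  proof
    assume eq: "star_class n b = star_class k b'"
    obtain M where "M \<in> star_class n b" using star_class_nonempty[OF n3 order.refl b] by (auto simp: star_class_def)
    then show False using star_class_cards(1)[OF n3, of M n b] star_class_cards(1)[OF n3, of M k b'] eq k by simp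
  qed
  have verts: "star_class n b \<in> spine_verts n" "star_class k b' \<in> spine_verts n"
    "{star_class n b, star_class k b'} \<subseteq> L_verts n"
    using star_class_spine_vert[OF n3] b b' k zero_star_in_zero[OF n3 b] F_star_in_F[OF n3 k b']
    by (auto simp: L_verts_def)
  have adj: "spine_adj n (star_class n b) (star_class k b') \<longleftrightarrow> (\<exists>i<n. star_class k b' = star_class i b)"
  proof
    assume "spine_adj n (star_class n b) (star_class k b')"
    then obtain M N where MN: "M \<in> star_class n b" "N \<in> star_class k b'" "collapses_to n M N \<or> collapses_to n N M"
      by (auto simp: spine_adj_def)
    have cards: "card (verts (ugraph M)) = Suc n" "card (verts (ugraph N)) = n"
      using star_class_cards(1)[OF n3] MN(1,2) k by auto
    have "\<not> collapses_to n N M"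
    proof
      assume "collapses_to n N M"
      then obtain c :: "nat \<Rightarrow> nat" where "c ` verts (ugraph N) = verts (ugraph M)" unfolding collapses_to_def by blast
      moreover have "finite (verts (ugraph N))" using cards n by (metis card.infinite not_numeral_le_zero)
      ultimately have "Suc n \<le> n" using cards card_image_le by metis
      then show False by simp
    qed
    then have col: "collapses_to n M N" using MN by blast
    obtain i where i: "i < n" "marks n i N b"
      using collapse_forward[OF n col _ cards(2)] MN(1) by (auto simp: star_class_def)
    have "star_class k b' = star_class i b"
      using star_class_eqI[of N k b' i b] MN(2) i by (auto simp: star_class_def)
    then show "\<exists>i<n. star_class k b' = star_class i b" using i by blast
  next
    assume "\<exists>i<n. star_class k b' = star_class i b"
    then obtain i where i: "i < n" "star_class k b' = star_class i b" by blast
    show "spine_adj n (star_class n b) (star_class k b')"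
      using collapse_backward[OF n i(1) b] ne i(2) unfolding spine_adj_def by metis
  qed
  have sym: "spine_adj n y z \<longleftrightarrow> spine_adj n z y" for y z by (auto simp: spine_adj_def)
  show ?thesis
    unfolding adj[symmetric] L_edges_def spine_def
    using ne verts sym by (auto simp: card_insert_if)
qed

end

section \<open>The action of the outer automorphism group\<close>

context universal_coxeter
begin

text \<open>The coset of \<open>Inn G\<close> through \<open>\<phi>\<close>. Its members are
  extensional functions, while \<open>\<phi>\<close> may be any representative, extensional or
  not.\<close>

definition out_class :: "(W_elt \<Rightarrow> W_elt) \<Rightarrow> (W_elt \<Rightarrow> W_elt) set" where
  "out_class \<phi> = {(\<lambda>h\<in>carrier G. g \<otimes> \<phi> h \<otimes> inv g) | g. g \<in> carrier G}"

lemma compose_Inn: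
  assumes "\<phi> \<in> auto G"
  shows "Inn G #>\<^bsub>AutoGroup G\<^esub> \<phi> = out_class \<phi>"
proof -
  have \<phi>: "\<phi> \<in> Bij (carrier G)" "\<And>h. h \<in> carrier G \<Longrightarrow> \<phi> h \<in> carrier G"
    using assms by (auto simp: auto_def hom_def)
  have inn: "(\<lambda>h\<in>carrier G. g \<otimes> h \<otimes> inv g) \<in> Bij (carrier G)" if "g \<in> carrier G" for g
    using conj_iso[OF that] by (auto simp: Bij_def iso_def bij_betw_def inj_on_def)
  have "(\<lambda>h\<in>carrier G. g \<otimes> h \<otimes> inv g) \<otimes>\<^bsub>AutoGroup G\<^esub> \<phi> = (\<lambda>h\<in>carrier G. g \<otimes> \<phi> h \<otimes> inv g)"
    if "g \<in> carrier G" for g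
  proof -
    have "(\<lambda>h\<in>carrier G. g \<otimes> h \<otimes> inv g) \<otimes>\<^bsub>AutoGroup G\<^esub> \<phi> = compose (carrier G) (\<lambda>h\<in>carrier G. g \<otimes> h \<otimes> inv g) \<phi>"
      using \<phi>(1) inn[OF that] by (simp add: AutoGroup_def BijGroup_def)
    also have "\<dots> = (\<lambda>h\<in>carrier G. g \<otimes> \<phi> h \<otimes> inv g)"
      unfolding compose_def by (rule restrict_ext) (simp add: \<phi>(2))
    finally show ?thesis .
  qed
  then show ?thesis
    unfolding r_coset_def Inn_def out_class_def by (simp add: setcompr_eq_image UNION_singleton_eq_range image_image)
qed

lemma carrier_Out: "carrier (Out G) = out_class ` iso G G"
proof -
  have carr: "carrier (Out G) = out_class ` auto G"
    unfolding Out_def FactGroup_def RCOSETS_def using compose_Inn by (auto simp: AutoGroup_def image_def)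
  have "out_class \<phi> \<in> out_class ` auto G" if "\<phi> \<in> iso G G" for \<phi>
  proof -
    have "restrict \<phi> (carrier G) \<in> auto G"
      using that by (auto simp: auto_def iso_def hom_def Bij_def bij_betw_def inj_on_def)
    moreover have "out_class (restrict \<phi> (carrier G)) = out_class \<phi>"
    proof -
      have "(\<lambda>h\<in>carrier G. g \<otimes> restrict \<phi> (carrier G) h \<otimes> inv g) = (\<lambda>h\<in>carrier G. g \<otimes> \<phi> h \<otimes> inv g)" for g
        by (rule restrict_ext) simp
      then show ?thesis unfolding out_class_def by simp
    qed
    ultimately show ?thesis by (metis imageI)
  qed
  moreover have "auto G \<subseteq> iso G G" by (auto simp: auto_def iso_def Bij_def)
  ultimately show ?thesis unfolding carr by blast
qed

lemma out_class_eqI: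
  assumes \<phi>: "\<phi> \<in> iso G G" and g: "g \<in> carrier G" and eq: "\<And>h. h \<in> carrier G \<Longrightarrow> \<phi>' h = g \<otimes> \<phi> h \<otimes> inv g"
  shows "out_class \<phi>' = out_class \<phi>"
proof -
  have cl: "\<phi> h \<in> carrier G" if "h \<in> carrier G" for h using \<phi> that by (auto simp: iso_def hom_def)
  have *: "(\<lambda>h\<in>carrier G. k \<otimes> \<phi>' h \<otimes> inv k) = (\<lambda>h\<in>carrier G. (k \<otimes> g) \<otimes> \<phi> h \<otimes> inv (k \<otimes> g))" if "k \<in> carrier G" for k
    by (rule restrict_ext) (use that g cl in \<open>simp add: eq conj_conj\<close>)
  show ?thesis
  proof (intro equalityI subsetI)
    fix \<theta> assume "\<theta> \<in> out_class \<phi>'"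
    then obtain k where "k \<in> carrier G" "\<theta> = (\<lambda>h\<in>carrier G. k \<otimes> \<phi>' h \<otimes> inv k)" by (auto simp: out_class_def)
    then show "\<theta> \<in> out_class \<phi>" using * g unfolding out_class_def by blast
  next
    fix \<theta> assume "\<theta> \<in> out_class \<phi>"
    then obtain k where k: "k \<in> carrier G" "\<theta> = (\<lambda>h\<in>carrier G. k \<otimes> \<phi> h \<otimes> inv k)" by (auto simp: out_class_def)
    have "(k \<otimes> inv g) \<otimes> g = k" using k g by (simp add: m_assoc)
    then have "\<theta> = (\<lambda>h\<in>carrier G. (k \<otimes> inv g) \<otimes> \<phi>' h \<otimes> inv (k \<otimes> inv g))"
      using *[of "k \<otimes> inv g"] k g by simp
    then show "\<theta> \<in> out_class \<phi>'" using k g unfolding out_class_def by blast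
  qed
qed

lemma marks_precompose:
  assumes M: "is_marked_gog n M" and b: "marks n k M b" and \<phi>: "\<phi> \<in> iso G G"
    and b': "\<And>j. j < n \<Longrightarrow> b' j \<in> carrier G \<and> \<phi> (b' j) = b j"
  shows "is_marked_gog n (M\<lparr>marking := marking M \<circ> \<phi>\<rparr>)" "marks n k (M\<lparr>marking := marking M \<circ> \<phi>\<rparr>) b'"
proof -
  have "marking M \<circ> \<phi> \<in> iso G (fundamental_group (gog M) (base M))"
    by (rule iso_set_trans[OF \<phi>]) (use M in \<open>simp add: is_marked_gog_def G_def\<close>)
  then show "is_marked_gog n (M\<lparr>marking := marking M \<circ> \<phi>\<rparr>)"
    using M by (simp add: is_marked_gog_def G_def)
  show "marks n k (M\<lparr>marking := marking M \<circ> \<phi>\<rparr>) b'"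
    using b b' unfolding marks_def G_def by (auto) metis
qed

lemma star_class_conj:
  assumes "n \<ge> 4" "k \<le> n" "basis b" "g \<in> carrier G" "\<And>j. j < n \<Longrightarrow> b' j = g \<otimes> b j \<otimes> inv g"
  shows "star_class k b = star_class k b'"
proof -
  have "star_equiv k b k b'"
    unfolding star_equiv_def using assms
    by - (rule exI[of _ id], rule exI[of _ g], rule exI[of _ "{}"], simp add: permutes_id partial_conj_def)
  then show ?thesis using star_class_eq_iff[OF assms(1,2,3)] by blast
qed

text \<open>Precomposing the marking with \<open>\<phi>\<close> moves the preimage of a loop by the
  inverse \<open>\<psi>\<close>. The inner part of a member of the class only conjugates the new
  basis, by \<open>inv (\<psi> g)\<close>.\<close>

lemma Out_act_star_class:
  assumes n: "n \<ge> 4" and k: "k \<le> n" and b: "basis b" and \<phi>: "\<phi> \<in> iso G G"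
    and \<psi>: "\<psi> \<in> iso G G" "\<And>g. g \<in> carrier G \<Longrightarrow> \<phi> (\<psi> g) = g"
  shows "Out_act n (out_class \<phi>) (star_class k b) = star_class k (\<psi> \<circ> b)"
proof -
  have bp: "basis (\<psi> \<circ> b)" by (rule basis_image[OF b \<psi>(1)])
  have hom: "\<psi> \<in> hom G G" "\<phi> \<in> hom G G" using \<psi> \<phi> by (auto simp: iso_def)
  have cl: "\<psi> g \<in> carrier G" "\<phi> g \<in> carrier G" if "g \<in> carrier G" for g using hom that by (auto simp: hom_def)
  have "marked_rel n `` {M\<lparr>marking := marking M \<circ> \<theta>\<rparr>} = star_class k (\<psi> \<circ> b)"
    if \<theta>: "\<theta> \<in> out_class \<phi>" and M: "M \<in> star_class k b" for \<theta> M
  proof -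
    obtain g where g: "g \<in> carrier G" "\<theta> = (\<lambda>h\<in>carrier G. g \<otimes> \<phi> h \<otimes> inv g)" using \<theta> by (auto simp: out_class_def)
    interpret \<psi>: group_hom G G \<psi> using hom is_group by (simp add: group_hom_def group_hom_axioms_def)
    define b' where "b' j = inv (\<psi> g) \<otimes> \<psi> (b j) \<otimes> inv (inv (\<psi> g))" for j
    have b'_eq: "b' j = \<psi> (inv g \<otimes> b j \<otimes> g)" if "j < n" for j
      using that b g by (simp add: b'_def)
    have "\<theta> = restrict ((\<lambda>h. g \<otimes> h \<otimes> inv g) \<circ> \<phi>) (carrier G)"
      unfolding g(2) by (rule restrict_ext) simp
    then have iso: "\<theta> \<in> iso G G"
      using iso_set_trans[OF \<phi> conj_iso[OF g(1)]] iso_eq[of _ G \<theta>] by simp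
    have "b' j \<in> carrier G \<and> \<theta> (b' j) = b j" if "j < n" for j
    proof -
      have "g \<otimes> (inv g \<otimes> b j \<otimes> g) \<otimes> inv g = b j" using that b g(1) by (simp add: m_assoc) (simp add: m_assoc[symmetric])
      moreover have a: "inv g \<otimes> b j \<otimes> g \<in> carrier G" using that b g(1) by simp
      ultimately show ?thesis
        unfolding b'_eq[OF that] g(2) using cl(1)[OF a] by (simp only: \<psi>(2)[OF a] restrict_apply' HOL.simp_thms)
    qed
    then have "is_marked_gog n (M\<lparr>marking := marking M \<circ> \<theta>\<rparr>)" "marks n k (M\<lparr>marking := marking M \<circ> \<theta>\<rparr>) b'"
      using marks_precompose[OF _ _ iso, of M k b b'] M by (auto simp: star_class_def)
    then have "marked_rel n `` {M\<lparr>marking := marking M \<circ> \<theta>\<rparr>} = star_class k b'" by (rule marked_rel_star_class)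
    also have "\<dots> = star_class k (\<psi> \<circ> b)"
      by (rule star_class_conj[OF n k bp, THEN HOL.sym, of "inv (\<psi> g)"]) (use g cl in \<open>simp_all add: b'_def\<close>)
    finally show ?thesis .
  qed
  moreover obtain M where "M \<in> star_class k b"
    using star_class_nonempty[of k b] n k b by (auto simp: star_class_def)
  moreover have "out_class \<phi> \<noteq> {}" by (auto simp: out_class_def)
  ultimately show ?thesis unfolding Out_act_def by blast
qed

end

section \<open>Rigidity\<close>

context universal_coxeter
begin

lemma star_class_cong:
  assumes "n \<ge> 4" "k \<le> n" "basis b" "\<And>j. j < n \<Longrightarrow> b' j = b j"
  shows "star_class k b' = star_class k b"
  using star_class_conj[of k b \<one> b'] assms by simp

lemma star_class_permute:
  assumes "n \<ge> 4" "k \<le> n" "basis b" "\<sigma> permutes {..<n}" "\<sigma> k = k'"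
  shows "star_class k (b \<circ> \<sigma>) = star_class k' b"
proof -
  have "k' \<le> n" using assms(2,4,5) permutes_in_image[OF assms(4), of k] permutes_not_in[OF assms(4), of k]
    by (cases "k < n") auto
  have "star_equiv k' b k (b \<circ> \<sigma>)"
    unfolding star_equiv_def
    by (rule exI[of _ \<sigma>], rule exI[of _ \<one>], rule exI[of _ "{}"])
      (use assms permutes_in_image[OF assms(4)] in \<open>simp add: partial_conj_def\<close>)
  then show ?thesis using star_class_eq_iff[OF assms(1) \<open>k' \<le> n\<close> assms(3)] by blast
qed

lemma star_class_partial_conj:
  assumes "n \<ge> 4" "i < n" "basis b"
  shows "star_class i (partial_conj i S b) = star_class i b"
proof -
  have "star_equiv i b i (partial_conj i S b)"
    unfolding star_equiv_def
    by (rule exI[of _ id], rule exI[of _ \<one>], rule exI[of _ S])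
      (use assms partial_conj_closed[of b i] in \<open>simp add: permutes_id\<close>)
  then have "star_class i b = star_class i (partial_conj i S b)" using star_class_eq_iff[of i b] assms by simp
  then show ?thesis by simp
qed

text \<open>Conjugating everything by \<open>b i\<close> fixes \<open>b i\<close> and exchanges the
  conjugated and the unconjugated ones among the other members.\<close>

lemma star_class_complement:
  assumes n: "n \<ge> 4" and i: "i < n" and b: "basis b" and k: "k \<le> n"
    and ST: "\<And>j. j < n \<Longrightarrow> j \<noteq> i \<Longrightarrow> j \<in> T \<longleftrightarrow> j \<notin> S"
  shows "star_class k (partial_conj i T b) = star_class k (partial_conj i S b)"
proof (rule star_class_conj[OF n k basis_partial_conj[OF b i], THEN HOL.sym, of "b i"])
  show "b i \<in> carrier G" using b i by simp
  have ii: "b i \<otimes> (b i \<otimes> g) = g" if "g \<in> carrier G" for g using b i that by (simp add: m_assoc[symmetric])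
  show "partial_conj i T b j = b i \<otimes> partial_conj i S b j \<otimes> inv b i" if "j < n" for j
    using b i that ST[OF that] ii by (auto simp: partial_conj_def m_assoc)
qed

section \<open>Exponent sums mod 2 as invariants of stars\<close>

definition parity_of :: "(nat \<Rightarrow> W_elt) \<Rightarrow> (nat \<Rightarrow> W_elt \<Rightarrow> bool) \<Rightarrow> bool" where
  "parity_of c par \<longleftrightarrow> (\<forall>m<n. (\<forall>g\<in>carrier G. \<forall>h\<in>carrier G. par m (g \<otimes> h) \<longleftrightarrow> par m g \<noteq> par m h) \<and>
    (\<forall>j<n. par m (c j) \<longleftrightarrow> j = m))"

lemma parity_exists:
  assumes "basis c"
  obtains par where "parity_of c par"
proof -
  have "\<exists>p. (\<forall>g\<in>carrier G. \<forall>h\<in>carrier G. p (g \<otimes> h) \<longleftrightarrow> p g \<noteq> p h) \<and> (\<forall>j<n. p (c j) \<longleftrightarrow> j = m)"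
    if "m < n" for m
    using basis_parity[OF assms that] by metis
  then have "\<exists>par. parity_of c par" unfolding parity_of_def by metis
  then show ?thesis using that by blast
qed

text \<open>\<open>S\<close> and its complement give the same star; this is the one of the two that
  avoids \<open>j\<close>.\<close>

definition normalized :: "nat \<Rightarrow> nat \<Rightarrow> nat set \<Rightarrow> nat set" where
  "normalized i j S = (if j \<in> S then {..<n} - {i} - S else S \<inter> ({..<n} - {i}))"

lemma normalized_subset: "normalized i j S \<subseteq> {..<n} - {i, j}"
  by (auto simp: normalized_def)

lemma mem_normalized: "l < n \<Longrightarrow> l \<noteq> i \<Longrightarrow> l \<in> normalized i j S \<longleftrightarrow> (l \<in> S \<longleftrightarrow> j \<notin> S)"
  by (simp add: normalized_def)

lemma star_class_normalized:
  assumes n: "n \<ge> 4" and i: "i < n" and b: "basis b" and k: "k \<le> n"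
  shows "star_class k (partial_conj i (normalized i j S) b) = star_class k (partial_conj i S b)"
proof (cases "j \<in> S")
  case True
  then show ?thesis by (intro star_class_complement[OF n i b k]) (simp add: mem_normalized)
next
  case False
  then show ?thesis
    by (intro star_class_cong[OF n k] basis_partial_conj b i) (auto simp: mem_normalized partial_conj_def)
qed

context
  fixes c :: "nat \<Rightarrow> W_elt" and par :: "nat \<Rightarrow> W_elt \<Rightarrow> bool"
  assumes c: "basis c" and par: "parity_of c par"
begin

lemma par_mult: "m < n \<Longrightarrow> g \<in> carrier G \<Longrightarrow> h \<in> carrier G \<Longrightarrow> par m (g \<otimes> h) \<longleftrightarrow> par m g \<noteq> par m h"
  and par_c: "m < n \<Longrightarrow> j < n \<Longrightarrow> par m (c j) \<longleftrightarrow> j = m"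
  using par by (auto simp: parity_of_def)

text \<open>\<open>twisted b a\<close> states that \<open>b l\<close> is the conjugate of \<open>c l\<close> by an element whose exponent sum in
  \<open>c m\<close>, taken mod 2, is \<open>a l m\<close>. This is well defined for \<open>l \<noteq> m\<close>, as the centralizer of \<open>c l\<close> is
  \<open>{\<one>, c l}\<close>.\<close>

definition twisted :: "(nat \<Rightarrow> W_elt) \<Rightarrow> (nat \<Rightarrow> nat \<Rightarrow> bool) \<Rightarrow> bool" where
  "twisted b a \<longleftrightarrow> (\<forall>l<n. \<exists>w\<in>carrier G. b l = w \<otimes> c l \<otimes> inv w \<and> (\<forall>m<n. par m w \<longleftrightarrow> a l m))"

lemma par_one: "m < n \<Longrightarrow> \<not> par m \<one>"
  using par_mult[of m \<one> \<one>] by simp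

lemma par_inv: "m < n \<Longrightarrow> g \<in> carrier G \<Longrightarrow> par m (inv g) \<longleftrightarrow> par m g"
  using par_mult[of m g "inv g"] par_one[of m] by auto

lemma twisted_self: "twisted c (\<lambda>_ _. False)"
  unfolding twisted_def using c par_one by (auto intro!: bexI[of _ \<one>])

lemma par_twisted: "twisted b a \<Longrightarrow> l < n \<Longrightarrow> m < n \<Longrightarrow> par m (b l) \<longleftrightarrow> l = m"
proof -
  assume "twisted b a" and l: "l < n" and m: "m < n"
  then obtain w where "w \<in> carrier G" "b l = w \<otimes> c l \<otimes> inv w" unfolding twisted_def by blast
  then show ?thesis using l m c by (cases "par m w") (simp_all add: par_mult par_inv par_c)
qed

text \<open>The conjugating element \<open>b i\<close> is a conjugate of \<open>c i\<close>, hence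
  odd in \<open>c i\<close> only. So the entries that change are those at \<open>(l, i)\<close> with
  \<open>l\<close> in \<open>S - {i}\<close>.\<close>

lemma twisted_partial_conj:
  assumes b: "basis b" "twisted b a" and i: "i < n"
  shows "twisted (partial_conj i S b) (\<lambda>l m. a l m \<noteq> (l \<in> S - {i} \<and> m = i))"
  unfolding twisted_def
proof (intro allI impI)
  fix l assume l: "l < n"
  then obtain w where w: "w \<in> carrier G" "b l = w \<otimes> c l \<otimes> inv w" "\<forall>m<n. par m w \<longleftrightarrow> a l m"
    using b(2) unfolding twisted_def by blast
  show "\<exists>w\<in>carrier G. partial_conj i S b l = w \<otimes> c l \<otimes> inv w \<and> (\<forall>m<n. par m w = (a l m \<noteq> (l \<in> S - {i} \<and> m = i)))"
  proof (cases "l \<in> S - {i}")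
    case True
    have "partial_conj i S b l = (b i \<otimes> w) \<otimes> c l \<otimes> inv (b i \<otimes> w)"
      using True w b(1) c i l by (simp add: partial_conj_def inv_mult_group m_assoc)
    moreover have "par m (b i \<otimes> w) = (a l m \<noteq> (m = i))" if "m < n" for m
      using w b i par_twisted[OF b(2) i that] that by (auto simp: par_mult)
    ultimately show ?thesis using True w(1) b(1) i by (intro bexI[of _ "b i \<otimes> w"]) simp_all
  next
    case False
    then show ?thesis using w by (intro bexI[of _ w]) (auto simp: partial_conj_def)
  qed
qed

text \<open>Conjugation by \<open>g\<close> flips the columns \<open>m\<close> in which
  \<open>g\<close> is odd as a whole. What survives are the differences of entries within a
  column.\<close>

lemma twisted_conj:
  assumes "twisted b a" "g \<in> carrier G" "\<forall>j<n. b' j = g \<otimes> b j \<otimes> inv g"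
  shows "twisted b' (\<lambda>l m. a l m \<noteq> par m g)"
  unfolding twisted_def
proof (intro allI impI)
  fix l assume l: "l < n"
  then obtain w where w: "w \<in> carrier G" "b l = w \<otimes> c l \<otimes> inv w" "\<forall>m<n. par m w \<longleftrightarrow> a l m"
    using assms(1) unfolding twisted_def by blast
  then show "\<exists>w\<in>carrier G. b' l = w \<otimes> c l \<otimes> inv w \<and> (\<forall>m<n. par m w = (a l m \<noteq> par m g))"
    using assms(2,3) c l by (intro bexI[of _ "g \<otimes> w"]) (auto simp: conj_conj par_mult)
qed

lemma twisted_unique:
  assumes "twisted b a" "twisted b a'" "l < n" "m < n" "l \<noteq> m"
  shows "a l m \<longleftrightarrow> a' l m"
proof -
  obtain w w' where w: "w \<in> carrier G" "b l = w \<otimes> c l \<otimes> inv w" "\<forall>m<n. par m w \<longleftrightarrow> a l m"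
    and w': "w' \<in> carrier G" "b l = w' \<otimes> c l \<otimes> inv w'" "\<forall>m<n. par m w' \<longleftrightarrow> a' l m"
    using assms(1-3) unfolding twisted_def by metis
  let ?g = "inv w' \<otimes> w"
  have cl: "c l \<in> carrier G" using c assms(3) by simp
  have "?g \<otimes> c l \<otimes> inv ?g = inv w' \<otimes> (w \<otimes> c l \<otimes> inv w) \<otimes> w'"
    using w w' cl by (simp add: inv_mult_group m_assoc)
  also have "\<dots> = inv w' \<otimes> (w' \<otimes> c l \<otimes> inv w') \<otimes> w'" using w(2) w'(2) by simp
  also have "\<dots> = c l" using w'(1) cl by (simp add: m_assoc) (simp add: m_assoc[symmetric])
  finally have eq: "?g \<otimes> c l \<otimes> inv ?g = c l" .
  have "?g \<otimes> c l = ?g \<otimes> c l \<otimes> inv ?g \<otimes> ?g" using w(1) w'(1) cl by (simp add: m_assoc)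
  then have "?g \<otimes> c l = c l \<otimes> ?g" unfolding eq .
  then have "?g = \<one> \<or> ?g = c l" using basis_centralizer[OF c] w w' assms(3) by simp
  then have "\<not> par m ?g" using par_one par_c assms(3-5) by auto
  then show ?thesis using w w' assms(4) by (simp add: par_mult par_inv)
qed

text \<open>The members with index \<open>j\<close> are odd in \<open>c j\<close> and even in the
  others, which conjugation preserves. So the permutation in \<open>star_equiv\<close> fixes every
  index.\<close>

lemma twisted_star_equiv:
  assumes b: "basis b" "twisted b a" and b': "twisted b' a'" and k: "k \<le> n" "k' \<le> n" and eq: "star_equiv k b k' b'"
  shows "k = k'" "\<exists>g\<in>carrier G. \<exists>T. (k = n \<longrightarrow> T = {}) \<and> (\<forall>j<n. b' j = g \<otimes> partial_conj k T b j \<otimes> inv g)"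
proof -
  obtain \<sigma> g T where s: "\<sigma> permutes {..<n}" "\<sigma> k' = k" "g \<in> carrier G" "k = n \<longrightarrow> T = {}"
    "\<And>j. j < n \<Longrightarrow> b' j = g \<otimes> partial_conj k T b (\<sigma> j) \<otimes> inv g"
    using eq unfolding star_equiv_def by blast
  have \<sigma>: "\<sigma> j = j" if j: "j < n" for j
  proof -
    have lt: "\<sigma> j < n" using permutes_in_image[OF s(1), of j] j by simp
    have "twisted (partial_conj k T b) (if k < n then (\<lambda>l m. a l m \<noteq> (l \<in> T - {k} \<and> m = k)) else a)"
      using twisted_partial_conj[OF b, of k T] s(4) k b(2) by (auto simp: partial_conj_def)
    then have "par j (partial_conj k T b (\<sigma> j)) \<longleftrightarrow> \<sigma> j = j" by (rule par_twisted[OF _ lt j])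
    moreover have "partial_conj k T b (\<sigma> j) \<in> carrier G"
      using partial_conj_closed[OF b(1) _ lt, of k T] s(4) k by (metis le_neq_implies_less)
    ultimately show ?thesis
      using par_twisted[OF b' j j] s(3) s(5)[OF j] j by (cases "par j g") (simp_all add: par_mult par_inv)
  qed
  show "k = k'" using \<sigma>[of k'] s(2) permutes_not_in[OF s(1), of k'] by (cases "k' < n") auto
  show "\<exists>g\<in>carrier G. \<exists>T. (k = n \<longrightarrow> T = {}) \<and> (\<forall>j<n. b' j = g \<otimes> partial_conj k T b j \<otimes> inv g)"
    using s(3-5) \<sigma> by auto
qed

end

lemma star_class_F_inject:
  assumes n: "n \<ge> 4" and b: "basis b" and k: "k \<le> n" "k' \<le> n" and eq: "star_class k b = star_class k' b"
  shows "k = k'"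
proof -
  obtain par where par: "parity_of b par" by (rule parity_exists[OF b])
  have "star_equiv k b k' b" using eq star_class_eq_iff[OF n k(1) b] by simp
  then show ?thesis
    using twisted_star_equiv(1)[OF b par b twisted_self[OF b par] twisted_self[OF b par] k] by blast
qed

section \<open>Stars at distance two and 8-cycles\<close>

lemma F_star_neighbour:
  assumes n: "n \<ge> 4" and c: "basis c" and d: "basis d" and i: "i < n"
    and e: "{star_class n d, star_class i c} \<in> L_edges n"
  shows "\<exists>T. star_class n d = star_class n (partial_conj i T c)"
proof -
  obtain j where j: "j < n" "star_class i c = star_class j d" using edge_iff[OF n d c i] e by blast
  then have "star_equiv i c j d" using star_class_eq_iff[OF n _ c, of i j d] i by simp
  then obtain \<sigma> g T where s: "\<sigma> permutes {..<n}" "g \<in> carrier G"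
    "\<And>j. j < n \<Longrightarrow> d j = g \<otimes> partial_conj i T c (\<sigma> j) \<otimes> inv g"
    unfolding star_equiv_def by blast
  \<comment> \<open>A {0}-star forgets order and simultaneous conjugation, so
    \<open>\<sigma>\<close> and \<open>g\<close> disappear and only \<open>T\<close> is
    left.\<close>
  have "\<sigma> n = n" using permutes_not_in[OF s(1)] by simp
  then have "star_equiv n (partial_conj i T c) n d"
    unfolding star_equiv_def
    using s by - (rule exI[of _ \<sigma>], rule exI[of _ g], rule exI[of _ "{}"], simp add: partial_conj_def[of n])
  then show ?thesis using star_class_eq_iff[OF n order.refl basis_partial_conj[OF c i]] by blast
qed

lemma F_star_neighbour_normalized:
  assumes n: "n \<ge> 4" and c: "basis c" and d: "basis d" and i: "i < n" and j: "j < n" "j \<noteq> i"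
    and e: "{star_class n d, star_class i c} \<in> L_edges n"
  shows "\<exists>T\<subseteq>{..<n} - {i, j}. star_class n d = star_class n (partial_conj i T c)"
proof -
  obtain T where T: "star_class n d = star_class n (partial_conj i T c)" using F_star_neighbour[OF n c d i e] by blast
  then show ?thesis
    using star_class_normalized[OF n i c order.refl, of j T] normalized_subset[of i j T] by metis
qed

lemma edge_partial_conj:
  assumes n: "n \<ge> 4" and c: "basis c" and i: "i < n"
  shows "{star_class n (partial_conj i T c), star_class i c} \<in> L_edges n"
  using edge_iff[OF n basis_partial_conj[OF c i] c i] star_class_partial_conj[OF n i c] i by metis

text \<open>Column \<open>i\<close> of the parities is the indicator of the set, up to a flip of the
  whole column. Both sets avoid \<open>j\<close>, which excludes the flip.\<close>

lemma star_class_partial_conj_inject: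
  assumes n: "n \<ge> 4" and c: "basis c" and i: "i < n" and j: "j < n" "j \<noteq> i"
    and S: "S \<subseteq> {..<n} - {i, j}" and T: "T \<subseteq> {..<n} - {i, j}"
    and eq: "star_class n (partial_conj i S c) = star_class n (partial_conj i T c)"
  shows "S = T"
proof -
  obtain par where par: "parity_of c par" by (rule parity_exists[OF c])
  note ctx = c par
  note tw = twisted_partial_conj[OF ctx c twisted_self[OF ctx] i]
  have "star_equiv n (partial_conj i S c) n (partial_conj i T c)"
    using eq star_class_eq_iff[OF n order.refl basis_partial_conj[OF c i]] by blast
  then obtain g where g: "g \<in> carrier G"
    "\<forall>j<n. partial_conj i T c j = g \<otimes> partial_conj n {} (partial_conj i S c) j \<otimes> inv g"
    using twisted_star_equiv(2)[OF ctx basis_partial_conj[OF c i] tw tw order.refl order.refl] by blast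
  then have g': "\<forall>j<n. partial_conj i T c j = g \<otimes> partial_conj i S c j \<otimes> inv g"
    by (simp add: partial_conj_def[of n])
  note eqs = twisted_unique[OF ctx twisted_conj[OF ctx tw g(1) g'] tw]
  have "\<not> par i g" using eqs[of j i] S T i j by auto
  then have "l \<in> S \<longleftrightarrow> l \<in> T" if "l < n" "l \<noteq> i" for l using eqs[OF that(1) i that(2)] that by auto
  then show ?thesis using S T by blast
qed

text \<open>The part of an 8-cycle through a star with neighbours \<open>y1\<close> and \<open>y2\<close> that lies beyond the
  vertices \<open>p\<close> and \<open>q\<close> following \<open>y1\<close> and \<open>y2\<close>.\<close>

definition far_side where
  "far_side y1 y2 p q y \<longleftrightarrow> (\<exists>z\<in>zero_stars n. \<exists>y'\<in>F_stars n. y \<in> F_stars n \<and>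
    {p, y} \<in> L_edges n \<and> {z, y} \<in> L_edges n \<and> {z, y'} \<in> L_edges n \<and> {q, y'} \<in> L_edges n \<and>
    y \<noteq> y1 \<and> y' \<noteq> y2 \<and> y \<noteq> y')"

lemma partial_conj_commute:
  assumes "i \<noteq> j" "j \<notin> S" "i \<notin> T" "S \<inter> T = {}"
  shows "partial_conj j T (partial_conj i S c) = partial_conj i S (partial_conj j T c)"
  using assms by (auto simp: partial_conj_def fun_eq_iff)

text \<open>For disjoint sets the two partial conjugations commute, so performing both closes the
  8-cycle. Parities show that the \<open>F\<close>-stars involved differ.\<close>

lemma far_side_exists:
  assumes n: "n \<ge> 4" and c: "basis c" and i: "i < n" and j: "j < n" "i \<noteq> j"
    and S: "S \<subseteq> {..<n} - {i, j}" and T: "T \<subseteq> {..<n} - {i, j}" and disj: "S \<inter> T = {}"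
  shows "far_side (star_class i c) (star_class j c) (star_class n (partial_conj i S c))
    (star_class n (partial_conj j T c)) (star_class j (partial_conj i S c))"
proof -
  have n3: "n \<ge> 3" using n by simp
  let ?P = "partial_conj i S c" and ?Q = "partial_conj j T c"
  have b: "basis ?P" "basis ?Q" "basis (partial_conj j T ?P)"
    using c i j by (simp_all add: basis_partial_conj)
  have comm: "partial_conj j T ?P = partial_conj i S ?Q"
    using partial_conj_commute[of i j S T] j S T disj by auto
  obtain par where par: "parity_of c par" by (rule parity_exists[OF c])
  note ctx = c par
  note twP = twisted_partial_conj[OF ctx c twisted_self[OF ctx] i, of S]
    and twQ = twisted_partial_conj[OF ctx c twisted_self[OF ctx] j(1), of T]
  have ne: "star_class j ?P \<noteq> star_class i c" "star_class i ?Q \<noteq> star_class j c" "star_class j ?P \<noteq> star_class i ?Q"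
  proof -
    show "star_class j ?P \<noteq> star_class i c"
      using twisted_star_equiv(1)[OF ctx b(1) twP twisted_self[OF ctx], of j i] star_class_eq_iff[OF n _ b(1), of j i c] i j by auto
    show "star_class i ?Q \<noteq> star_class j c"
      using twisted_star_equiv(1)[OF ctx b(2) twQ twisted_self[OF ctx], of i j] star_class_eq_iff[OF n _ b(2), of i j c] i j by auto
    show "star_class j ?P \<noteq> star_class i ?Q"
      using twisted_star_equiv(1)[OF ctx b(1) twP twQ, of j i] star_class_eq_iff[OF n _ b(1), of j i ?Q] i j by auto
  qed
  show ?thesis
    unfolding far_side_def
  proof (rule bexI[of _ "star_class n (partial_conj j T ?P)"], rule bexI[of _ "star_class i ?Q"], intro conjI)
    show "{star_class n ?P, star_class j ?P} \<in> L_edges n" using edge_iff[OF n b(1) b(1) j(1)] j by blast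
    show "{star_class n (partial_conj j T ?P), star_class j ?P} \<in> L_edges n" by (rule edge_partial_conj[OF n b(1) j(1)])
    show "{star_class n (partial_conj j T ?P), star_class i ?Q} \<in> L_edges n"
      unfolding comm by (rule edge_partial_conj[OF n b(2) i])
    show "{star_class n ?Q, star_class i ?Q} \<in> L_edges n" using edge_iff[OF n b(2) b(2) i] i by blast
  qed (use ne F_star_in_F[OF n3] zero_star_in_zero[OF n3] b i j in auto)
qed

text \<open>The star \<open>z\<close> is reached from \<open>?P\<close> by conjugation with the
  member \<open>j'\<close> and from \<open>?Q\<close> with the member \<open>i'\<close>. Comparing
  the columns \<open>i\<close> and \<open>j\<close> of the parities leaves only
  \<open>j' = j\<close> with the set \<open>T\<close> and \<open>i' = i\<close> with the set
  \<open>S\<close>. The conjugator between the two bases then commutes with \<open>c i\<close> and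
  \<open>c j\<close>, so it is trivial, and a common member of \<open>S\<close> and \<open>T\<close>
  would be conjugated in two orders that give different elements.\<close>

lemma far_side_disjoint:
  assumes n: "n \<ge> 4" and c: "basis c" and i: "i < n" and j: "j < n" "i \<noteq> j"
    and S: "S \<subseteq> {..<n} - {i, j}" "S \<noteq> {}" and T: "T \<subseteq> {..<n} - {i, j}" "T \<noteq> {}"
    and far: "far_side (star_class i c) (star_class j c) (star_class n (partial_conj i S c))
      (star_class n (partial_conj j T c)) y"
  shows "S \<inter> T = {}" "y = star_class j (partial_conj i S c)"
proof -
  have n3: "n \<ge> 3" using n by simp
  let ?P = "partial_conj i S c" and ?Q = "partial_conj j T c"
  have b: "basis ?P" "basis ?Q" using c i j by (simp_all add: basis_partial_conj)
  obtain z y' where z: "z \<in> zero_stars n" "y' \<in> F_stars n" "y \<in> F_stars n"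
    "{star_class n ?P, y} \<in> L_edges n" "{z, y} \<in> L_edges n" "{z, y'} \<in> L_edges n" "{star_class n ?Q, y'} \<in> L_edges n"
    "y \<noteq> star_class i c" "y' \<noteq> star_class j c" "y \<noteq> y'"
    using far unfolding far_side_def by blast
  obtain d where d: "basis d" "z = star_class n d" using z(1) zero_stars_eq[OF n3] by blast
  have F_neighbour: "\<exists>k<n. y = star_class k b" if "basis b" "y \<in> F_stars n" "{star_class n b, y} \<in> L_edges n" for b y
  proof -
    obtain k b' where "k < n" "basis b'" "y = star_class k b'" using \<open>y \<in> F_stars n\<close> F_stars_eq[OF n3] by blast
    then show ?thesis using edge_iff[OF n that(1), of b' k] that(3) by blast
  qed
  obtain j' where j': "j' < n" "y = star_class j' ?P"
    using F_neighbour[OF b(1) z(3,4)] by blast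
  obtain i' where i': "i' < n" "y' = star_class i' ?Q"
    using F_neighbour[OF b(2) z(2,7)] by blast
  have j'i: "j' \<noteq> i" using z(8) j'(2) star_class_partial_conj[OF n i c] by auto
  have i'j: "i' \<noteq> j" using z(9) i'(2) star_class_partial_conj[OF n j(1) c] by auto
  obtain T' where T': "T' \<subseteq> {..<n} - {j', i}" "star_class n d = star_class n (partial_conj j' T' ?P)"
    using F_star_neighbour_normalized[OF n b(1) d(1) j'(1) i] z(5) j'(2) d(2) j'i by metis
  obtain S' where S': "S' \<subseteq> {..<n} - {i', j}" "star_class n d = star_class n (partial_conj i' S' ?Q)"
    using F_star_neighbour_normalized[OF n b(2) d(1) i'(1) j(1)] z(6) i'(2) d(2) i'j by metis
  let ?D = "partial_conj j' T' ?P" and ?D' = "partial_conj i' S' ?Q"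
  have bD: "basis ?D" "basis ?D'" using b i' j' by (simp_all add: basis_partial_conj)
  obtain par where par: "parity_of c par" by (rule parity_exists[OF c])
  note ctx = c par
  note twD = twisted_partial_conj[OF ctx b(1) twisted_partial_conj[OF ctx c twisted_self[OF ctx] i, of S] j'(1), of T']
    and twD' = twisted_partial_conj[OF ctx b(2) twisted_partial_conj[OF ctx c twisted_self[OF ctx] j(1), of T] i'(1), of S']
  have "star_equiv n ?D n ?D'"
    using T'(2) S'(2) star_class_eq_iff[OF n order.refl bD(1)] by metis
  then obtain g where g: "g \<in> carrier G" "\<forall>j<n. ?D' j = g \<otimes> partial_conj n {} ?D j \<otimes> inv g"
    using twisted_star_equiv(2)[OF ctx bD(1) twD twD' order.refl order.refl] by blast
  then have g'_all: "\<forall>j<n. ?D' j = g \<otimes> ?D j \<otimes> inv g"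
    by (simp add: partial_conj_def[of n])
  then have g': "?D' j = g \<otimes> ?D j \<otimes> inv g" if "j < n" for j using that by blast
  note eqs = twisted_unique[OF ctx twisted_conj[OF ctx twD g(1) g'_all] twD']
  \<comment> \<open>Otherwise \<open>y\<close> and \<open>y'\<close> would distinguish the same
    member of the basis of \<open>z\<close>, and they would coincide.\<close>
  have i'j': "i' \<noteq> j'"
  proof
    assume same: "i' = j'"
    have "y = star_class j' ?D" using j' star_class_partial_conj[OF n j'(1) b(1)] by simp
    also have "\<dots> = star_class j' ?D'" by (rule star_class_conj[OF n _ bD(1) g(1) g']) (use j' in simp_all)
    also have "\<dots> = y'" using i' same star_class_partial_conj[OF n i'(1) b(2)] by simp
    finally show False using z(10) by simp
  qed
  \<comment> \<open>If not, column \<open>j\<close> vanishes for \<open>?D\<close> and is the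
    indicator of \<open>T\<close> for \<open>?D'\<close>. The entry at \<open>i\<close> shows that
    \<open>g\<close> is even in \<open>c j\<close>, so \<open>T\<close> would be empty. The argument
    for \<open>i'\<close> is symmetric.\<close>
  have "j' = j"
  proof (rule ccontr)
    assume ne: "j' \<noteq> j"
    have "\<not> par j g" using eqs[of i j] i j i'j ne T by auto
    then have "l \<notin> T" if "l < n" "l \<noteq> j" for l using eqs[of l j] that i j i'j ne by auto
    then show False using T by blast
  qed
  have "i' = i"
  proof (rule ccontr)
    assume ne: "i' \<noteq> i"
    have "\<not> par i g" using eqs[of j i] i j j'i ne S by auto
    then have "l \<notin> S" if "l < n" "l \<noteq> i" for l using eqs[of l i] that i j j'i ne by auto
    then show False using S by blast
  qed
  note [simp] = \<open>j' = j\<close> \<open>i' = i\<close>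
  show "y = star_class j ?P" using j' by simp
  have "\<not> par j g" using eqs[of i j] i j T T' by auto
  then have "l \<in> T' \<longleftrightarrow> l \<in> T" if "l < n" "l \<noteq> j" for l using eqs[of l j] that i j by auto
  then have T'T: "T' = T" using T T' by auto
  have "\<not> par i g" using eqs[of j i] i j S S' by auto
  then have "l \<in> S' \<longleftrightarrow> l \<in> S" if "l < n" "l \<noteq> i" for l using eqs[of l i] that i j by auto
  then have S'S: "S' = S" using S S' by auto
  have sub: "i \<notin> S" "j \<notin> S" "i \<notin> T" "j \<notin> T" using S T by auto
  have gi: "c i = g \<otimes> c i \<otimes> inv g"
    using g'[OF i] sub j(2) by (simp add: T'T S'S partial_conj_def)
  have gj: "c j = g \<otimes> c j \<otimes> inv g"
    using g'[OF j(1)] sub j(2) by (simp add: T'T S'S partial_conj_def)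
  have comm: "g \<otimes> c l = c l \<otimes> g" if "c l = g \<otimes> c l \<otimes> inv g" "l < n" for l
  proof -
    have "g \<otimes> c l = (g \<otimes> c l \<otimes> inv g) \<otimes> g" using g(1) c that(2) by (simp add: m_assoc)
    then show ?thesis using that(1) by simp
  qed
  have g1: "g = \<one>" using basis_centralizer2[OF c g(1) i j(1) j(2)] comm gi gj i j by blast
  show "S \<inter> T = {}"
  proof (rule ccontr)
    assume "S \<inter> T \<noteq> {}"
    then obtain l where l: "l \<in> S" "l \<in> T" "l < n" "l \<noteq> i" "l \<noteq> j" using S by auto
    have "?D l = c j \<otimes> (c i \<otimes> c l \<otimes> c i) \<otimes> c j" "?D' l = c i \<otimes> (c j \<otimes> c l \<otimes> c j) \<otimes> c i"
      using l S T j by (auto simp: T'T S'S partial_conj_def)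
    then show False
      using g'[OF l(3)] g1 basis_not_commuting[OF c i j(1) l(3) j(2)] l c i j by simp
  qed
qed

end

section \<open>Automorphisms of L\<close>

locale star_graph_automorphism = universal_coxeter +
  fixes f :: "marked_gog set \<Rightarrow> marked_gog set"
  assumes n: "n \<ge> 4" and f_aut: "graph_automorphism (L_verts n) (L_edges n) f"
    and f_zero: "f ` zero_stars n = zero_stars n" and f_F: "f ` F_stars n = F_stars n"
begin

lemma n3: "n \<ge> 3"
  using n by simp

lemma f_zero_preimage: "z \<in> zero_stars n \<Longrightarrow> \<exists>z0\<in>zero_stars n. z = f z0"
  and f_F_preimage: "y \<in> F_stars n \<Longrightarrow> \<exists>y0\<in>F_stars n. y = f y0"
  using f_zero f_F by (metis imageE)+

lemma f_inj: "y \<in> L_verts n \<Longrightarrow> z \<in> L_verts n \<Longrightarrow> f y = f z \<longleftrightarrow> y = z"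
  using f_aut by (auto simp: graph_automorphism_def bij_betw_def inj_on_def)

lemma f_edge: "y \<in> L_verts n \<Longrightarrow> z \<in> L_verts n \<Longrightarrow> {f y, f z} \<in> L_edges n \<longleftrightarrow> {y, z} \<in> L_edges n"
  using f_aut by (auto simp: graph_automorphism_def)

lemma star_L [simp]: "basis b \<Longrightarrow> k \<le> n \<Longrightarrow> star_class k b \<in> L_verts n"
  using zero_star_in_zero[OF n3] F_star_in_F[OF n3] by (cases "k = n") (auto simp: L_verts_def)

lemma f_far_side:
  assumes "y1 \<in> F_stars n" "y2 \<in> F_stars n" "p \<in> zero_stars n" "q \<in> zero_stars n"
    "far_side y1 y2 p q y"
  shows "far_side (f y1) (f y2) (f p) (f q) (f y)"
proof -
  have L: "zero_stars n \<subseteq> L_verts n" "F_stars n \<subseteq> L_verts n" by (auto simp: L_verts_def)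
  obtain z y' where z: "z \<in> zero_stars n" "y' \<in> F_stars n" "y \<in> F_stars n"
    "{p, y} \<in> L_edges n" "{z, y} \<in> L_edges n" "{z, y'} \<in> L_edges n" "{q, y'} \<in> L_edges n"
    "y \<noteq> y1" "y' \<noteq> y2" "y \<noteq> y'"
    using assms(5) unfolding far_side_def by blast
  note mem = z(1-3) assms(1-4)
  have "f z \<in> zero_stars n" "f y' \<in> F_stars n" "f y \<in> F_stars n"
    using f_zero f_F z(1-3) by blast+
  moreover have "{f p, f y} \<in> L_edges n" "{f z, f y} \<in> L_edges n" "{f z, f y'} \<in> L_edges n" "{f q, f y'} \<in> L_edges n"
    "f y \<noteq> f y1" "f y' \<noteq> f y2" "f y \<noteq> f y'"
    using z(4-) mem L by (simp_all add: f_edge f_inj subset_iff)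
  ultimately show ?thesis unfolding far_side_def by blast
qed

lemma f_far_side_reverse:
  assumes "y1 \<in> F_stars n" "y2 \<in> F_stars n" "p \<in> zero_stars n" "q \<in> zero_stars n"
    "far_side (f y1) (f y2) (f p) (f q) y"
  shows "\<exists>y. far_side y1 y2 p q y"
proof -
  have L: "zero_stars n \<subseteq> L_verts n" "F_stars n \<subseteq> L_verts n" by (auto simp: L_verts_def)
  obtain z y' where z: "z \<in> zero_stars n" "y' \<in> F_stars n" "y \<in> F_stars n"
    "{f p, y} \<in> L_edges n" "{z, y} \<in> L_edges n" "{z, y'} \<in> L_edges n" "{f q, y'} \<in> L_edges n"
    "y \<noteq> f y1" "y' \<noteq> f y2" "y \<noteq> y'"
    using assms(5) unfolding far_side_def by blast
  obtain z0 y0 y0' where z0: "z0 \<in> zero_stars n" "z = f z0" "y0 \<in> F_stars n" "y = f y0" "y0' \<in> F_stars n" "y' = f y0'"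
    using z(1-3) f_zero_preimage f_F_preimage by metis
  have "{p, y0} \<in> L_edges n" "{z0, y0} \<in> L_edges n" "{z0, y0'} \<in> L_edges n" "{q, y0'} \<in> L_edges n"
    "y0 \<noteq> y1" "y0' \<noteq> y2" "y0 \<noteq> y0'"
    using z(4-) z0 assms(1-4) L by (auto simp: f_edge subset_iff)
  then show ?thesis unfolding far_side_def using z0 by blast
qed

text \<open>Instead of composing \<open>f\<close> with an outer automorphism so as to fix a star,
  \<open>f\<close> is compared with a second basis \<open>c'\<close> whose stars are the images,
  index by index. This relation is then propagated along partial conjugations.\<close>

definition matched :: "(nat \<Rightarrow> W_elt) \<Rightarrow> (nat \<Rightarrow> W_elt) \<Rightarrow> bool" where
  "matched c c' \<longleftrightarrow> basis c \<and> basis c' \<and> (\<forall>k\<le>n. f (star_class k c) = star_class k c')"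

context
  fixes c c'
  assumes m: "matched c c'"
begin

lemma matched_basis [simp]: "basis c" and matched_basis' [simp]: "basis c'"
  and f_matched: "k \<le> n \<Longrightarrow> f (star_class k c) = star_class k c'"
  using m by (auto simp: matched_def)

lemma f_neighbour:
  assumes i: "i < n" and j: "j < n" "j \<noteq> i"
  shows "\<exists>S'\<subseteq>{..<n} - {i, j}. f (star_class n (partial_conj i S c)) = star_class n (partial_conj i S' c')"
proof -
  have b: "basis (partial_conj i S c)" by (rule basis_partial_conj[OF matched_basis i])
  have "f (star_class n (partial_conj i S c)) \<in> zero_stars n"
    using zero_star_in_zero[OF n3 b] f_zero by blast
  then obtain d where d: "basis d" "f (star_class n (partial_conj i S c)) = star_class n d"
    using zero_stars_eq[OF n3] by blast
  have "{f (star_class n (partial_conj i S c)), f (star_class i c)} \<in> L_edges n"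
    using f_edge[of "star_class n (partial_conj i S c)" "star_class i c"] edge_partial_conj[OF n matched_basis i] b i by simp
  then have "{star_class n d, star_class i c'} \<in> L_edges n" using d(2) f_matched i by simp
  then show ?thesis using F_star_neighbour_normalized[OF n matched_basis' d(1) i j] d(2) by auto
qed

text \<open>Every label occurs among the images; \<open>f_full\<close> needs this for a
  singleton.\<close>

lemma f_neighbour_surj:
  assumes i: "i < n" and j: "j < n" "j \<noteq> i"
  shows "\<exists>S\<subseteq>{..<n} - {i, j}. f (star_class n (partial_conj i S c)) = star_class n (partial_conj i S' c')"
proof -
  have b: "basis (partial_conj i S' c')" by (rule basis_partial_conj[OF matched_basis' i])
  obtain d where d: "basis d" "star_class n (partial_conj i S' c') = f (star_class n d)"
  proof -
    obtain z0 where z0: "z0 \<in> zero_stars n" "star_class n (partial_conj i S' c') = f z0"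
      using f_zero_preimage[OF zero_star_in_zero[OF n3 b]] by blast
    then obtain d where "basis d" "z0 = star_class n d" using zero_stars_eq[OF n3] by blast
    then show ?thesis using that z0(2) by blast
  qed
  have "{f (star_class n d), f (star_class i c)} \<in> L_edges n"
    using edge_partial_conj[OF n matched_basis' i, of S'] d(2) f_matched[of i] i by simp
  then have "{star_class n d, star_class i c} \<in> L_edges n"
    using f_edge[of "star_class n d" "star_class i c"] d(1) i by simp
  then show ?thesis using F_star_neighbour_normalized[OF n matched_basis d(1) i j] d(2) by metis
qed

lemma partial_conj_empty: "partial_conj i {} b = b"
  by (simp add: partial_conj_def)

lemma f_neighbour_empty:
  assumes i: "i < n" and j: "j < n" "j \<noteq> i" and S: "S \<subseteq> {..<n} - {i, j}" "S' \<subseteq> {..<n} - {i, j}"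
    and eq: "f (star_class n (partial_conj i S c)) = star_class n (partial_conj i S' c')"
  shows "S = {} \<longleftrightarrow> S' = {}"
proof
  assume "S = {}"
  then have "star_class n (partial_conj i S' c') = star_class n (partial_conj i {} c')"
    using eq f_matched[of n] by (simp add: partial_conj_empty)
  then show "S' = {}" using star_class_partial_conj_inject[OF n matched_basis' i j S(2), of "{}"] by simp
next
  assume "S' = {}"
  then have "f (star_class n (partial_conj i S c)) = f (star_class n (partial_conj i {} c))"
    using eq f_matched[of n] by (simp add: partial_conj_empty)
  then have "star_class n (partial_conj i S c) = star_class n (partial_conj i {} c)"
    using f_inj basis_partial_conj[OF matched_basis i] by simp
  then show "S = {}" using star_class_partial_conj_inject[OF n matched_basis i j S(1), of "{}"] by simp
qed

text \<open>The far side of an 8-cycle is transported by \<open>f\<close> in one direction and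
  pulled back in the other. \<open>f_neighbour_empty\<close> keeps the sets nonempty, as
  \<open>far_side_disjoint\<close> demands.\<close>

lemma f_disjoint_iff:
  assumes i: "i < n" and j: "j < n" "i \<noteq> j"
    and S: "S \<subseteq> {..<n} - {i, j}" "S \<noteq> {}" and T: "T \<subseteq> {..<n} - {i, j}" "T \<noteq> {}"
    and S': "S' \<subseteq> {..<n} - {i, j}" and T': "T' \<subseteq> {..<n} - {i, j}"
    and fS: "f (star_class n (partial_conj i S c)) = star_class n (partial_conj i S' c')"
    and fT: "f (star_class n (partial_conj j T c)) = star_class n (partial_conj j T' c')"
  shows "S \<inter> T = {} \<longleftrightarrow> S' \<inter> T' = {}"
proof -
  have ji: "{..<n} - {j, i} = {..<n} - {i, j}" by auto
  have ne: "S' \<noteq> {}" "T' \<noteq> {}"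
    using f_neighbour_empty[OF i j(1) _ S(1) S' fS] f_neighbour_empty[OF j(1) i j(2), of T T'] S T T' fT j ji by auto
  have mem: "star_class i c \<in> F_stars n" "star_class j c \<in> F_stars n"
    "star_class n (partial_conj i S c) \<in> zero_stars n" "star_class n (partial_conj j T c) \<in> zero_stars n"
    using F_star_in_F[OF n3] zero_star_in_zero[OF n3] i j basis_partial_conj by simp_all
  have fi: "f (star_class i c) = star_class i c'" "f (star_class j c) = star_class j c'" using f_matched i j by simp_all
  show ?thesis
  proof
    assume "S \<inter> T = {}"
    from f_far_side[OF mem far_side_exists[OF n matched_basis i j S(1) T(1) this]]
    show "S' \<inter> T' = {}"
      unfolding fi fS fT by (rule far_side_disjoint(1)[OF n matched_basis' i j S' ne(1) T' ne(2)])
  next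
    assume "S' \<inter> T' = {}"
    from far_side_exists[OF n matched_basis' i j S' T' this] obtain y where "far_side (star_class i c) (star_class j c)
        (star_class n (partial_conj i S c)) (star_class n (partial_conj j T c)) y"
      using f_far_side_reverse[OF mem] unfolding fi fS fT by blast
    then show "S \<inter> T = {}" by (rule far_side_disjoint(1)[OF n matched_basis i j S T])
  qed
qed

text \<open>The full set is the only one that meets every nonempty set. If \<open>S'\<close> omitted
  \<open>k\<close>, it would be disjoint from the label \<open>(j, {k})\<close>, whose preimage has
  a nonempty set \<open>T\<close> that meets the full set.\<close>

lemma f_full:
  assumes i: "i < n" and j: "j < n" "j \<noteq> i"
  shows "f (star_class n (partial_conj i ({..<n} - {i, j}) c)) = star_class n (partial_conj i ({..<n} - {i, j}) c')"
proof -
  let ?S = "{..<n} - {i, j}"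
  have "card ?S \<ge> n - 2" using card_Diff_subset[of "{i, j}" "{..<n}"] i j by (simp add: card_insert_if)
  then have ne: "?S \<noteq> {}" using n by (intro notI) simp
  obtain S' where S': "S' \<subseteq> ?S" "f (star_class n (partial_conj i ?S c)) = star_class n (partial_conj i S' c')"
    using f_neighbour[OF i j, of ?S] by blast
  have "S' = ?S"
  proof (rule ccontr)
    assume "S' \<noteq> ?S"
    then obtain k where k: "k \<in> ?S" "k \<notin> S'" using S' by blast
    obtain T where T: "T \<subseteq> {..<n} - {j, i}" "f (star_class n (partial_conj j T c)) = star_class n (partial_conj j {k} c')"
      using f_neighbour_surj[OF j(1) i j(2)[symmetric], of "{k}"] by blast
    have T_ne: "T \<noteq> {}" using f_neighbour_empty[OF j(1) i j(2)[symmetric] T(1) _ T(2)] k by auto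
    have T': "T \<subseteq> ?S" using T(1) by auto
    have "?S \<inter> T = {} \<longleftrightarrow> S' \<inter> {k} = {}"
      by (rule f_disjoint_iff[OF i j(1) j(2)[symmetric] _ ne T' T_ne S'(1) _ S'(2) T(2)]) (use k in auto)
    then show False using k T' T_ne by auto
  qed
  then show ?thesis using S'(2) by simp
qed

text \<open>The complement of the full set in \<open>{..<n} - {i}\<close> is \<open>{j}\<close>, so
  both sets give the same star. Singletons are the probes for all other sets.\<close>

lemma f_singleton:
  assumes i: "i < n" and j: "j < n" "j \<noteq> i"
  shows "f (star_class n (partial_conj i {j} c)) = star_class n (partial_conj i {j} c')"
proof -
  have "star_class n (partial_conj i {j} b) = star_class n (partial_conj i ({..<n} - {i, j}) b)" if "basis b" for b
    by (rule star_class_complement[OF n i that order.refl]) (use j in auto)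
  then show ?thesis using f_full[OF i j] by simp
qed

text \<open>The labels \<open>(j, {k})\<close> are preserved by \<open>f_singleton\<close>, and
  disjointness from \<open>{k}\<close> decides whether \<open>k\<close> is a member.\<close>

lemma f_partial_conj_normalized:
  assumes i: "i < n" and j: "j < n" "j \<noteq> i" and S: "S \<subseteq> {..<n} - {i, j}"
  shows "f (star_class n (partial_conj i S c)) = star_class n (partial_conj i S c')"
proof (cases "S = {}")
  case True
  then show ?thesis using f_matched[of n] by (simp add: partial_conj_empty)
next
  case False
  obtain S' where S': "S' \<subseteq> {..<n} - {i, j}" "f (star_class n (partial_conj i S c)) = star_class n (partial_conj i S' c')"
    using f_neighbour[OF i j, of S] by blast
  have "k \<in> S \<longleftrightarrow> k \<in> S'" if k: "k \<in> {..<n} - {i, j}" for k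
  proof -
    have "S \<inter> {k} = {} \<longleftrightarrow> S' \<inter> {k} = {}"
      by (rule f_disjoint_iff[OF i j(1) j(2)[symmetric] S False _ _ S'(1) _ S'(2) f_singleton[OF j(1)]]) (use k in auto)
    then show ?thesis by auto
  qed
  then have "S = S'" using S S'(1) by blast
  then show ?thesis using S'(2) by simp
qed

text \<open>For a neighbour \<open>j \<noteq> i\<close>, an 8-cycle through \<open>(i, S')\<close>
  and \<open>(j, T)\<close> with \<open>T\<close> disjoint from \<open>S'\<close> singles out the
  \<open>F\<close>-star and hence its image. If \<open>S'\<close> is full, there is no room for
  \<open>T\<close>; this happens for at most one \<open>j\<close>, where injectivity of
  \<open>f\<close> decides.\<close>

lemma matched_partial_conj:
  assumes i: "i < n"
  shows "matched (partial_conj i S c) (partial_conj i S c')"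
proof -
  let ?P = "partial_conj i S c" and ?P' = "partial_conj i S c'"
  have b: "basis ?P" "basis ?P'" by (simp_all add: basis_partial_conj i)
  have zero: "f (star_class n ?P) = star_class n ?P'"
  proof -
    obtain j where j: "j < n" "j \<noteq> i" using n by (metis le_less_linear less_le_trans nat_neq_iff numeral_le_one_iff
      not_numeral_le_zero less_one semiring_norm(69))
    show ?thesis
      using f_partial_conj_normalized[OF i j normalized_subset[of i j S]]
        star_class_normalized[OF n i matched_basis order.refl, of j S] star_class_normalized[OF n i matched_basis' order.refl, of j S]
      by simp
  qed
  have centre: "f (star_class i ?P) = star_class i ?P'"
    using star_class_partial_conj[OF n i matched_basis] star_class_partial_conj[OF n i matched_basis'] f_matched i by simp
  have generic: "f (star_class j ?P) = star_class j ?P'"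
    if j: "j < n" "j \<noteq> i" and ex: "normalized i j S \<noteq> {..<n} - {i, j}" for j
  proof -
    define S' where "S' = normalized i j S"
    have S': "S' \<subseteq> {..<n} - {i, j}" unfolding S'_def by (rule normalized_subset)
    have eq: "star_class j ?P = star_class j (partial_conj i S' c)" "star_class j ?P' = star_class j (partial_conj i S' c')"
      using star_class_normalized[OF n i, of _ j j S] j by (simp_all add: S'_def)
    show ?thesis
    proof (cases "S' = {}")
      case True
      then show ?thesis unfolding eq using f_matched j by (simp add: partial_conj_empty)
    next
      case False
      define T where "T = {..<n} - {i, j} - S'"
      have T: "T \<subseteq> {..<n} - {i, j}" "T \<noteq> {}" "S' \<inter> T = {}" using S' ex by (auto simp: T_def S'_def)
      have T2: "T \<subseteq> {..<n} - {j, i}" using T(1) by auto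
      have mem: "star_class i c \<in> F_stars n" "star_class j c \<in> F_stars n"
        "star_class n (partial_conj i S' c) \<in> zero_stars n" "star_class n (partial_conj j T c) \<in> zero_stars n"
        using F_star_in_F[OF n3] zero_star_in_zero[OF n3] i j basis_partial_conj by simp_all
      have fi: "f (star_class i c) = star_class i c'" "f (star_class j c) = star_class j c'" using f_matched i j by simp_all
      from f_far_side[OF mem far_side_exists[OF n matched_basis i j(1) j(2)[symmetric] S' T(1,3)]]
      show ?thesis
        unfolding eq fi f_partial_conj_normalized[OF i j S'] f_partial_conj_normalized[OF j(1) i j(2)[symmetric] T2]
        by (rule far_side_disjoint(2)[OF n matched_basis' i j(1) j(2)[symmetric] S' False T(1,2)])
    qed
  qed
  \<comment> \<open>The image of the \<open>j\<close>-th neighbour is some neighbour of the star of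
    \<open>?P'\<close>. If all neighbours but the \<open>j\<close>-th are matched, injectivity
    leaves only the \<open>j\<close>-th for it.\<close>
  have F: "f (star_class j ?P) = star_class j ?P'" if j: "j < n" for j
  proof (rule ccontr)
    assume no: "f (star_class j ?P) \<noteq> star_class j ?P'"
    have ji: "j \<noteq> i" using no centre by auto
    have exj: "normalized i j S = {..<n} - {i, j}"
      using generic[OF j ji] no by blast
    have others: "f (star_class k ?P) = star_class k ?P'" if k: "k < n" "k \<noteq> j" for k
    proof (cases "k = i")
      case False
      have "normalized i k S \<noteq> {..<n} - {i, k}"
      proof
        assume exk: "normalized i k S = {..<n} - {i, k}"
        \<comment> \<open>If the sets for \<open>j\<close> and \<open>k\<close> are both full,
          \<open>S\<close> separates each of \<open>j\<close> and \<open>k\<close> from all other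
          indices apart from \<open>i\<close>. A fourth index \<open>l\<close> would then be
          opposite to \<open>j\<close> and to \<open>k\<close>, which are opposite to each
          other.\<close>
        obtain l where l: "l < n" "l \<noteq> i" "l \<noteq> j" "l \<noteq> k"
        proof -
          have "card {i, j, k} \<le> 3" by (simp add: card_insert_if)
          then have "\<not> {..<n} \<subseteq> {i, j, k}" using n card_mono[of "{i, j, k}" "{..<n}"] by auto
          then show ?thesis using that by blast
        qed
        have j_mem: "w \<in> S \<longleftrightarrow> j \<notin> S" if "w \<in> {..<n} - {i, j}" for w
          using exj that mem_normalized[of w i j S] by simp
        have k_mem: "w \<in> S \<longleftrightarrow> k \<notin> S" if "w \<in> {..<n} - {i, k}" for w
          using exk that mem_normalized[of w i k S] by simp
        show False using j_mem[of l] j_mem[of k] k_mem[of l] l k False by simp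
      qed
      then show ?thesis using generic[OF k(1) False] by blast
    qed (use centre in simp)
    have "f (star_class j ?P) \<in> F_stars n" using F_star_in_F[OF n3 j b(1)] f_F by blast
    then obtain k0 b0 where kb: "k0 < n" "basis b0" "f (star_class j ?P) = star_class k0 b0" using F_stars_eq[OF n3] by blast
    have "{star_class n ?P, star_class j ?P} \<in> L_edges n" using edge_iff[OF n b(1) b(1) j] j by blast
    then have "{star_class n ?P', star_class k0 b0} \<in> L_edges n"
      using f_edge[of "star_class n ?P" "star_class j ?P"] b j zero kb(3) by simp
    then obtain k where k: "k < n" "f (star_class j ?P) = star_class k ?P'"
      using edge_iff[OF n b(2) kb(2,1)] kb(3) by auto
    then have "k \<noteq> j" using no by auto
    then have "f (star_class j ?P) = f (star_class k ?P)" using k others by simp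
    then have "star_class j ?P = star_class k ?P" using f_inj b(1) j k by simp
    then show False using star_class_F_inject[OF n b(1)] j k \<open>k \<noteq> j\<close> by auto
  qed
  show ?thesis unfolding matched_def using b zero F by (metis le_neq_implies_less)
qed

end

lemma matched_cong:
  assumes "matched c c'" "\<And>j. j < n \<Longrightarrow> d j = c j" "\<And>j. j < n \<Longrightarrow> d' j = c' j"
  shows "matched d d'"
  using assms star_class_cong[OF n] basis_cong unfolding matched_def by metis

text \<open>Automorphisms commute with partial conjugation, so the matching spreads from the
  standard basis along the moves.\<close>

lemma matched_connected:
  assumes \<psi>: "\<psi> \<in> iso G G" and base: "matched x (\<psi> \<circ> x)"
  shows "connected_to_x d \<Longrightarrow> matched d (\<psi> \<circ> d)"
proof (induction rule: connected_to_x.induct)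
  case (start b)
  show ?case by (rule matched_cong[OF base]) (use start in simp_all)
next
  case (move b i b' S)
  have hom: "\<psi> \<in> hom G G" using \<psi> by (simp add: iso_def)
  have b: "basis b" using move.IH unfolding matched_def by blast
  have "(\<psi> \<circ> b') j = partial_conj i S (\<psi> \<circ> b) j" if "j < n" for j
    using that move.hyps b hom_mult[OF hom] by (simp add: partial_conj_def)
  then show ?case
    using matched_cong[OF matched_partial_conj[OF move.IH move.hyps(2), of S], of b' "\<psi> \<circ> b'"] move.hyps(3) by blast
qed

text \<open>\<open>f\<close> sends the {0}-star of \<open>x\<close> to that of some basis
  \<open>d\<close>, and its neighbours to those of \<open>d\<close> in an order given by
  \<open>\<tau>\<close>. Reordering \<open>d\<close> accordingly makes the indices agree.\<close>

lemma base_matched: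
  obtains \<psi> where "\<psi> \<in> iso G G" "matched x (\<psi> \<circ> x)"
proof -
  have "f (star_class n x) \<in> zero_stars n" using zero_star_in_zero[OF n3 basis_x] f_zero by blast
  then obtain d where d: "basis d" "f (star_class n x) = star_class n d" using zero_stars_eq[OF n3] by blast
  have "\<exists>k<n. f (star_class i x) = star_class k d" if i: "i < n" for i
  proof -
    have "f (star_class i x) \<in> F_stars n" using F_star_in_F[OF n3 i basis_x] f_F by blast
    then obtain k0 b0 where kb: "k0 < n" "basis b0" "f (star_class i x) = star_class k0 b0" using F_stars_eq[OF n3] by blast
    have "{star_class n x, star_class i x} \<in> L_edges n" using edge_iff[OF n basis_x basis_x i] i by blast
    then have "{star_class n d, star_class k0 b0} \<in> L_edges n"
      using f_edge[of "star_class n x" "star_class i x"] basis_x i d(2) kb(3) by simp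
    then show ?thesis using edge_iff[OF n d(1) kb(2,1)] kb(3) by auto
  qed
  then obtain \<tau> where \<tau>: "\<And>i. i < n \<Longrightarrow> \<tau> i < n \<and> f (star_class i x) = star_class (\<tau> i) d" by metis
  define \<sigma> where "\<sigma> i = (if i < n then \<tau> i else i)" for i
  have "inj_on \<sigma> {..<n}"
  proof (rule inj_onI)
    fix i j assume ij: "i \<in> {..<n}" "j \<in> {..<n}" "\<sigma> i = \<sigma> j"
    then have "f (star_class i x) = f (star_class j x)" using \<tau>[of i] \<tau>[of j] by (simp add: \<sigma>_def)
    then have "star_class i x = star_class j x" using f_inj basis_x ij by simp
    then show "i = j" using star_class_F_inject[OF n basis_x] ij by simp
  qed
  moreover have "\<sigma> ` {..<n} \<subseteq> {..<n}" using \<tau> by (auto simp: \<sigma>_def)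
  ultimately have "bij_betw \<sigma> {..<n} {..<n}" using endo_inj_surj[of "{..<n}" \<sigma>] by (simp add: bij_betw_def)
  then have perm: "\<sigma> permutes {..<n}" by (rule bij_imp_permutes) (simp add: \<sigma>_def)
  have bd: "basis (d \<circ> \<sigma>)" by (rule basis_permute[OF d(1) perm])
  have eq: "star_class k (d \<circ> \<sigma>) = f (star_class k x)" if "k \<le> n" for k
    using star_class_permute[OF n that d(1) perm HOL.refl] \<tau>[of k] d(2) that by (cases "k = n") (auto simp: \<sigma>_def)
  obtain \<psi> where \<psi>: "\<psi> \<in> iso G G" "\<And>j. j < n \<Longrightarrow> (d \<circ> \<sigma>) j = \<psi> (x j)" using basisE[OF bd] by blast
  have "matched x (d \<circ> \<sigma>)" unfolding matched_def using basis_x bd eq by simp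
  then have "matched x (\<psi> \<circ> x)" by (rule matched_cong) (simp_all add: \<psi>(2)[symmetric])
  then show ?thesis by (rule that[OF \<psi>(1)])
qed

section \<open>Existence and uniqueness of the outer automorphism\<close>

lemma iso_inverse:
  assumes "\<psi> \<in> iso G G"
  shows "\<exists>\<phi>\<in>iso G G. (\<forall>g\<in>carrier G. \<phi> (\<psi> g) = g) \<and> (\<forall>g\<in>carrier G. \<psi> (\<phi> g) = g)"
proof (rule bexI[of _ "inv_into (carrier G) \<psi>"])
  show "inv_into (carrier G) \<psi> \<in> iso G G" using assms by (rule iso_set_sym)
qed (use assms in \<open>simp add: iso_def bij_betw_def f_inv_into_f\<close>)

lemma induced_by_Out: "\<exists>\<gamma>\<in>carrier (Out G). \<forall>y\<in>L_verts n. f y = Out_act n \<gamma> y"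
proof -
  obtain \<psi> where \<psi>: "\<psi> \<in> iso G G" "matched x (\<psi> \<circ> x)" by (rule base_matched)
  \<comment> \<open>The action precomposes markings, so it is the inverse of \<open>\<psi>\<close>
    that takes the star of \<open>b\<close> to the star of \<open>\<psi> \<circ> b\<close>.\<close>
  obtain \<phi> where \<phi>: "\<phi> \<in> iso G G" "\<And>g. g \<in> carrier G \<Longrightarrow> \<phi> (\<psi> g) = g"
    using iso_inverse[OF \<psi>(1)] by metis
  have act: "f (star_class k b) = Out_act n (out_class \<phi>) (star_class k b)" if k: "k \<le> n" and b: "basis b" for k b
  proof -
    obtain \<sigma> where \<sigma>: "\<sigma> permutes {..<n}" "connected_to_x (b \<circ> \<sigma>)" by (rule connected_to_x_exists[OF b])
    define k' where "k' = inv_into UNIV \<sigma> k"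
    have k': "\<sigma> k' = k" by (simp add: k'_def permutes_inverses[OF \<sigma>(1)])
    have "k' \<le> n"
      using k' k permutes_in_image[OF \<sigma>(1), of k'] permutes_not_in[OF \<sigma>(1), of k'] by (cases "k' < n") auto
    have eq: "star_class k b = star_class k' (b \<circ> \<sigma>)"
      using star_class_permute[OF n \<open>k' \<le> n\<close> b \<sigma>(1) k'] by simp
    have m: "matched (b \<circ> \<sigma>) (\<psi> \<circ> (b \<circ> \<sigma>))" by (rule matched_connected[OF \<psi> \<sigma>(2)])
    then have "f (star_class k' (b \<circ> \<sigma>)) = star_class k' (\<psi> \<circ> (b \<circ> \<sigma>))" "basis (b \<circ> \<sigma>)"
      using m \<open>k' \<le> n\<close> unfolding matched_def by blast+
    then show ?thesis
      unfolding eq using Out_act_star_class[OF n \<open>k' \<le> n\<close> _ \<phi>(1) \<psi>(1) \<phi>(2)] by simp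
  qed
  have "f y = Out_act n (out_class \<phi>) y" if "y \<in> L_verts n" for y
    using that act zero_stars_eq[OF n3] F_stars_eq[OF n3] unfolding L_verts_def by fastforce
  moreover have "out_class \<phi> \<in> carrier (Out G)" using \<phi>(1) by (simp add: carrier_Out)
  ultimately show ?thesis by blast
qed

text \<open>Equality on the {0}-star of \<open>x\<close> makes the two images of \<open>x\<close>
  conjugate up to a permutation \<open>\<sigma>\<close>. Equality on its neighbours forces
  \<open>\<sigma>\<close> to be trivial, as different distinguished members give different
  \<open>F\<close>-stars. So the two automorphisms differ by an inner one.\<close>

lemma Out_act_faithful:
  assumes "\<gamma> \<in> carrier (Out G)" "\<gamma>' \<in> carrier (Out G)"
    and eq: "\<forall>y\<in>L_verts n. Out_act n \<gamma> y = Out_act n \<gamma>' y"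
  shows "\<gamma> = \<gamma>'"
proof -
  obtain \<phi> \<phi>' where \<phi>: "\<phi> \<in> iso G G" "\<gamma> = out_class \<phi>" "\<phi>' \<in> iso G G" "\<gamma>' = out_class \<phi>'"
    using assms(1,2) carrier_Out by auto
  obtain \<psi> where \<psi>: "\<psi> \<in> iso G G" "\<And>g. g \<in> carrier G \<Longrightarrow> \<psi> (\<phi> g) = g" "\<And>g. g \<in> carrier G \<Longrightarrow> \<phi> (\<psi> g) = g"
    using iso_inverse[OF \<phi>(1)] by metis
  obtain \<psi>' where \<psi>': "\<psi>' \<in> iso G G" "\<And>g. g \<in> carrier G \<Longrightarrow> \<psi>' (\<phi>' g) = g" "\<And>g. g \<in> carrier G \<Longrightarrow> \<phi>' (\<psi>' g) = g"
    using iso_inverse[OF \<phi>(3)] by metis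
  have b: "basis (\<psi> \<circ> x)" "basis (\<psi>' \<circ> x)" using basis_image[OF basis_x] \<psi>(1) \<psi>'(1) by blast+
  have same: "star_class k (\<psi> \<circ> x) = star_class k (\<psi>' \<circ> x)" if k: "k \<le> n" for k
    using eq Out_act_star_class[OF n k basis_x \<phi>(1) \<psi>(1,3)] Out_act_star_class[OF n k basis_x \<phi>(3) \<psi>'(1,3)]
      star_L[OF basis_x k] \<phi>(2,4) by simp
  have "star_equiv n (\<psi> \<circ> x) n (\<psi>' \<circ> x)" using same[of n] star_class_eq_iff[OF n order.refl b(1)] by simp
  then obtain \<sigma> g where s: "\<sigma> permutes {..<n}" "g \<in> carrier G"
    "\<And>j. j < n \<Longrightarrow> \<psi>' (x j) = g \<otimes> partial_conj n {} (\<psi> \<circ> x) (\<sigma> j) \<otimes> inv g"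
    unfolding star_equiv_def by auto
  have lt: "\<sigma> j < n" if "j < n" for j using permutes_in_image[OF s(1), of j] that by simp
  have \<sigma>: "\<sigma> i = i" if i: "i < n" for i
  proof -
    have "star_class i (\<psi>' \<circ> x) = star_class i ((\<psi> \<circ> x) \<circ> \<sigma>)"
      by (rule star_class_conj[OF n _ basis_permute[OF b(1) s(1)] s(2), THEN HOL.sym])
        (use i s(3) in \<open>simp_all add: partial_conj_def\<close>)
    also have "\<dots> = star_class (\<sigma> i) (\<psi> \<circ> x)" by (rule star_class_permute[OF n _ b(1) s(1)]) (use i in simp_all)
    finally have "star_class (\<sigma> i) (\<psi> \<circ> x) = star_class i (\<psi> \<circ> x)" using same[of i] i by simp
    then show ?thesis using star_class_F_inject[OF n b(1)] i lt[OF i] by simp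
  qed
  have \<psi>'_eq: "\<psi>' h = g \<otimes> \<psi> h \<otimes> inv g" if h: "h \<in> carrier G" for h
  proof -
    have "\<psi>' h = ((\<lambda>h. g \<otimes> h \<otimes> inv g) \<circ> \<psi>) h"
      by (rule hom_ext[OF is_group iso_imp_homomorphism[OF \<psi>'(1)]
          iso_imp_homomorphism[OF iso_set_trans[OF \<psi>(1) conj_iso[OF s(2)]]] _ h])
        (use s(3) \<sigma> in \<open>simp add: partial_conj_def\<close>)
    then show ?thesis by simp
  qed
  have hom: "\<phi> \<in> hom G G" "\<phi>' \<in> hom G G" using \<phi> by (simp_all add: iso_def)
  interpret \<phi>: group_hom G G \<phi> using hom(1) is_group by (simp add: group_hom_def group_hom_axioms_def)
  have cl: "\<phi> h \<in> carrier G" "\<phi>' h \<in> carrier G" "\<psi> h \<in> carrier G" if "h \<in> carrier G" for h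
    using that hom_in_carrier[OF hom(1)] hom_in_carrier[OF hom(2)] hom_in_carrier[OF iso_imp_homomorphism[OF \<psi>(1)]] by simp_all
  have "\<phi> h = \<phi> g \<otimes> \<phi>' h \<otimes> inv \<phi> g" if h: "h \<in> carrier G" for h
  proof -
    have "h = g \<otimes> \<psi> (\<phi>' h) \<otimes> inv g" using \<psi>'_eq[of "\<phi>' h"] \<psi>'(2)[OF h] cl(2)[OF h] by simp
    then have "\<phi> h = \<phi> (g \<otimes> \<psi> (\<phi>' h) \<otimes> inv g)" by simp
    also have "\<dots> = \<phi> g \<otimes> \<phi> (\<psi> (\<phi>' h)) \<otimes> inv \<phi> g" using s(2) cl h by simp
    finally show ?thesis using \<psi>(3) cl h by simp
  qed
  then show ?thesis unfolding \<phi>(2,4) using out_class_eqI[OF \<phi>(3) cl(1)[OF s(2)]] by blast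
qed

end

theorem theorem3p1:
  fixes n :: nat and f :: "marked_gog set \<Rightarrow> marked_gog set"
  assumes "n \<ge> 4"
    and "graph_automorphism (L_verts n) (L_edges n) f"
    and "f ` zero_stars n = zero_stars n"
    and "f ` F_stars n = F_stars n"
  shows "\<exists>!\<gamma>. \<gamma> \<in> carrier (Out (W n)) \<and> (\<forall>x\<in>L_verts n. f x = Out_act n \<gamma> x)"
proof -
  interpret star_graph_automorphism n "W n" f
    by unfold_locales (use assms in simp_all)
  from induced_by_Out obtain \<gamma> where \<gamma>: "\<gamma> \<in> carrier (Out (W n))" "\<forall>y\<in>L_verts n. f y = Out_act n \<gamma> y"
    by blast
  show ?thesis
    by (rule ex1I[of _ \<gamma>]) (use \<gamma> Out_act_faithful in auto)
qed
end
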